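(* Suppose $\lambda\in\mathbb{C}\setminus\Lambda$. Let $u$ be a balanced solution of $Ju'+qu=\lambda wu$ on $(0,b)$ and define $v^-(x)=\tau(x,\overline{\lambda})\,\overline{u^-(x)}$ for $x\in(0,b)$. Then $v$, the balanced version of $v^-$ (that is, $v(x)=\frac12\big(v^-(x)+\lim_{t\downarrow x}v^-(t)\big)$), satisfies $Jv'+qv=\overline{\lambda}wv$ and $v(0)=\overline{u(0)}$.
   Context: Let $0<b\le\infty$ and $J=\begin{pmatrix}0&-1\\1&0\end{pmatrix}$. Let $q,w$ be $2\times2$ matrices whose entries are distributions of order $0$ on $(0,b)$, equivalently local complex measures on $(0,b)$ (complex measures when restricted to compact subsets of $(0,b)$). Here $q$ is Hermitian ($q=q^*$; off-diagonal entries may be non-real), and $w$ is non-negative (a matrix-valued measure with $w(E)\ge0$ as a Hermitian matrix) and not identically $0$. The endpoint $0$ is regular: $q$ and $w$ are finite measures on $(0,c)$ for each $c\in(0,b)$. For a function $u$ of locally bounded variation put $u^-(x)=\lim_{t\uparrow x}u(t)$ and $u^+(x)=\lim_{t\downarrow x}u(t)$; $u$ is balanced if $u=\frac12(u^-+u^+)$. A solution of $Ju'+qu=\lambda wu$ is a balanced function $u:(0,b)\to\mathbb{C}^2$ of locally bounded variation satisfying the equation as an identity of local measures ($u'$ is the Lebesgue–Stieltjes measure generated by $u$), and $u(0)=\lim_{x\downarrow0}u(x)$. Let $\Delta_q(x)=q(\{x\})$, $\Delta_w(x)=w(\{x\})$, $B_\pm(x,\lambda)=J\pm\frac12(\Delta_q(x)-\lambda\Delta_w(x))$,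 and $\Lambda=\{\lambda\in\mathbb{C}:\exists x\in(0,b):\det B_+(x,\lambda)\det B_-(x,\lambda)=0\}$. It is assumed throughout that $\Lambda\ne\mathbb{C}$. The set $\Lambda$ is symmetric with respect to the real axis. Let $(x_n)$ enumerate the (at most countably many) points of $(0,b)$ at which $\Delta_q$ or $\Delta_w$ is different from $0$. For $\lambda\notin\Lambda$ and $x\in[0,b)$ set $P(x,\lambda)=\prod_{x_n\in(0,x)}\frac{\det B_-(x_n,\lambda)}{\det B_+(x_n,\lambda)}$ (empty products are $1$; the product converges independently of the order of the factors to a non-zero number) and $$\tau(x,\lambda)=P(x,\lambda)\exp\Big(2\mathrm{i}\int_{(0,x)}\big(\operatorname{Im}(q_{c,12})-\lambda\operatorname{Im}(w_{c,12})\big)\Big),$$ where $q_{c,12}$ and $w_{c,12}$ are the continuous (atom-free) parts of the local measures $q_{12}$ and $w_{12}$. *)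

theory Defs
  imports "HOL-Analysis.Analysis"
begin

section \<open>Vector-valued measures and integration\<close>

text \<open>
  A \<open>'a\<close>-valued measure on a Borel set \<open>X\<close> is a countably additive function on the Borel subsets
  of \<open>X\<close>; for finite-dimensional \<open>'a\<close> it has finite total variation automatically. Measures are
  represented by total set functions whose values at all other sets are ignored, so that one
  function can serve as a measure on many sets \<open>X\<close> at once. That the empty set has measure 0
  follows by taking all \<open>A n\<close> empty.
\<close>

definition measure_on :: "real set \<Rightarrow> (real set \<Rightarrow> 'a::real_normed_vector) \<Rightarrow> bool" where
  "measure_on X \<mu> \<longleftrightarrow>
     (\<forall>A :: nat \<Rightarrow> real set.
        disjoint_family A \<and> (\<forall>n. A n \<in> sets borel \<and> A n \<subseteq> X) \<longrightarrow>
        (\<lambda>n. \<mu> (A n)) sums \<mu> (\<Union>n. A n))"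

definition ival :: "ereal \<Rightarrow> real set" where
  "ival b = {x. 0 < x \<and> ereal x < b}"

definition local_sets :: "ereal \<Rightarrow> real set set" where
  "local_sets b = {E \<in> sets borel. \<exists>s\<in>ival b. \<exists>t\<in>ival b. E \<subseteq> {s..t}}"

definition local_measure :: "ereal \<Rightarrow> (real set \<Rightarrow> 'a::real_normed_vector) \<Rightarrow> bool" where
  "local_measure b \<mu> \<longleftrightarrow> (\<forall>s\<in>ival b. \<forall>t\<in>ival b. measure_on {s..t} \<mu>)"

definition finite_near_0 :: "ereal \<Rightarrow> (real set \<Rightarrow> 'a::real_normed_vector) \<Rightarrow> bool" where
  "finite_near_0 b \<mu> \<longleftrightarrow> (\<forall>c\<in>ival b. measure_on {0<..<c} \<mu>)"

text \<open>
  The positive part of the Jordan decomposition of the real measure \<open>\<rho>\<close> on \<open>X\<close>. Clipping of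
  negative values by \<^const>\<open>ennreal\<close> is harmless because \<open>B = {}\<close> takes part in the supremum.
\<close>

definition positive_part :: "real set \<Rightarrow> (real set \<Rightarrow> real) \<Rightarrow> real measure" where
  "positive_part X \<rho> =
     measure_of X {A \<in> sets borel. A \<subseteq> X}
       (\<lambda>A. SUP B\<in>{B \<in> sets borel. B \<subseteq> A}. ennreal (\<rho> B))"

definition integral_real :: "real set \<Rightarrow> (real set \<Rightarrow> real) \<Rightarrow> (real \<Rightarrow> complex) \<Rightarrow> complex" where
  "integral_real X \<rho> f =
     integral\<^sup>L (positive_part X \<rho>) f - integral\<^sup>L (positive_part X (\<lambda>A. - \<rho> A)) f"

definition integral_complex :: "real set \<Rightarrow> (real set \<Rightarrow> complex) \<Rightarrow> (real \<Rightarrow> complex) \<Rightarrow> complex"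
  where
  "integral_complex X \<mu> f =
     integral_real X (\<lambda>A. Re (\<mu> A)) f + \<i> * integral_real X (\<lambda>A. Im (\<mu> A)) f"

definition entry :: "(real set \<Rightarrow> complex^2^2) \<Rightarrow> 2 \<Rightarrow> 2 \<Rightarrow> real set \<Rightarrow> complex" where
  "entry m i j E = m E $ i $ j"

text \<open>The value of the \<open>\<complex>\<^sup>2\<close>-valued measure \<open>m u\<close> at the set \<open>E\<close>.\<close>

definition times_fun :: "(real set \<Rightarrow> complex^2^2) \<Rightarrow> (real \<Rightarrow> complex^2) \<Rightarrow> real set \<Rightarrow> complex^2"
  where
  "times_fun m u E = (\<chi> i. \<Sum>j\<in>UNIV. integral_complex E (entry m i j) (\<lambda>x. u x $ j))"

text \<open>The sum below has at most countably many non-zero terms and converges absolutely.\<close>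

definition continuous_part :: "(real set \<Rightarrow> complex) \<Rightarrow> real set \<Rightarrow> complex" where
  "continuous_part \<mu> E = \<mu> E - (\<Sum>\<^sub>\<infinity>x\<in>E. \<mu> {x})"

section \<open>Matrices\<close>

definition hermitian :: "complex^2^2 \<Rightarrow> bool" where
  "hermitian A \<longleftrightarrow> A = transpose (map_matrix cnj A)"

definition nonneg_hermitian :: "complex^2^2 \<Rightarrow> bool" where
  "nonneg_hermitian A \<longleftrightarrow>
     hermitian A \<and> (\<forall>z. 0 \<le> Re (\<Sum>i\<in>UNIV. cnj (z $ i) * (A *v z) $ i))"

definition J :: "complex^2^2" where
  "J = vector [vector [0, -1], vector [1, 0]]"

definition vec_cnj :: "complex^2 \<Rightarrow> complex^2" where
  "vec_cnj z = (\<chi> i. cnj (z $ i))"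

section \<open>Functions of locally bounded variation\<close>

definition bounded_variation_on :: "real \<Rightarrow> real \<Rightarrow> (real \<Rightarrow> 'a::real_normed_vector) \<Rightarrow> bool" where
  "bounded_variation_on s t f \<longleftrightarrow>
     (\<exists>K. \<forall>n (p :: nat \<Rightarrow> real).
        mono_on {..n} p \<and> p ` {..n} \<subseteq> {s..t} \<longrightarrow>
        (\<Sum>i<n. norm (f (p (Suc i)) - f (p i))) \<le> K)"

definition locally_bv :: "ereal \<Rightarrow> (real \<Rightarrow> 'a::real_normed_vector) \<Rightarrow> bool" where
  "locally_bv b f \<longleftrightarrow> (\<forall>s\<in>ival b. \<forall>t\<in>ival b. bounded_variation_on s t f)"

definition left_lim :: "(real \<Rightarrow> 'a::t2_space) \<Rightarrow> real \<Rightarrow> 'a" where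
  "left_lim f x = Lim (at_left x) f"

definition right_lim :: "(real \<Rightarrow> 'a::t2_space) \<Rightarrow> real \<Rightarrow> 'a" where
  "right_lim f x = Lim (at_right x) f"

definition balanced :: "ereal \<Rightarrow> (real \<Rightarrow> 'a::real_normed_vector) \<Rightarrow> bool" where
  "balanced b f \<longleftrightarrow> (\<forall>x\<in>ival b. f x = (1/2) *\<^sub>R (left_lim f x + right_lim f x))"

text \<open>
  \<open>du\<close> is the Lebesgue--Stieltjes measure generated by \<open>u\<close>; for \<open>u\<close> of locally bounded variation
  it exists and its values on \<^term>\<open>local_sets b\<close> are uniquely determined.
\<close>

definition stieltjes_measure ::
  "ereal \<Rightarrow> (real \<Rightarrow> 'a::real_normed_vector) \<Rightarrow> (real set \<Rightarrow> 'a) \<Rightarrow> bool" where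
  "stieltjes_measure b u du \<longleftrightarrow>
     local_measure b du \<and>
     (\<forall>s\<in>ival b. \<forall>t\<in>ival b. s < t \<longrightarrow> du {s<..t} = right_lim u t - right_lim u s)"

section \<open>The differential equation\<close>

definition solution ::
  "ereal \<Rightarrow> (real set \<Rightarrow> complex^2^2) \<Rightarrow> (real set \<Rightarrow> complex^2^2) \<Rightarrow> complex \<Rightarrow>
     (real \<Rightarrow> complex^2) \<Rightarrow> bool" where
  "solution b q w lam u \<longleftrightarrow>
     locally_bv b u \<and> balanced b u \<and>
     (\<exists>du. stieltjes_measure b u du \<and>
        (\<forall>E\<in>local_sets b. J *v du E + times_fun q u E = lam *s times_fun w u E))"

definition B_plus ::
  "(real set \<Rightarrow> complex^2^2) \<Rightarrow> (real set \<Rightarrow> complex^2^2) \<Rightarrow> real \<Rightarrow> complex \<Rightarrow> complex^2^2" where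
  "B_plus q w x lam = J + (1/2) *\<^sub>R (q {x} - map_matrix ((*) lam) (w {x}))"

definition B_minus ::
  "(real set \<Rightarrow> complex^2^2) \<Rightarrow> (real set \<Rightarrow> complex^2^2) \<Rightarrow> real \<Rightarrow> complex \<Rightarrow> complex^2^2" where
  "B_minus q w x lam = J - (1/2) *\<^sub>R (q {x} - map_matrix ((*) lam) (w {x}))"

definition Lambda ::
  "ereal \<Rightarrow> (real set \<Rightarrow> complex^2^2) \<Rightarrow> (real set \<Rightarrow> complex^2^2) \<Rightarrow> complex set" where
  "Lambda b q w = {lam. \<exists>x\<in>ival b. det (B_plus q w x lam) * det (B_minus q w x lam) = 0}"

definition atoms :: "(real set \<Rightarrow> complex^2^2) \<Rightarrow> (real set \<Rightarrow> complex^2^2) \<Rightarrow> real \<Rightarrow> real set" where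
  "atoms q w x = {y \<in> {0<..<x}. q {y} \<noteq> 0 \<or> w {y} \<noteq> 0}"

text \<open>
  The product over the atoms in \<open>(0, x)\<close> converges independently of the order of the factors; it is
  therefore taken as the limit of the finite subproducts, as for \<^const>\<open>infsum\<close>.
\<close>

definition P ::
  "(real set \<Rightarrow> complex^2^2) \<Rightarrow> (real set \<Rightarrow> complex^2^2) \<Rightarrow> real \<Rightarrow> complex \<Rightarrow> complex" where
  "P q w x lam =
     Lim (finite_subsets_at_top (atoms q w x))
       (\<lambda>F. \<Prod>y\<in>F. det (B_minus q w y lam) / det (B_plus q w y lam))"

definition tau ::
  "(real set \<Rightarrow> complex^2^2) \<Rightarrow> (real set \<Rightarrow> complex^2^2) \<Rightarrow> real \<Rightarrow> complex \<Rightarrow> complex" where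
  "tau q w x lam =
     P q w x lam *
     exp (2 * \<i> * (of_real (Im (continuous_part (entry q 1 2) {0<..<x}))
                  - lam * of_real (Im (continuous_part (entry w 1 2) {0<..<x}))))"

end

theory Submission
  imports Defs
begin

text \<open>
  Conjugating \<open>J u' + q u = \<lambda> w u\<close> replaces the Hermitian coefficients by their transposes, and
  \<open>q\<^sup>T = q + 2 \<i> Im q\<^sub>1\<^sub>2 J\<close>. Hence the conjugate of \<open>u\<close> solves the equation for \<open>cnj \<lambda>\<close> up to the term
  \<open>\<sigma> J\<close>, where \<open>\<sigma> = 2 \<i> (Im q\<^sub>1\<^sub>2 - cnj \<lambda> Im w\<^sub>1\<^sub>2)\<close> is a scalar measure. Away from the atoms this term is
  absorbed by the integrating factor \<open>exp (\<integral> \<sigma>)\<close>. At an atom the equation is the jump condition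
  \<open>B\<^sub>+ u\<^sup>+ = B\<^sub>- u\<^sup>-\<close>, and an identity between \<open>2 \<times> 2\<close> matrices shows that there the factor has to be
  multiplied by \<open>det B\<^sub>- / det B\<^sub>+\<close>, taken at \<open>cnj \<lambda>\<close>. The function \<open>\<tau>\<close> is the product of both corrections.

  The proof compares increments. The functions \<open>\<tau>\<close>, \<open>u\<close> and \<open>v\<close> are given by their one-sided limits,
  whose increments over an open interval \<open>I\<close> and jumps at a point \<open>x\<close> are at most \<open>K M(I)\<close> and \<open>K M{x}\<close>
  for one finite measure \<open>M\<close>, essentially the total variation of the coefficients (\<open>dominated\<close>). Two
  points then suffice.
  \<^item> The jumps of \<open>v\<close> are the ones that the equation demands, exactly (\<open>v_jump\<close>).
  \<^item> Over an open interval \<open>I\<close> the increment of \<open>v\<close> agrees with the one that the equation demands up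
    to an error of order \<open>M(I)\<^sup>2\<close> (\<open>v_quadratic\<close>).
  An additive interval function that vanishes at points and is of order \<open>M(I)\<^sup>2\<close> on open intervals is
  zero, since an interval can be cut at finitely many points into open intervals of arbitrarily small
  \<open>M\<close>-measure (\<open>interval_identity\<close>). So \<open>v\<close> is a solution.

  The second-order estimate needs only first-order information on \<open>\<tau>\<close>. Taking logarithms of the
  factors gives \<open>\<tau>(x) = exp (\<Phi>(0,x))\<close> with an additive set function \<open>\<Phi>\<close> (\<open>tau_exp_Phi\<close>), and
  \<open>\<Phi>(E) = \<sigma>(E) + O(M(E)\<^sup>2)\<close> because \<open>Ln (det B\<^sub>- / det B\<^sub>+) = \<sigma>{y} + O(M{y}\<^sup>2)\<close> at every atom \<open>y\<close>. That
  \<open>u\<close> is bounded near the regular endpoint, and therefore dominated and convergent there, is a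
  Gronwall argument (\<open>u_bounded\<close>).
\<close>

section \<open>Countably additive set functions\<close>

lemma measure_on_subset:
  assumes "measure_on X \<mu>" "Y \<subseteq> X" shows "measure_on Y \<mu>"
  using assms unfolding measure_on_def by (meson order_trans)

lemma measure_on_sums:
  assumes "measure_on X \<mu>" "disjoint_family A" "\<And>n. A n \<in> sets borel" "\<And>n. A n \<subseteq> X"
  shows "(\<lambda>n. \<mu> (A n)) sums \<mu> (\<Union>n. A n)"
  using assms unfolding measure_on_def by blast

lemma measure_on_cong:
  assumes "\<And>E. E \<in> sets borel \<Longrightarrow> E \<subseteq> X \<Longrightarrow> \<mu> E = \<nu> E" "measure_on X \<mu>"
  shows "measure_on X \<nu>"
  unfolding measure_on_def
proof (intro allI impI, elim conjE)
  fix A :: "nat \<Rightarrow> real set" assume A: "disjoint_family A" "\<forall>n. A n \<in> sets borel \<and> A n \<subseteq> X"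
  have "(\<lambda>n. \<mu> (A n)) sums \<mu> (\<Union>n. A n)"
    by (rule measure_on_sums[OF assms(2)]) (use A in auto)
  moreover have "\<mu> (A n) = \<nu> (A n)" "\<mu> (\<Union>n. A n) = \<nu> (\<Union>n. A n)" for n
    by (rule assms(1); use A in auto)+
  ultimately show "(\<lambda>n. \<nu> (A n)) sums \<nu> (\<Union>n. A n)" by simp
qed

lemma measure_on_empty:
  assumes "measure_on X \<mu>" shows "\<mu> {} = 0"
proof -
  have "(\<lambda>n::nat. \<mu> {}) sums \<mu> (\<Union>n::nat. {})"
    using assms by (rule measure_on_sums) (auto simp: disjoint_family_on_def)
  then show ?thesis using sums_summable summable_const_iff by blast
qed

lemma measure_on_Un:
  assumes "measure_on X \<mu>" "A \<in> sets borel" "B \<in> sets borel" "A \<subseteq> X" "B \<subseteq> X" "A \<inter> B = {}"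
  shows "\<mu> (A \<union> B) = \<mu> A + \<mu> B"
proof -
  have "(\<lambda>n. \<mu> (binaryset A B n)) sums \<mu> (\<Union>n. binaryset A B n)"
    using assms(1)
  proof (rule measure_on_sums)
    show "disjoint_family (binaryset A B)"
      using assms(6) by (auto simp: disjoint_family_on_def binaryset_def)
  qed (use assms in \<open>auto simp: binaryset_def\<close>)
  moreover have "(\<lambda>n. \<mu> (binaryset A B n)) sums (\<mu> A + \<mu> B)"
    by (rule binaryset_sums) (rule measure_on_empty[OF assms(1)])
  ultimately show ?thesis by (metis UN_binaryset_eq sums_unique2)
qed

lemma measure_on_Diff:
  assumes "measure_on X \<mu>" "A \<in> sets borel" "B \<in> sets borel" "A \<subseteq> B" "B \<subseteq> X"
  shows "\<mu> B = \<mu> A + \<mu> (B - A)"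
proof -
  have "A \<union> (B - A) = B" using assms(4) by auto
  then show ?thesis using measure_on_Un[OF assms(1), of A "B - A"] assms by auto
qed

lemma measure_on_Int:
  assumes "measure_on X \<mu>" "X \<in> sets borel"
  shows "measure_on UNIV (\<lambda>E. \<mu> (E \<inter> X))"
  unfolding measure_on_def
proof (intro allI impI, elim conjE)
  fix A :: "nat \<Rightarrow> real set" assume "disjoint_family A" "\<forall>n. A n \<in> sets borel \<and> A n \<subseteq> UNIV"
  then have "(\<lambda>n. \<mu> (A n \<inter> X)) sums \<mu> (\<Union>n. A n \<inter> X)"
    by (intro measure_on_sums[OF assms(1)]) (use assms(2) in \<open>auto simp: disjoint_family_on_def\<close>)
  moreover have "(\<Union>n. A n \<inter> X) = (\<Union>n. A n) \<inter> X" by auto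
  ultimately show "(\<lambda>n. \<mu> (A n \<inter> X)) sums \<mu> ((\<Union>n. A n) \<inter> X)" by simp
qed

lemma measure_on_bounded_linear:
  assumes "bounded_linear h" "measure_on X \<mu>" shows "measure_on X (\<lambda>E. h (\<mu> E))"
  using assms(2) unfolding measure_on_def
  by (intro allI impI bounded_linear.sums[OF assms(1)]) simp

lemma measure_on_add:
  assumes "measure_on X \<mu>" "measure_on X \<nu>" shows "measure_on X (\<lambda>E. \<mu> E + \<nu> E)"
  using assms unfolding measure_on_def by (intro allI impI sums_add) simp_all

lemma measure_on_diff:
  assumes "measure_on X \<mu>" "measure_on X \<nu>" shows "measure_on X (\<lambda>E. \<mu> E - \<nu> E)"
  using assms unfolding measure_on_def by (intro allI impI sums_diff) simp_all

lemma measure_on_sum: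
  assumes "\<And>i. i \<in> I \<Longrightarrow> measure_on X (\<mu> i)" shows "measure_on X (\<lambda>E. \<Sum>i\<in>I. \<mu> i E)"
  using assms unfolding measure_on_def by (intro allI impI sums_sum) simp

lemma measure_on_uminus:
  fixes \<rho> :: "real set \<Rightarrow> 'a::real_normed_vector"
  assumes "measure_on X \<rho>" shows "measure_on X (\<lambda>A. - \<rho> A)"
  using measure_on_bounded_linear[OF bounded_linear_minus[OF bounded_linear_ident] assms] by simp

section \<open>The Jordan decomposition\<close>

text \<open>
  The set function whose values \<^const>\<open>positive_part\<close> passes to \<^const>\<open>measure_of\<close>. It is kept apart
  from the carrier \<open>X\<close>, on which it does not depend.
\<close>

definition upper_variation :: "(real set \<Rightarrow> real) \<Rightarrow> real set \<Rightarrow> ennreal" where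
  "upper_variation \<rho> A = (SUP B\<in>{B \<in> sets borel. B \<subseteq> A}. ennreal (\<rho> B))"

lemma upper_variation_upper:
  "B \<in> sets borel \<Longrightarrow> B \<subseteq> A \<Longrightarrow> ennreal (\<rho> B) \<le> upper_variation \<rho> A"
  unfolding upper_variation_def by (rule SUP_upper) auto

lemma upper_variation_mono: "A \<subseteq> B \<Longrightarrow> upper_variation \<rho> A \<le> upper_variation \<rho> B"
  unfolding upper_variation_def by (rule SUP_subset_mono) auto

lemma upper_variation_empty:
  assumes "measure_on X \<rho>" shows "upper_variation \<rho> {} = 0"
proof -
  have "{B \<in> sets borel. B \<subseteq> {}} = {{} :: real set}" by auto
  then show ?thesis unfolding upper_variation_def using measure_on_empty[OF assms] by simp
qed

text \<open>
  Near-optimal subsets of \<open>A\<close> and of \<open>B\<close> can be united. If one of them has a negative value, it is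
  clipped to \<open>0\<close>, and the other subset alone suffices.
\<close>

lemma upper_variation_superadditive:
  assumes \<rho>: "measure_on X \<rho>" and "A \<subseteq> X" "B \<subseteq> X" "A \<inter> B = {}"
  shows "upper_variation \<rho> A + upper_variation \<rho> B \<le> upper_variation \<rho> (A \<union> B)"
proof -
  let ?S = "\<lambda>A. {C \<in> sets borel. C \<subseteq> A} :: real set set"
  have ne: "?S C \<noteq> {}" for C :: "real set" by blast
  have *: "ennreal (\<rho> C) + ennreal (\<rho> D) \<le> upper_variation \<rho> (A \<union> B)" if "C \<in> ?S A" "D \<in> ?S B" for C D
  proof (cases "\<rho> C \<ge> 0 \<and> \<rho> D \<ge> 0")
    case True
    have "\<rho> (C \<union> D) = \<rho> C + \<rho> D"
      using that assms by (intro measure_on_Un[OF \<rho>]) auto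
    then have "ennreal (\<rho> C) + ennreal (\<rho> D) = ennreal (\<rho> (C \<union> D))"
      using True by (simp add: ennreal_plus)
    also have "\<dots> \<le> upper_variation \<rho> (A \<union> B)"
      by (rule upper_variation_upper) (use that in auto)
    finally show ?thesis .
  next
    case False
    have "ennreal (\<rho> C) \<le> upper_variation \<rho> (A \<union> B)" "ennreal (\<rho> D) \<le> upper_variation \<rho> (A \<union> B)"
      by (rule upper_variation_upper; use that in auto)+
    moreover have "ennreal (\<rho> C) = 0 \<or> ennreal (\<rho> D) = 0"
      using False by (auto simp: ennreal_neg)
    ultimately show ?thesis by auto
  qed
  have "upper_variation \<rho> A + upper_variation \<rho> B = (SUP C\<in>?S A. ennreal (\<rho> C) + upper_variation \<rho> B)"
    unfolding upper_variation_def[of \<rho> A] by (rule ennreal_SUP_add_left[symmetric, OF ne])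
  also have "\<dots> \<le> upper_variation \<rho> (A \<union> B)"
  proof (rule SUP_least)
    fix C assume C: "C \<in> ?S A"
    have "ennreal (\<rho> C) + upper_variation \<rho> B = (SUP D\<in>?S B. ennreal (\<rho> C) + ennreal (\<rho> D))"
      unfolding upper_variation_def[of \<rho> B] by (subst ennreal_SUP_add_right[OF ne]) (rule refl)
    also have "\<dots> \<le> upper_variation \<rho> (A \<union> B)"
      by (rule SUP_least) (use * C in blast)
    finally show "ennreal (\<rho> C) + upper_variation \<rho> B \<le> upper_variation \<rho> (A \<union> B)" .
  qed
  finally show ?thesis .
qed

lemma ennreal_sum_le: "ennreal (sum f I) \<le> (\<Sum>i\<in>I. ennreal (f i))"
proof (induction I rule: infinite_finite_induct)
  case (insert x F)
  have "ennreal (a + b) \<le> ennreal a + ennreal b" for a b :: real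
  proof (cases "0 \<le> a \<and> 0 \<le> b")
    case False
    then have "ennreal (a + b) \<le> ennreal (max a b)" "ennreal (max a b) \<le> ennreal a + ennreal b"
      by (auto intro!: ennreal_leI simp: max_def ennreal_neg)
    then show ?thesis by (rule order_trans)
  qed (simp add: ennreal_plus)
  then have "ennreal (sum f (insert x F)) \<le> ennreal (f x) + ennreal (sum f F)"
    using insert by simp
  also have "\<dots> \<le> ennreal (f x) + (\<Sum>i\<in>F. ennreal (f i))"
    using insert by (intro add_left_mono)
  finally show ?case using insert by simp
qed auto

lemma upper_variation_countably_additive:
  assumes \<rho>: "measure_on X \<rho>" and A: "disjoint_family A" "\<And>n. A n \<in> sets borel" "\<And>n. A n \<subseteq> X"
  shows "(\<Sum>n. upper_variation \<rho> (A n)) = upper_variation \<rho> (\<Union>n. A n)"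
proof (rule antisym)
  have "(\<Sum>i<n. upper_variation \<rho> (A i)) \<le> upper_variation \<rho> (\<Union>i<n. A i)" for n
  proof (induction n)
    case 0
    then show ?case by simp
  next
    case (Suc n)
    have "(\<Sum>i<Suc n. upper_variation \<rho> (A i))
        \<le> upper_variation \<rho> (\<Union>i<n. A i) + upper_variation \<rho> (A n)"
      using Suc by (simp add: add_right_mono)
    also have "\<dots> \<le> upper_variation \<rho> ((\<Union>i<n. A i) \<union> A n)"
    proof (rule upper_variation_superadditive[OF \<rho>])
      have "A i \<inter> A n = {}" if "i < n" for i
        using A(1) that by (auto simp: disjoint_family_on_def)
      then show "(\<Union>i<n. A i) \<inter> A n = {}" by auto
    qed (use A(3) in auto)
    also have "(\<Union>i<n. A i) \<union> A n = (\<Union>i<Suc n. A i)" by (auto simp: less_Suc_eq)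
    finally show ?case .
  qed
  then have "(\<Sum>i<n. upper_variation \<rho> (A i)) \<le> upper_variation \<rho> (\<Union>i. A i)" for n
    by (rule order_trans) (rule upper_variation_mono, auto)
  then show "(\<Sum>n. upper_variation \<rho> (A n)) \<le> upper_variation \<rho> (\<Union>n. A n)"
    by (intro suminf_le_const) auto
next
  show "upper_variation \<rho> (\<Union>n. A n) \<le> (\<Sum>n. upper_variation \<rho> (A n))"
    unfolding upper_variation_def[of \<rho> "\<Union>n. A n"]
  proof (rule SUP_least)
    fix B assume B: "B \<in> {B \<in> sets borel. B \<subseteq> (\<Union>n. A n)}"
    have "(\<lambda>n. \<rho> (B \<inter> A n)) sums \<rho> (\<Union>n. B \<inter> A n)"
    proof (rule measure_on_sums[OF \<rho>])
      show "disjoint_family (\<lambda>n. B \<inter> A n)" using A(1) by (auto simp: disjoint_family_on_def)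
      show "B \<inter> A n \<subseteq> X" for n using A(3) by blast
    qed (use A B in auto)
    also have "(\<Union>n. B \<inter> A n) = B" using B by auto
    finally have "(\<lambda>n. ennreal (\<Sum>i<n. \<rho> (B \<inter> A i))) \<longlonglongrightarrow> ennreal (\<rho> B)"
      unfolding sums_def by (rule tendsto_ennrealI)
    then show "ennreal (\<rho> B) \<le> (\<Sum>n. upper_variation \<rho> (A n))"
    proof (rule LIMSEQ_le_const2, intro exI allI impI)
      fix n
      have "ennreal (\<Sum>i<n. \<rho> (B \<inter> A i)) \<le> (\<Sum>i<n. ennreal (\<rho> (B \<inter> A i)))"
        by (rule ennreal_sum_le)
      also have "\<dots> \<le> (\<Sum>i<n. upper_variation \<rho> (A i))"
        by (rule sum_mono, rule upper_variation_upper) (use A B in auto)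
      also have "\<dots> \<le> (\<Sum>n. upper_variation \<rho> (A n))"
        by (rule sum_le_suminf) auto
      finally show "ennreal (\<Sum>i<n. \<rho> (B \<inter> A i)) \<le> (\<Sum>n. upper_variation \<rho> (A n))" .
    qed
  qed
qed

lemma upper_variation_Diff:
  assumes \<rho>: "measure_on X \<rho>" and A: "A \<in> sets borel" "E \<in> sets borel" "A \<subseteq> E" "E \<subseteq> X"
  shows "upper_variation \<rho> E = upper_variation \<rho> A + upper_variation \<rho> (E - A)"
proof -
  have "(\<Sum>n. upper_variation \<rho> (binaryset A (E - A) n)) = upper_variation \<rho> (\<Union>n. binaryset A (E - A) n)"
  proof (rule upper_variation_countably_additive[OF \<rho>])
    show "disjoint_family (binaryset A (E - A))"
      by (auto simp: disjoint_family_on_def binaryset_def)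
    show "binaryset A (E - A) n \<in> sets borel" "binaryset A (E - A) n \<subseteq> X" for n
      using A by (auto simp: binaryset_def)
  qed
  moreover have "(\<Sum>n. upper_variation \<rho> (binaryset A (E - A) n)) = upper_variation \<rho> A + upper_variation \<rho> (E - A)"
    by (rule suminf_binaryset_eq) (rule upper_variation_empty[OF \<rho>])
  moreover have "A \<union> (E - A) = E" using A by auto
  ultimately show ?thesis by (simp only: UN_binaryset_eq)
qed

text \<open>
  Choose \<open>A \<subseteq> E\<close> with \<open>\<rho> A > \<bar>\<rho> E\<bar> + 1\<close>. Then both \<open>A\<close> and \<open>E - A\<close> have a value of modulus at least \<open>1\<close>, and
  by additivity one of them has infinite upper variation again.
\<close>

lemma upper_variation_split_infinite:
  assumes \<rho>: "measure_on X \<rho>" and E: "E \<in> sets borel" "E \<subseteq> X" and inf: "upper_variation \<rho> E = \<infinity>"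
  shows "\<exists>F\<in>sets borel. F \<subseteq> E \<and> upper_variation \<rho> F = \<infinity> \<and> \<bar>\<rho> (E - F)\<bar> \<ge> 1"
proof -
  have "ennreal (\<bar>\<rho> E\<bar> + 1) < upper_variation \<rho> E" unfolding inf infinity_ennreal_def by (rule ennreal_less_top)
  then obtain A where A: "A \<in> sets borel" "A \<subseteq> E" "ennreal (\<bar>\<rho> E\<bar> + 1) < ennreal (\<rho> A)"
    unfolding upper_variation_def less_SUP_iff by auto
  have nonneg: "0 \<le> \<bar>\<rho> E\<bar> + 1" by simp
  from A(3) have large: "\<bar>\<rho> E\<bar> + 1 < \<rho> A"
    unfolding ennreal_less_iff[OF nonneg] .
  have split: "\<rho> E = \<rho> A + \<rho> (E - A)"
    by (rule measure_on_Diff[OF \<rho>]) (use A E in auto)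
  have "upper_variation \<rho> A + upper_variation \<rho> (E - A) = \<infinity>"
    using upper_variation_Diff[OF \<rho> A(1) E(1) A(2) E(2)] inf by (rule subst)
  then consider "upper_variation \<rho> A = \<infinity>" | "upper_variation \<rho> (E - A) = \<infinity>"
    unfolding infinity_ennreal_def ennreal_add_eq_top by blast
  then show ?thesis
  proof cases
    case 1
    have "\<bar>\<rho> (E - A)\<bar> \<ge> 1" using large split by linarith
    with 1 A show ?thesis by blast
  next
    case 2
    have "E - (E - A) = A" using A by auto
    moreover have "\<bar>\<rho> A\<bar> \<ge> 1" using large by linarith
    moreover have "E - A \<in> sets borel" using A E by auto
    ultimately show ?thesis using 2 by (intro bexI[of _ "E - A"]) auto
  qed
qed

text \<open>
  Otherwise repeated splitting produces infinitely many disjoint sets on which \<open>\<bar>\<rho>\<bar> \<ge> 1\<close>, although the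
  values of \<open>\<rho>\<close> on disjoint sets form a convergent series.
\<close>

lemma upper_variation_finite:
  assumes \<rho>: "measure_on X \<rho>" and X: "X \<in> sets borel"
  shows "upper_variation \<rho> X < \<infinity>"
proof (rule ccontr)
  assume "\<not> ?thesis"
  then have inf: "upper_variation \<rho> X = \<infinity>" by (simp add: less_top[symmetric])
  define bad where "bad E \<longleftrightarrow> E \<in> sets borel \<and> E \<subseteq> X \<and> upper_variation \<rho> E = \<infinity>" for E
  obtain g where g: "bad (g E)" "g E \<subseteq> E" "\<bar>\<rho> (E - g E)\<bar> \<ge> 1" if "bad E" for E
  proof -
    have "\<forall>E. \<exists>F. bad E \<longrightarrow> bad F \<and> F \<subseteq> E \<and> \<bar>\<rho> (E - F)\<bar> \<ge> 1"
      using upper_variation_split_infinite[OF \<rho>] unfolding bad_def by (meson order_trans)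
    then show ?thesis using that by metis
  qed
  define F where "F n = (g ^^ n) X" for n
  have bad: "bad (F n)" for n
    by (induction n) (use X inf g in \<open>auto simp: F_def bad_def\<close>)
  have FS: "F (Suc n) = g (F n)" for n by (simp add: F_def)
  have "decseq F"
    by (rule decseq_SucI) (simp add: FS g bad)
  have "(\<lambda>n. \<rho> (F n - F (Suc n))) sums \<rho> (\<Union>n. F n - F (Suc n))"
  proof (rule measure_on_sums[OF \<rho>])
    show "disjoint_family (\<lambda>n. F n - F (Suc n))"
    proof -
      have "(F m - F (Suc m)) \<inter> (F n - F (Suc n)) = {}" if "m < n" for m n
        using decseqD[OF \<open>decseq F\<close>, of "Suc m" n] that by auto
      then show ?thesis unfolding disjoint_family_on_def by (metis Int_commute linorder_neqE_nat)
    qed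
  qed (use bad in \<open>auto simp: bad_def\<close>)
  then have "(\<lambda>n. \<rho> (F n - F (Suc n))) \<longlonglongrightarrow> 0"
    using sums_summable summable_LIMSEQ_zero by blast
  then have "eventually (\<lambda>n. \<bar>\<rho> (F n - F (Suc n))\<bar> < 1) sequentially"
    by (drule_tac tendstoD[where e=1]) auto
  then show False using g(3)[OF bad] FS by (auto simp: eventually_sequentially not_less[symmetric])
qed

lemma sigma_algebra_borel_subsets:
  "X \<in> sets borel \<Longrightarrow> sigma_algebra X {A \<in> sets borel. A \<subseteq> (X :: real set)}"
proof -
  assume X: "X \<in> sets borel"
  have "{A \<in> sets borel. A \<subseteq> X} = sets (restrict_space borel X)"
    using X by (auto simp: sets_restrict_space_iff)
  then show ?thesis
    using sets.sigma_algebra_axioms[of "restrict_space borel X"] by (simp add: space_restrict_space)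
qed

lemma
  assumes "X \<in> sets borel"
  shows space_positive_part: "space (positive_part X \<rho>) = X"
    and sets_positive_part: "sets (positive_part X \<rho>) = {A \<in> sets borel. A \<subseteq> X}"
proof -
  interpret sigma_algebra X "{A \<in> sets borel. A \<subseteq> X}" by (rule sigma_algebra_borel_subsets[OF assms])
  show "space (positive_part X \<rho>) = X" "sets (positive_part X \<rho>) = {A \<in> sets borel. A \<subseteq> X}"
    unfolding positive_part_def
    by (simp_all add: space_measure_of_conv sets_measure_of_conv space_closed sigma_sets_eq)
qed

lemma emeasure_positive_part:
  assumes X: "X \<in> sets borel" and \<rho>: "measure_on X \<rho>" and A: "A \<in> sets borel" "A \<subseteq> X"
  shows "emeasure (positive_part X \<rho>) A = upper_variation \<rho> A"
proof -
  have eq: "positive_part X \<rho> = measure_of X {A \<in> sets borel. A \<subseteq> X} (upper_variation \<rho>)"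
    unfolding positive_part_def upper_variation_def by (rule refl)
  show ?thesis unfolding eq
  proof (rule emeasure_measure_of_sigma)
    show "sigma_algebra X {A \<in> sets borel. A \<subseteq> X}" by (rule sigma_algebra_borel_subsets[OF X])
    show "positive {A \<in> sets borel. A \<subseteq> X} (upper_variation \<rho>)"
      by (simp add: positive_def upper_variation_empty[OF \<rho>])
    show "countably_additive {A \<in> sets borel. A \<subseteq> X} (upper_variation \<rho>)"
      unfolding countably_additive_def
      by (auto intro!: upper_variation_countably_additive[OF \<rho>])
  qed (use A in auto)
qed

lemma finite_measure_positive_part:
  assumes X: "X \<in> sets borel" and \<rho>: "measure_on X \<rho>"
  shows "finite_measure (positive_part X \<rho>)"
proof (rule finite_measureI)
  show "emeasure (positive_part X \<rho>) (space (positive_part X \<rho>)) \<noteq> \<infinity>"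
    using upper_variation_finite[OF \<rho> X] by (simp add: space_positive_part X emeasure_positive_part \<rho>)
qed

lemma positive_part_restrict:
  assumes X: "X \<in> sets borel" and \<rho>: "measure_on X \<rho>" and E: "E \<in> sets borel" "E \<subseteq> X"
  shows "positive_part E \<rho> = restrict_space (positive_part X \<rho>) E"
proof (rule measure_eqI)
  show "sets (positive_part E \<rho>) = sets (restrict_space (positive_part X \<rho>) E)"
    using E X by (auto simp: sets_positive_part sets_restrict_space_iff space_positive_part)
  fix A assume "A \<in> sets (positive_part E \<rho>)"
  then have A: "A \<in> sets borel" "A \<subseteq> E" using E by (auto simp: sets_positive_part)
  then show "emeasure (positive_part E \<rho>) A = emeasure (restrict_space (positive_part X \<rho>) E) A"
    using E X measure_on_subset[OF \<rho> E(2)] \<rho>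
    by (subst emeasure_restrict_space)
       (auto simp: emeasure_positive_part sets_positive_part space_positive_part)
qed

text \<open>
  Since the upper variation of a measure is finite, nothing is lost by taking real values.
\<close>

definition upper_var :: "(real set \<Rightarrow> real) \<Rightarrow> real set \<Rightarrow> real" where
  "upper_var \<rho> A = enn2real (upper_variation \<rho> A)"

lemma measure_positive_part:
  assumes X: "X \<in> sets borel" and \<rho>: "measure_on X \<rho>" and A: "A \<in> sets borel" "A \<subseteq> X"
  shows "measure (positive_part X \<rho>) A = upper_var \<rho> A"
  unfolding measure_def upper_var_def by (simp add: emeasure_positive_part assms)

lemma measure_on_measure:
  assumes "finite_measure N" "\<And>A. A \<in> sets borel \<Longrightarrow> A \<subseteq> X \<Longrightarrow> A \<in> sets N"
  shows "measure_on X (measure N)"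
  unfolding measure_on_def
  using assms by (auto intro!: finite_measure.finite_measure_UNION)

lemma measure_on_upper_var:
  assumes X: "X \<in> sets borel" and \<rho>: "measure_on X \<rho>"
  shows "measure_on X (upper_var \<rho>)"
proof -
  have "measure_on X (measure (positive_part X \<rho>))"
    by (rule measure_on_measure) (auto simp: finite_measure_positive_part assms sets_positive_part)
  then show ?thesis
    unfolding measure_on_def
  proof (intro allI impI, elim allE impE)
    fix A :: "nat \<Rightarrow> real set" assume "disjoint_family A \<and> (\<forall>n. A n \<in> sets borel \<and> A n \<subseteq> X)"
    then have A: "A n \<in> sets borel" "A n \<subseteq> X" "(\<Union>n. A n) \<in> sets borel" "(\<Union>n. A n) \<subseteq> X" for n by auto
    assume "(\<lambda>n. measure (positive_part X \<rho>) (A n)) sums measure (positive_part X \<rho>) (\<Union>n. A n)"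
    then show "(\<lambda>n. upper_var \<rho> (A n)) sums upper_var \<rho> (\<Union>n. A n)"
      using A by (simp only: measure_positive_part[OF X \<rho>])
  qed
qed

lemma upper_var_nonneg: "0 \<le> upper_var \<rho> A"
  by (simp add: upper_var_def)

lemma upper_var_upper:
  assumes X: "X \<in> sets borel" and \<rho>: "measure_on X \<rho>" and B: "B \<in> sets borel" "B \<subseteq> X"
  shows "\<rho> B \<le> upper_var \<rho> X"
proof -
  have "ennreal (\<rho> B) \<le> ennreal (upper_var \<rho> X)"
    using upper_variation_upper[OF B] upper_variation_finite[OF \<rho> X] by (simp add: upper_var_def)
  then show ?thesis using upper_var_nonneg[of \<rho> X] by (meson ennreal_le_iff)
qed

text \<open>
  A subset \<open>B\<close> is nearly optimal for \<open>\<rho>\<close> exactly if its complement is nearly optimal for \<open>- \<rho>\<close>, because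
  \<open>\<rho> B = \<rho> X + (- \<rho>) (X - B)\<close>.
\<close>

lemma jordan_decomposition:
  assumes X: "X \<in> sets borel" and \<rho>: "measure_on X \<rho>"
  shows "\<rho> X = upper_var \<rho> X - upper_var (\<lambda>A. - \<rho> A) X"
proof -
  have *: "upper_var \<rho> X \<le> \<rho> X + upper_var (\<lambda>A. - \<rho> A) X" if \<rho>: "measure_on X \<rho>" for \<rho> :: "real set \<Rightarrow> real"
  proof -
    have "upper_variation \<rho> X \<le> ennreal (\<rho> X + upper_var (\<lambda>A. - \<rho> A) X)"
      unfolding upper_variation_def
    proof (rule SUP_least)
      fix B assume B: "B \<in> {B \<in> sets borel. B \<subseteq> X}"
      have "\<rho> X = \<rho> B + \<rho> (X - B)"
        by (rule measure_on_Diff[OF \<rho>]) (use B X in auto)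
      moreover have "- \<rho> (X - B) \<le> upper_var (\<lambda>A. - \<rho> A) X"
        by (rule upper_var_upper) (use X B measure_on_uminus[OF \<rho>] in auto)
      ultimately show "ennreal (\<rho> B) \<le> ennreal (\<rho> X + upper_var (\<lambda>A. - \<rho> A) X)"
        by (intro ennreal_leI) linarith
    qed
    moreover have "0 \<le> \<rho> X + upper_var (\<lambda>A. - \<rho> A) X"
      using upper_var_upper[OF X measure_on_uminus[OF \<rho>] X] by auto
    ultimately show ?thesis unfolding upper_var_def[of \<rho>] by (metis enn2real_mono enn2real_ennreal ennreal_less_top)
  qed
  show ?thesis using *[OF \<rho>] *[OF measure_on_uminus[OF \<rho>]] by simp
qed

lemma upper_var_nonneg_measure:
  assumes X: "X \<in> sets borel" and \<rho>: "measure_on X \<rho>" and nonneg: "\<And>A. A \<in> sets borel \<Longrightarrow> A \<subseteq> X \<Longrightarrow> 0 \<le> \<rho> A"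
  shows "upper_var \<rho> X = \<rho> X"
proof -
  have "upper_variation (\<lambda>A. - \<rho> A) X = (SUP B\<in>{B \<in> sets borel. B \<subseteq> X}. 0)"
    unfolding upper_variation_def by (rule SUP_cong) (auto simp: nonneg ennreal_neg)
  also have "\<dots> = 0" by (rule SUP_const) auto
  finally have "upper_var (\<lambda>A. - \<rho> A) X = 0" by (simp add: upper_var_def)
  then show ?thesis using jordan_decomposition[OF X \<rho>] by simp
qed

section \<open>Integration against complex set functions\<close>

definition variation :: "(real set \<Rightarrow> real) \<Rightarrow> real set \<Rightarrow> real" where
  "variation \<rho> A = upper_var \<rho> A + upper_var (\<lambda>A. - \<rho> A) A"

lemma integral_const_approx:
  fixes f :: "'a \<Rightarrow> complex"
  assumes N: "finite_measure N" and f: "f \<in> borel_measurable N" and B: "\<And>x. x \<in> space N \<Longrightarrow> norm (f x - k) \<le> B"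
  shows "norm (integral\<^sup>L N f - of_real (measure N (space N)) * k) \<le> B * measure N (space N)"
proof -
  interpret finite_measure N by fact
  have int: "integrable N f"
  proof (rule integrable_const_bound)
    show "AE x in N. norm (f x) \<le> B + norm k"
      by (rule AE_I2) (metis B add.commute diff_add_cancel norm_triangle_mono order_refl)
  qed (rule f)
  have "integral\<^sup>L N f - of_real (measure N (space N)) * k = (\<integral>x. f x - k \<partial>N)"
    using int by (simp add: scaleR_conv_of_real)
  also have "norm \<dots> \<le> (\<integral>x. norm (f x - k) \<partial>N)" by (rule integral_norm_bound)
  also have "\<dots> \<le> (\<integral>x. B \<partial>N)"
    using int by (intro integral_mono) (auto intro: B)
  finally show ?thesis by (simp add: mult.commute)
qed

lemma integral_real_approx:
  assumes E: "E \<in> sets borel" and \<rho>: "measure_on E \<rho>" and f: "f \<in> borel_measurable (restrict_space borel E)"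
    and B: "\<And>x. x \<in> E \<Longrightarrow> norm (f x - k) \<le> B"
  shows "norm (integral_real E \<rho> f - of_real (\<rho> E) * k) \<le> B * variation \<rho> E"
proof -
  let ?p = "positive_part E \<rho>" and ?n = "positive_part E (\<lambda>A. - \<rho> A)"
  note \<rho>' = measure_on_uminus[OF \<rho>]
  have "sets (positive_part E \<rho>') = sets (restrict_space borel E)" for \<rho>'
    using E by (auto simp: sets_positive_part sets_restrict_space_iff)
  then have f': "f \<in> borel_measurable (positive_part E \<rho>')" for \<rho>'
    using f measurable_cong_sets by blast
  have "norm (integral\<^sup>L ?p f - of_real (measure ?p (space ?p)) * k) \<le> B * measure ?p (space ?p)"
    by (rule integral_const_approx) (auto simp: finite_measure_positive_part E \<rho> f' B space_positive_part)
  moreover have "norm (integral\<^sup>L ?n f - of_real (measure ?n (space ?n)) * k) \<le> B * measure ?n (space ?n)"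
    by (rule integral_const_approx) (auto simp: finite_measure_positive_part E \<rho>' f' B space_positive_part)
  moreover have "measure ?p (space ?p) = upper_var \<rho> E" "measure ?n (space ?n) = upper_var (\<lambda>A. - \<rho> A) E"
    using E \<rho> \<rho>' by (simp_all add: space_positive_part measure_positive_part)
  ultimately have "norm ((integral\<^sup>L ?p f - of_real (upper_var \<rho> E) * k) - (integral\<^sup>L ?n f - of_real (upper_var (\<lambda>A. - \<rho> A) E) * k))
      \<le> B * variation \<rho> E"
    unfolding variation_def distrib_left by (metis add_mono norm_triangle_ineq4 order_trans)
  then show ?thesis
    unfolding integral_real_def jordan_decomposition[OF E \<rho>] by (simp add: algebra_simps)
qed

lemma measure_on_integral_real:
  assumes X: "X \<in> sets borel" and \<rho>: "measure_on X \<rho>" and f: "f \<in> borel_measurable (restrict_space borel X)"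
    and B: "\<And>x. x \<in> X \<Longrightarrow> norm (f x) \<le> B"
  shows "measure_on X (\<lambda>E. integral_real E \<rho> f)"
proof -
  have part: "measure_on X (\<lambda>E. integral\<^sup>L (positive_part E \<rho>) f)" if \<rho>: "measure_on X \<rho>" for \<rho>
    unfolding measure_on_def
  proof (intro allI impI, elim conjE)
    fix A :: "nat \<Rightarrow> real set" assume disj: "disjoint_family A" and A: "\<forall>n. A n \<in> sets borel \<and> A n \<subseteq> X"
    let ?N = "positive_part X \<rho>"
    interpret finite_measure ?N by (rule finite_measure_positive_part[OF X \<rho>])
    have "sets ?N = sets (restrict_space borel X)"
      using X by (auto simp: sets_positive_part sets_restrict_space_iff)
    then have f': "f \<in> borel_measurable ?N"
      using f measurable_cong_sets by blast
    have int: "integrable ?N f"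
      by (rule integrable_const_bound[where B=B]) (auto simp: f' B space_positive_part X intro!: AE_I2)
    have eq: "integral\<^sup>L (positive_part E \<rho>) f = (LINT x:E|?N. f x)" if "E \<in> sets borel" "E \<subseteq> X" for E
      unfolding positive_part_restrict[OF X \<rho> that] set_lebesgue_integral_def
      by (rule integral_restrict_space) (use that X in \<open>auto simp: sets_positive_part space_positive_part\<close>)
    have UA: "(\<Union>n. A n) \<in> sets borel" "(\<Union>n. A n) \<subseteq> X" using A by auto
    have A': "A n \<in> sets ?N" for n using A X by (auto simp: sets_positive_part)
    have setint: "set_integrable ?N E f" if "E \<in> sets ?N" for E
      unfolding set_integrable_def by (rule integrable_mult_indicator[OF that int])
    have "(\<lambda>n. LINT x:A n|?N. f x) sums (LINT x:(\<Union>n. A n)|?N. f x)"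
      unfolding sums_def
    proof -
      have "(\<lambda>n. LINT x:(\<Union>i<n. A i)|?N. f x) \<longlonglongrightarrow> (LINT x:(\<Union>n. (\<Union>i<n. A i))|?N. f x)"
      proof (rule set_integral_cont_up)
        show "incseq (\<lambda>n. \<Union>i<n. A i)" by (intro incseq_SucI UN_mono) auto
      qed (use A' in \<open>auto intro!: setint\<close>)
      moreover have "(\<Union>n. (\<Union>i<n. A i)) = (\<Union>n. A n)" by blast
      moreover have "(LINT x:(\<Union>i<n. A i)|?N. f x) = (\<Sum>i<n. LINT x:A i|?N. f x)" for n
        by (rule set_integral_finite_Union) 
           (use A' disj in \<open>auto simp: disjoint_family_on_def intro!: setint\<close>)
      ultimately show "(\<lambda>n. \<Sum>i<n. LINT x:A i|?N. f x) \<longlonglongrightarrow> (LINT x:(\<Union>n. A n)|?N. f x)" by simp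
    qed
    then show "(\<lambda>n. integral\<^sup>L (positive_part (A n) \<rho>) f) sums integral\<^sup>L (positive_part (\<Union>n. A n) \<rho>) f"
      using A UA by (simp add: eq)
  qed
  show ?thesis unfolding integral_real_def
    by (intro measure_on_diff part \<rho> measure_on_uminus)
qed

definition complex_variation :: "(real set \<Rightarrow> complex) \<Rightarrow> real set \<Rightarrow> real" where
  "complex_variation \<mu> A = variation (\<lambda>A. Re (\<mu> A)) A + variation (\<lambda>A. Im (\<mu> A)) A"

lemma measure_on_complex_variation:
  assumes X: "X \<in> sets borel" and \<mu>: "measure_on X \<mu>"
  shows "measure_on X (complex_variation \<mu>)"
proof -
  have "measure_on X (\<lambda>A. Re (\<mu> A))" "measure_on X (\<lambda>A. Im (\<mu> A))"
    using measure_on_bounded_linear[OF bounded_linear_Re \<mu>] measure_on_bounded_linear[OF bounded_linear_Im \<mu>] .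
  then show ?thesis
    unfolding complex_variation_def variation_def
    by (intro measure_on_add measure_on_upper_var X measure_on_uminus)
qed

lemma complex_variation_nonneg: "0 \<le> complex_variation \<mu> A"
  by (simp add: complex_variation_def variation_def upper_var_nonneg)

text \<open>
  Freezing the integrand at a value \<open>k\<close> costs at most its oscillation times the total variation. All later
  estimates of integrals go through the main term \<open>\<mu> E * k\<close>, where measures can be added, scaled and
  conjugated pointwise.
\<close>

lemma integral_complex_approx:
  assumes E: "E \<in> sets borel" and \<mu>: "measure_on E \<mu>" and f: "f \<in> borel_measurable (restrict_space borel E)"
    and B: "\<And>x. x \<in> E \<Longrightarrow> norm (f x - k) \<le> B"
  shows "norm (integral_complex E \<mu> f - \<mu> E * k) \<le> B * complex_variation \<mu> E"
proof -
  have "measure_on E (\<lambda>A. Re (\<mu> A))" "measure_on E (\<lambda>A. Im (\<mu> A))"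
    using measure_on_bounded_linear[OF bounded_linear_Re \<mu>] measure_on_bounded_linear[OF bounded_linear_Im \<mu>] .
  note * = integral_real_approx[OF E this(1) f B] integral_real_approx[OF E this(2) f B]
  have "integral_complex E \<mu> f - \<mu> E * k = (integral_real E (\<lambda>A. Re (\<mu> A)) f - of_real (Re (\<mu> E)) * k)
      + \<i> * (integral_real E (\<lambda>A. Im (\<mu> A)) f - of_real (Im (\<mu> E)) * k)"
    unfolding integral_complex_def by (subst (3) complex_eq) (simp add: algebra_simps)
  also have "norm \<dots> \<le> B * complex_variation \<mu> E"
    unfolding complex_variation_def distrib_left
    by (rule norm_triangle_mono) (use * in \<open>auto simp: norm_mult\<close>)
  finally show ?thesis .
qed

lemma norm_le_complex_variation:
  assumes "E \<in> sets borel" "measure_on E \<mu>"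
  shows "norm (\<mu> E) \<le> complex_variation \<mu> E"
proof -
  \<comment> \<open>The integrand \<open>0\<close>, frozen at the value \<open>1\<close>.\<close>
  have "norm (integral_complex E \<mu> (\<lambda>_. 0) - \<mu> E * 1) \<le> 1 * complex_variation \<mu> E"
    by (rule integral_complex_approx) (use assms in auto)
  moreover have "integral_complex E \<mu> (\<lambda>_. 0) = 0"
    unfolding integral_complex_def integral_real_def by simp
  ultimately show ?thesis by simp
qed

lemma measure_on_integral_complex:
  assumes X: "X \<in> sets borel" and \<mu>: "measure_on X \<mu>" and f: "f \<in> borel_measurable (restrict_space borel X)"
    and B: "\<And>x. x \<in> X \<Longrightarrow> norm (f x) \<le> B"
  shows "measure_on X (\<lambda>E. integral_complex E \<mu> f)"
proof -
  have "measure_on X (\<lambda>A. Re (\<mu> A))" "measure_on X (\<lambda>A. Im (\<mu> A))"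
    using measure_on_bounded_linear[OF bounded_linear_Re \<mu>] measure_on_bounded_linear[OF bounded_linear_Im \<mu>] .
  then show ?thesis unfolding integral_complex_def
    by (intro measure_on_add measure_on_integral_real[OF X _ f B]
        measure_on_bounded_linear[OF bounded_linear_mult_right])
qed

section \<open>Functions of bounded variation and one-sided limits\<close>

text \<open>
  The majorant \<open>G\<close> is monotone and bounded below, so it has a limit, and the increments of \<open>f\<close> inherit
  the Cauchy property from those of \<open>G\<close>.
\<close>

lemma right_limit_of_majorized:
  fixes f :: "real \<Rightarrow> 'a::banach" and G :: "real \<Rightarrow> real"
  assumes "a < b" and maj: "\<And>x y. a < x \<Longrightarrow> x \<le> y \<Longrightarrow> y < b \<Longrightarrow> norm (f y - f x) \<le> G y - G x"
    and bdd: "\<And>x. a < x \<Longrightarrow> x < b \<Longrightarrow> L0 \<le> G x"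
  shows "\<exists>l. (f \<longlongrightarrow> l) (at_right a)"
proof -
  have mono: "G x \<le> G y" if "a < x" "x \<le> y" "y < b" for x y
    using maj[OF that] norm_ge_zero[of "f y - f x"] by linarith
  have "(G \<longlongrightarrow> Inf (G ` ({a<..} \<inter> {a<..<b}))) (at a within ({a<..} \<inter> {a<..<b}))"
    by (rule Lim_right_bound[where K=L0]) (use mono bdd in auto)
  moreover have "at a within ({a<..} \<inter> {a<..<b}) = at_right a"
    using \<open>a < b\<close> by (intro at_within_nhd[of _ "{..<b}"]) auto
  ultimately obtain L where L: "(G \<longlongrightarrow> L) (at_right a)" by metis
  define x where "x n = a + (b - a) / (real n + 2)" for n
  have x: "a < x n" "x n < b" for n
  proof -
    have "(b - a) / (real n + 2) < (b - a) / 1"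
      using \<open>a < b\<close> by (intro divide_strict_left_mono) auto
    then show "a < x n" "x n < b" using \<open>a < b\<close> by (simp_all add: x_def)
  qed
  have "x \<longlonglongrightarrow> a" unfolding x_def by real_asymp
  then have xr: "filterlim x (at_right a) sequentially"
    using x by (auto simp: filterlim_at intro!: always_eventually)
  have Gx: "(\<lambda>n. G (x n)) \<longlonglongrightarrow> L"
    by (rule filterlim_compose[OF L xr])
  have le: "norm (f (x m) - f (x n)) \<le> \<bar>G (x m) - G (x n)\<bar>" for m n
    using maj[of "x m" "x n"] maj[of "x n" "x m"] x[of m] x[of n]
    by (cases "x m \<le> x n") (auto simp: norm_minus_commute)
  have "Cauchy (\<lambda>n. f (x n))"
  proof (rule metric_CauchyI)
    fix e :: real assume "e > 0"
    then obtain N where "\<And>m n. m \<ge> N \<Longrightarrow> n \<ge> N \<Longrightarrow> dist (G (x m)) (G (x n)) < e"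
      using LIMSEQ_imp_Cauchy[OF Gx] unfolding Cauchy_def by blast
    then show "\<exists>M. \<forall>m\<ge>M. \<forall>n\<ge>M. dist (f (x m)) (f (x n)) < e"
      unfolding dist_norm real_norm_def using le by (meson order_le_less_trans)
  qed
  then obtain l where l: "(\<lambda>n. f (x n)) \<longlonglongrightarrow> l" using Cauchy_convergent_iff convergentD by blast
  have near: "norm (f y - l) \<le> G y - L" if "a < y" "y < b" for y
  proof (rule tendsto_le)
    show "(\<lambda>n. norm (f y - f (x n))) \<longlonglongrightarrow> norm (f y - l)"
      by (intro tendsto_intros l)
    show "(\<lambda>n. G y - G (x n)) \<longlonglongrightarrow> G y - L"
      by (intro tendsto_intros Gx)
    have "eventually (\<lambda>n. x n < y) sequentially"
      using order_tendstoD(2)[OF \<open>x \<longlonglongrightarrow> a\<close> that(1)] .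
    then show "eventually (\<lambda>n. norm (f y - f (x n)) \<le> G y - G (x n)) sequentially"
      by eventually_elim (use x maj that in auto)
  qed simp
  have "(f \<longlongrightarrow> l) (at_right a)"
  proof (rule Lim_transform_bound[of _ "\<lambda>y. G y - L", THEN Lim_null[THEN iffD2], rotated])
    show "((\<lambda>y. G y - L) \<longlongrightarrow> 0) (at_right a)" using L by (simp add: LIM_zero)
    have "eventually (\<lambda>y. y \<in> {a<..<b}) (at_right a)"
      using \<open>a < b\<close> by (rule eventually_at_right_real)
    then show "eventually (\<lambda>y. norm (f y - l) \<le> norm (G y - L)) (at_right a)"
      by eventually_elim (use near in \<open>force\<close>)
  qed
  then show ?thesis ..
qed

lemma left_limit_of_majorized:
  fixes f :: "real \<Rightarrow> 'a::banach" and G :: "real \<Rightarrow> real"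
  assumes "a < b" and maj: "\<And>x y. a < x \<Longrightarrow> x \<le> y \<Longrightarrow> y < b \<Longrightarrow> norm (f y - f x) \<le> G y - G x"
    and bdd: "\<And>x. a < x \<Longrightarrow> x < b \<Longrightarrow> G x \<le> L0"
  shows "\<exists>l. (f \<longlongrightarrow> l) (at_left b)"
proof -
  have "\<exists>l. ((\<lambda>x. f (- x)) \<longlongrightarrow> l) (at_right (- b))"
  proof (rule right_limit_of_majorized[where b="-a" and G="\<lambda>x. - G (- x)" and ?L0.0="-L0"])
    fix x y assume "- b < x" "x \<le> y" "y < - a"
    then show "norm (f (- y) - f (- x)) \<le> - G (- y) - - G (- x)"
      using maj[of "-y" "-x"] by (simp add: norm_minus_commute)
  qed (use assms in auto)
  then show ?thesis by (simp add: filterlim_at_left_to_right)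
qed

lemma bounded_variation_onI:
  assumes maj: "\<And>x y. s \<le> x \<Longrightarrow> x \<le> y \<Longrightarrow> y \<le> t \<Longrightarrow> norm (f y - f x) \<le> G y - G x"
  shows "bounded_variation_on s t f"
  unfolding bounded_variation_on_def
proof (intro exI allI impI, elim conjE)
  fix n and p :: "nat \<Rightarrow> real" assume p: "mono_on {..n} p" "p ` {..n} \<subseteq> {s..t}"
  then have pst: "s \<le> p i" "p i \<le> t" if "i \<le> n" for i using that by auto
  have mono: "G x \<le> G y" if "s \<le> x" "x \<le> y" "y \<le> t" for x y
    using maj[OF that] norm_ge_zero[of "f y - f x"] by linarith
  have "(\<Sum>i<n. norm (f (p (Suc i)) - f (p i))) \<le> (\<Sum>i<n. G (p (Suc i)) - G (p i))"
  proof (rule sum_mono)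
    fix i assume "i \<in> {..<n}"
    then show "norm (f (p (Suc i)) - f (p i)) \<le> G (p (Suc i)) - G (p i)"
      by (intro maj pst mono_onD[OF p(1)]) auto
  qed
  also have "\<dots> = G (p n) - G (p 0)" by (rule sum_lessThan_telescope)
  also have "\<dots> \<le> G t - G s"
    using mono[of "p n" t] mono[of s "p 0"] pst[of n] pst[of 0] by auto
  finally show "(\<Sum>i<n. norm (f (p (Suc i)) - f (p i))) \<le> G t - G s" .
qed

text \<open>
  \<open>G x\<close> is the variation of \<open>f\<close> on \<open>[s,x]\<close>: appending the points \<open>x\<close> and \<open>y\<close> to a partition of \<open>[s,x]\<close> adds
  at least \<open>\<bar>f y - f x\<bar>\<close> to its sum.
\<close>

lemma bounded_variation_on_majorant:
  fixes f :: "real \<Rightarrow> 'a::real_normed_vector"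
  assumes "bounded_variation_on s t f"
  obtains G where "\<And>x y. s \<le> x \<Longrightarrow> x \<le> y \<Longrightarrow> y \<le> t \<Longrightarrow> norm (f y - f x) \<le> G y - G x"
proof -
  define S where "S x = {\<Sum>i<n. norm (f (p (Suc i)) - f (p i)) | n (p :: nat \<Rightarrow> real).
     mono_on {..n} p \<and> p ` {..n} \<subseteq> {s..x}}" for x
  obtain K where K: "\<And>n p. mono_on {..n} p \<Longrightarrow> p ` {..n} \<subseteq> {s..t} \<Longrightarrow>
        (\<Sum>i<n. norm (f (p (Suc i)) - f (p i))) \<le> K"
    using assms unfolding bounded_variation_on_def by blast
  have bdd: "bdd_above (S x)" if "x \<le> t" for x
  proof (rule bdd_aboveI)
    fix z assume "z \<in> S x"
    then show "z \<le> K" unfolding S_def using that by (auto intro!: K)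
  qed
  have ne: "S x \<noteq> {}" if "s \<le> x" for x
  proof -
    have "(\<Sum>i<0. norm (f ((\<lambda>_. s) (Suc i)) - f ((\<lambda>_. s) i))) \<in> S x"
      unfolding S_def using that by (intro CollectI exI[of _ 0] exI[of _ "\<lambda>_. s"]) (auto simp: mono_on_def)
    then show ?thesis by blast
  qed
  have "norm (f y - f x) \<le> Sup (S y) - Sup (S x)" if xy: "s \<le> x" "x \<le> y" "y \<le> t" for x y
  proof -
    have "Sup (S x) \<le> Sup (S y) - norm (f y - f x)"
    proof (rule cSup_least[OF ne[OF xy(1)]])
      fix z assume "z \<in> S x"
      then obtain n p where z: "z = (\<Sum>i<n. norm (f (p (Suc i)) - f (p i)))"
        and p: "mono_on {..n} p" "p ` {..n} \<subseteq> {s..x}" unfolding S_def by blast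
      \<comment> \<open>The partition \<open>p\<close> may end before \<open>x\<close>, so both \<open>x\<close> and \<open>y\<close> are appended.\<close>
      define r where "r i = (if i \<le> n then p i else if i = Suc n then x else y)" for i
      have px: "s \<le> p i" "p i \<le> x" if "i \<le> n" for i using p(2) that by auto
      have "mono_on {..Suc (Suc n)} r"
        unfolding mono_on_def r_def using p(1) px xy by (fastforce simp: mono_on_def)
      moreover have "r ` {..Suc (Suc n)} \<subseteq> {s..y}"
        using px xy unfolding r_def by fastforce
      ultimately have "(\<Sum>i<Suc (Suc n). norm (f (r (Suc i)) - f (r i))) \<in> S y"
        unfolding S_def by blast
      then have "(\<Sum>i<Suc (Suc n). norm (f (r (Suc i)) - f (r i))) \<le> Sup (S y)"
        by (rule cSup_upper[OF _ bdd[OF xy(3)]])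
      moreover have "(\<Sum>i<n. norm (f (r (Suc i)) - f (r i))) = z"
        unfolding z by (rule sum.cong) (auto simp: r_def)
      moreover have "norm (f (r (Suc (Suc n))) - f (r (Suc n))) = norm (f y - f x)"
        by (simp add: r_def)
      moreover have "0 \<le> norm (f (r (Suc n)) - f (r n))" by simp
      ultimately show "z \<le> Sup (S y) - norm (f y - f x)"
        by (simp only: sum.lessThan_Suc)
    qed
    then show ?thesis by linarith
  qed
  then show ?thesis by (rule that)
qed

text \<open>
  The limit function is the pointwise limit of step functions: \<open>g x\<close> is approximated by the value of \<open>f\<close>
  at the last point of the grid of width \<open>1/(n+1)\<close> strictly to the left of \<open>x\<close>.
\<close>

lemma borel_measurable_left_limit:
  fixes g :: "real \<Rightarrow> 'b::metric_space"
  assumes "\<And>x. x \<in> X \<Longrightarrow> (f \<longlongrightarrow> g x) (at_left x)"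
  shows "g \<in> borel_measurable (restrict_space borel X)"
proof (rule borel_measurable_LIMSEQ_metric)
  fix n :: nat
  let ?h = "\<lambda>k::int. f ((of_int k - 1) / (real n + 1))"
  have "(\<lambda>x::real. \<lceil>(real n + 1) * x\<rceil>) \<in> measurable borel (count_space UNIV)" by measurable
  then have "(\<lambda>x. ?h \<lceil>(real n + 1) * x\<rceil>) \<in> borel_measurable borel"
    by (rule measurable_compose) simp
  then show "(\<lambda>x. ?h \<lceil>(real n + 1) * x\<rceil>) \<in> borel_measurable (restrict_space borel X)"
    by (rule measurable_restrict_space1)
next
  fix x assume "x \<in> space (restrict_space borel X)"
  then have "x \<in> X" by (simp add: space_restrict_space)
  let ?y = "\<lambda>n. (of_int \<lceil>(real n + 1) * x\<rceil> - 1) / (real n + 1)"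
  have lt: "?y n < x" for n
    using ceiling_correct[of "(real n + 1) * x"] by (auto simp: field_simps)
  have ge: "x - 1 / (real n + 1) \<le> ?y n" for n
  proof -
    have "((real n + 1) * x - 1) / (real n + 1) \<le> ?y n"
      by (intro divide_right_mono diff_right_mono le_of_int_ceiling) simp
    moreover have "((real n + 1) * x - 1) / (real n + 1) = x - 1 / (real n + 1)"
      by (simp add: diff_divide_distrib add_pos_nonneg less_imp_neq[symmetric])
    ultimately show ?thesis by simp
  qed
  have "?y \<longlonglongrightarrow> x"
  proof (rule tendsto_sandwich)
    show "(\<lambda>n. x - 1 / (real n + 1)) \<longlonglongrightarrow> x" by real_asymp
    show "(\<lambda>n. x) \<longlonglongrightarrow> x" by simp
  qed (use lt ge in \<open>auto intro!: always_eventually less_imp_le\<close>)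
  then have "filterlim ?y (at_left x) sequentially"
    using lt by (auto simp: filterlim_at less_imp_neq intro!: always_eventually)
  then show "(\<lambda>n. f (?y n)) \<longlonglongrightarrow> g x"
    by (rule filterlim_compose[OF assms[OF \<open>x \<in> X\<close>]])
qed

lemma borel_measurable_right_limit:
  fixes g :: "real \<Rightarrow> 'b::metric_space"
  assumes "\<And>x. x \<in> X \<Longrightarrow> (f \<longlongrightarrow> g x) (at_right x)"
  shows "g \<in> borel_measurable (restrict_space borel X)"
proof -
  have "(\<lambda>x. g (- x)) \<in> borel_measurable (restrict_space borel (uminus ` X))"
  proof (rule borel_measurable_left_limit[where f="\<lambda>x. f (- x)"])
    fix x assume "x \<in> uminus ` X"
    then show "((\<lambda>x. f (- x)) \<longlongrightarrow> g (- x)) (at_left x)"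
      using assms[of "-x"] by (auto simp: filterlim_at_left_to_right)
  qed
  moreover have "uminus \<in> measurable (restrict_space borel X) (restrict_space borel (uminus ` X))"
    by (rule measurable_restrict_space3) auto
  ultimately have "(\<lambda>x. g (- (- x))) \<in> borel_measurable (restrict_space borel X)"
    by (rule measurable_compose[rotated])
  then show ?thesis by simp
qed

text \<open>
  The right limit at \<open>s\<close> is a limit of values of \<open>f\<close> between \<open>s\<close> and \<open>t\<close>, which are close to \<open>l\<close>.
\<close>

lemma right_limits_tendsto_left:
  fixes f g :: "real \<Rightarrow> 'b::metric_space"
  assumes f: "(f \<longlongrightarrow> l) (at_left t)" and "a < t"
    and g: "\<And>s. a < s \<Longrightarrow> s < t \<Longrightarrow> (f \<longlongrightarrow> g s) (at_right s)"
  shows "(g \<longlongrightarrow> l) (at_left t)"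
proof (rule tendstoI)
  fix e :: real assume "e > 0"
  then have "eventually (\<lambda>y. dist (f y) l < e / 2) (at_left t)" using tendstoD[OF f, of "e / 2"] by simp
  then obtain b where b: "b < t" "\<And>y. b < y \<Longrightarrow> y < t \<Longrightarrow> dist (f y) l < e / 2"
    unfolding eventually_at_left_field by blast
  have "eventually (\<lambda>s. s \<in> {max a b<..<t}) (at_left t)"
    by (rule eventually_at_left_real) (use b \<open>a < t\<close> in simp)
  then show "eventually (\<lambda>s. dist (g s) l < e) (at_left t)"
  proof eventually_elim
    case (elim s)
    have "dist (g s) l \<le> e / 2"
    proof (rule tendsto_upperbound)
      show "((\<lambda>y. dist (f y) l) \<longlongrightarrow> dist (g s) l) (at_right s)"
        by (intro tendsto_intros g) (use elim in auto)
      have "eventually (\<lambda>y. y \<in> {s<..<t}) (at_right s)"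
        by (rule eventually_at_right_real) (use elim in auto)
      then show "eventually (\<lambda>y. dist (f y) l \<le> e / 2) (at_right s)"
        by eventually_elim (use b(2) elim in \<open>auto intro: less_imp_le\<close>)
    qed simp
    then show ?case using \<open>e > 0\<close> by simp
  qed
qed

lemma left_lim_eq: "(f \<longlongrightarrow> l) (at_left x) \<Longrightarrow> left_lim f x = l" for x :: real
  unfolding left_lim_def by (rule tendsto_Lim) simp_all

lemma right_lim_eq: "(f \<longlongrightarrow> l) (at_right x) \<Longrightarrow> right_lim f x = l" for x :: real
  unfolding right_lim_def by (rule tendsto_Lim) simp_all

section \<open>Functions dominated by a finite measure\<close>

lemma norm_average_diff_le:
  fixes a b l :: "'b::real_normed_vector"
  assumes "norm (a - l) \<le> r" "norm (b - l) \<le> r"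
  shows "norm ((1/2) *\<^sub>R (a + b) - l) \<le> r"
proof -
  have "(1/2) *\<^sub>R (a + b) - l = (1/2) *\<^sub>R ((a - l) + (b - l))"
    by (simp add: algebra_simps flip: scaleR_2)
  also have "norm \<dots> \<le> (1/2) * (r + r)"
    unfolding norm_scaleR by (intro mult_mono norm_triangle_mono assms) auto
  finally show ?thesis by simp
qed

lemma tendsto_if_dominated:
  fixes f :: "real \<Rightarrow> 'b::real_normed_vector"
  assumes "eventually (\<lambda>t. norm (f t - l) \<le> K * g t) F" "(g \<longlongrightarrow> 0) F"
  shows "(f \<longlongrightarrow> l) F"
proof -
  have "((\<lambda>t. f t - l) \<longlongrightarrow> 0) F"
    by (rule Lim_null_comparison[OF assms(1)]) (use tendsto_mult_right_zero[OF assms(2)] in simp)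
  then show ?thesis by (simp add: LIM_zero_iff)
qed

text \<open>
  The balanced function with left limits \<open>f\<^sub>m\<close> and right limits \<open>f\<^sub>p\<close>.
\<close>

definition mid :: "(real \<Rightarrow> 'a::real_vector) \<Rightarrow> (real \<Rightarrow> 'a) \<Rightarrow> real \<Rightarrow> 'a" where
  "mid f\<^sub>m f\<^sub>p x = (1/2) *\<^sub>R (f\<^sub>m x + f\<^sub>p x)"

text \<open>
  \<open>M\<close> controls functions on the interval \<open>(0,c)\<close>. It lives on the whole line, so that no set has to be
  intersected with that interval.
\<close>

locale dominating_measure = finite_measure M for M :: "real measure" +
  fixes c :: real
  assumes sets_M: "sets M = sets borel"

begin

lemma borel_in_sets [simp]: "A \<in> sets borel \<Longrightarrow> A \<in> sets M"
  by (simp add: sets_M)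

lemma measure_mono: "A \<subseteq> B \<Longrightarrow> B \<in> sets borel \<Longrightarrow> measure M A \<le> measure M B"
  by (rule finite_measure_mono) auto

lemma measure_add:
  assumes "A \<in> sets borel" "B \<in> sets borel" "A \<inter> B = {}"
  shows "measure M (A \<union> B) = measure M A + measure M B"
  using assms by (intro finite_measure_Union) auto

lemma measure_pieces:
  fixes s t :: real assumes "s < t"
  shows "measure M {s..<t} = measure M {s} + measure M {s<..<t}"
    and "measure M {s<..t} = measure M {s<..<t} + measure M {t}"
    and "measure M {s..t} = measure M {s} + measure M {s<..<t} + measure M {t}"
proof -
  have "{s} \<union> {s<..<t} = {s..<t}" "{s<..<t} \<union> {t} = {s<..t}" "{s..<t} \<union> {t} = {s..t}"
    using assms by auto
  then show *: "measure M {s..<t} = measure M {s} + measure M {s<..<t}"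
    and "measure M {s<..t} = measure M {s<..<t} + measure M {t}"
    and "measure M {s..t} = measure M {s} + measure M {s<..<t} + measure M {t}"
    using measure_add[of "{s}" "{s<..<t}"] measure_add[of "{s<..<t}" "{t}"] measure_add[of "{s..<t}" "{t}"]
    by simp_all
qed

lemma measure_shrinking:
  fixes A :: "nat \<Rightarrow> real set"
  assumes "decseq A" "(\<Inter>n. A n) = {}" "\<And>n. A n \<in> sets borel"
  shows "(\<lambda>n. measure M (A n)) \<longlonglongrightarrow> 0"
proof -
  have "range A \<subseteq> sets M" using assms(3) by auto
  then show ?thesis using finite_Lim_measure_decseq[of A] assms(1,2) by simp
qed

lemma measure_right_null: "((\<lambda>t. measure M {x<..t}) \<longlongrightarrow> 0) (at_right x)"
proof (rule tendstoI)
  fix e :: real assume "e > 0"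
  have "(\<lambda>n. measure M {x<..x + 1 / (real n + 1)}) \<longlonglongrightarrow> 0"
  proof (rule measure_shrinking)
    show "decseq (\<lambda>n. {x<..x + 1 / (real n + 1)})"
      by (rule decseq_SucI) (auto elim!: order_trans simp: field_simps)
    have "\<exists>n::nat. \<not> y \<le> x + 1 / (real n + 1)" if less: "x < y" for y
    proof -
      obtain n where "1 / (real n + 1) < y - x"
        using reals_Archimedean[of "y - x"] less by (auto simp: inverse_eq_divide add.commute)
      then show ?thesis by (intro exI[of _ n]) linarith
    qed
    then show "(\<Inter>n. {x<..x + 1 / (real n + 1)}) = {}" by fastforce
  qed auto
  then have "eventually (\<lambda>n. measure M {x<..x + 1 / (real n + 1)} < e) sequentially"
    using \<open>e > 0\<close> by (rule order_tendstoD)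
  then obtain n where n: "measure M {x<..x + 1 / (real n + 1)} < e"
    by (auto simp: eventually_sequentially)
  have "eventually (\<lambda>t. t \<in> {x<..<x + 1 / (real n + 1)}) (at_right x)"
    by (rule eventually_at_right_real) (simp add: add_pos_nonneg)
  then show "eventually (\<lambda>t. dist (measure M {x<..t}) 0 < e) (at_right x)"
  proof eventually_elim
    case (elim t)
    then have "measure M {x<..t} \<le> measure M {x<..x + 1 / (real n + 1)}"
      by (intro measure_mono) auto
    then show ?case using n by simp
  qed
qed

lemma measure_left_null: "((\<lambda>t. measure M {t..<x}) \<longlongrightarrow> 0) (at_left x)"
proof (rule tendstoI)
  fix e :: real assume "e > 0"
  have "(\<lambda>n. measure M {x - 1 / (real n + 1)..<x}) \<longlonglongrightarrow> 0"
  proof (rule measure_shrinking)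
    show "decseq (\<lambda>n. {x - 1 / (real n + 1)..<x})"
      by (rule decseq_SucI) (auto elim!: order_trans[rotated] simp: field_simps)
    have "\<exists>n::nat. \<not> x - 1 / (real n + 1) \<le> y" if less: "y < x" for y
    proof -
      obtain n where "1 / (real n + 1) < x - y"
        using reals_Archimedean[of "x - y"] less by (auto simp: inverse_eq_divide add.commute)
      then show ?thesis by (intro exI[of _ n]) linarith
    qed
    then show "(\<Inter>n. {x - 1 / (real n + 1)..<x}) = {}" by fastforce
  qed auto
  then have "eventually (\<lambda>n. measure M {x - 1 / (real n + 1)..<x} < e) sequentially"
    using \<open>e > 0\<close> by (rule order_tendstoD)
  then obtain n where n: "measure M {x - 1 / (real n + 1)..<x} < e"
    by (auto simp: eventually_sequentially)
  have "eventually (\<lambda>t. t \<in> {x - 1 / (real n + 1)<..<x}) (at_left x)"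
    by (rule eventually_at_left_real) (simp add: add_pos_nonneg)
  then show "eventually (\<lambda>t. dist (measure M {t..<x}) 0 < e) (at_left x)"
  proof eventually_elim
    case (elim t)
    then have "measure M {t..<x} \<le> measure M {x - 1 / (real n + 1)..<x}"
      by (intro measure_mono) auto
    then show ?case using n by simp
  qed
qed

text \<open>
  The pair consists of the left limits \<open>f\<^sub>m\<close> and the right limits \<open>f\<^sub>p\<close> of one function on \<open>(0,c)\<close>. Working with
  the pair rather than with the function separates the increments over open intervals from the jumps.
\<close>

definition dominated :: "(real \<Rightarrow> 'a::banach) \<Rightarrow> (real \<Rightarrow> 'a) \<Rightarrow> real \<Rightarrow> bool" where
  "dominated f\<^sub>m f\<^sub>p K \<longleftrightarrow> 0 \<le> K \<and>
     (\<forall>s t. 0 < s \<longrightarrow> s < t \<longrightarrow> t < c \<longrightarrow> norm (f\<^sub>m t - f\<^sub>p s) \<le> K * measure M {s<..<t}) \<and>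
     (\<forall>s. 0 < s \<longrightarrow> s < c \<longrightarrow> norm (f\<^sub>p s - f\<^sub>m s) \<le> K * measure M {s})"

lemma
  assumes f: "dominated f\<^sub>m f\<^sub>p K" and st: "0 < s" "s < t" "t < c"
  shows dominated_mp: "norm (f\<^sub>m t - f\<^sub>p s) \<le> K * measure M {s<..<t}"
    and dominated_mm: "norm (f\<^sub>m t - f\<^sub>m s) \<le> K * measure M {s..<t}"
    and dominated_pp: "norm (f\<^sub>p t - f\<^sub>p s) \<le> K * measure M {s<..t}"
    and dominated_pm: "norm (f\<^sub>p t - f\<^sub>m s) \<le> K * measure M {s..t}"
proof -
  have *: "norm (f\<^sub>m t - f\<^sub>p s) \<le> K * measure M {s<..<t}" "norm (f\<^sub>p s - f\<^sub>m s) \<le> K * measure M {s}"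
     "norm (f\<^sub>p t - f\<^sub>m t) \<le> K * measure M {t}"
    using f st unfolding dominated_def by auto
  then show "norm (f\<^sub>m t - f\<^sub>p s) \<le> K * measure M {s<..<t}" by simp
  have "norm (f\<^sub>m t - f\<^sub>m s) \<le> norm (f\<^sub>m t - f\<^sub>p s) + norm (f\<^sub>p s - f\<^sub>m s)" by norm
  then show "norm (f\<^sub>m t - f\<^sub>m s) \<le> K * measure M {s..<t}"
    using * measure_pieces(1)[OF st(2)] by (simp add: distrib_left)
  have "norm (f\<^sub>p t - f\<^sub>p s) \<le> norm (f\<^sub>m t - f\<^sub>p s) + norm (f\<^sub>p t - f\<^sub>m t)" by norm
  then show "norm (f\<^sub>p t - f\<^sub>p s) \<le> K * measure M {s<..t}"
    using * measure_pieces(2)[OF st(2)] by (simp add: distrib_left)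
  have "norm (f\<^sub>p t - f\<^sub>m s) \<le> norm (f\<^sub>m t - f\<^sub>p s) + norm (f\<^sub>p t - f\<^sub>m t) + norm (f\<^sub>p s - f\<^sub>m s)" by norm
  then show "norm (f\<^sub>p t - f\<^sub>m s) \<le> K * measure M {s..t}"
    using * measure_pieces(3)[OF st(2)] by (simp add: distrib_left)
qed

lemma dominated_jump:
  "dominated f\<^sub>m f\<^sub>p K \<Longrightarrow> 0 < s \<Longrightarrow> s < c \<Longrightarrow> norm (f\<^sub>p s - f\<^sub>m s) \<le> K * measure M {s}"
  and dominated_const_nonneg: "dominated f\<^sub>m f\<^sub>p K \<Longrightarrow> 0 \<le> K"
  unfolding dominated_def by auto

lemma dominated_mid_right:
  assumes f: "dominated f\<^sub>m f\<^sub>p K" and st: "0 < s" "s < t" "t < c"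
  shows "norm (mid f\<^sub>m f\<^sub>p t - f\<^sub>p s) \<le> K * measure M {s<..t}"
  unfolding mid_def
proof (rule norm_average_diff_le)
  have "K * measure M {s<..<t} \<le> K * measure M {s<..t}"
    by (intro mult_left_mono measure_mono dominated_const_nonneg[OF f]) auto
  then show "norm (f\<^sub>m t - f\<^sub>p s) \<le> K * measure M {s<..t}"
    using dominated_mp[OF assms] by linarith
qed (rule dominated_pp[OF assms])

lemma dominated_mid_left:
  assumes f: "dominated f\<^sub>m f\<^sub>p K" and st: "0 < s" "s < t" "t < c"
  shows "norm (mid f\<^sub>m f\<^sub>p s - f\<^sub>m t) \<le> K * measure M {s..<t}"
  unfolding mid_def
proof (rule norm_average_diff_le)
  have "K * measure M {s<..<t} \<le> K * measure M {s..<t}"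
    by (intro mult_left_mono measure_mono dominated_const_nonneg[OF f]) auto
  then show "norm (f\<^sub>p s - f\<^sub>m t) \<le> K * measure M {s..<t}"
    using dominated_mp[OF assms] by (simp add: norm_minus_commute)
  show "norm (f\<^sub>m s - f\<^sub>m t) \<le> K * measure M {s..<t}"
    using dominated_mm[OF assms] by (simp add: norm_minus_commute)
qed

text \<open>
  Every increment is bounded by \<open>K M[s,t]\<close>. Both \<open>t \<mapsto> M(-\<infinity>,t)\<close> and \<open>t \<mapsto> M(-\<infinity>,t]\<close> are needed in the
  monotone majorant since \<open>M[s,t]\<close> contains the atoms at both ends.
\<close>

lemma dominated_mid:
  assumes f: "dominated f\<^sub>m f\<^sub>p K" and st: "0 < s" "s \<le> t" "t < c"
  shows "norm (mid f\<^sub>m f\<^sub>p t - mid f\<^sub>m f\<^sub>p s) \<le> K * (measure M {..<t} + measure M {..t}) - K * (measure M {..<s} + measure M {..s})"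
proof (cases "s = t")
  case False
  with st have "s < t" by simp
  note st' = st(1) this st(3)
  have A: "norm (f\<^sub>p s - mid f\<^sub>m f\<^sub>p t) \<le> K * measure M {s..t}"
  proof -
    have "K * measure M {s<..t} \<le> K * measure M {s..t}"
      by (intro mult_left_mono measure_mono dominated_const_nonneg[OF f]) auto
    then show ?thesis using dominated_mid_right[OF f st'] by (simp add: norm_minus_commute)
  qed
  have B: "norm (f\<^sub>m s - mid f\<^sub>m f\<^sub>p t) \<le> K * measure M {s..t}"
    unfolding norm_minus_commute[of "f\<^sub>m s"] unfolding mid_def
  proof (rule norm_average_diff_le)
    show "norm (f\<^sub>m t - f\<^sub>m s) \<le> K * measure M {s..t}"
    proof -
      have "K * measure M {s..<t} \<le> K * measure M {s..t}"
        by (intro mult_left_mono measure_mono dominated_const_nonneg[OF f]) auto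
      then show ?thesis using dominated_mm[OF f st'] by simp
    qed
  qed (rule dominated_pm[OF f st'])
  have "norm (mid f\<^sub>m f\<^sub>p s - mid f\<^sub>m f\<^sub>p t) \<le> K * measure M {s..t}"
    unfolding mid_def[of f\<^sub>m f\<^sub>p s] by (rule norm_average_diff_le[OF B A])
  also have "\<dots> \<le> K * ((measure M {..<t} + measure M {..t}) - (measure M {..<s} + measure M {..s}))"
  proof (rule mult_left_mono[OF _ dominated_const_nonneg[OF f]])
    have "{..<t} = {..<s} \<union> {s..<t}" "{..t} = {..s} \<union> {s<..t}" using st by auto
    then have "measure M {..<t} = measure M {..<s} + measure M {s..<t}" "measure M {..t} = measure M {..s} + measure M {s<..t}"
      by (simp_all only:) (rule measure_add; auto)+
    then show "measure M {s..t} \<le> (measure M {..<t} + measure M {..t}) - (measure M {..<s} + measure M {..s})"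
      using measure_pieces[OF \<open>s < t\<close>] by simp
  qed
  finally show ?thesis by (simp add: norm_minus_commute algebra_simps)
qed simp

lemma
  assumes f: "dominated f\<^sub>m f\<^sub>p K" and x: "0 < x" "x < c"
  shows dominated_right_limit_m: "(f\<^sub>m \<longlongrightarrow> f\<^sub>p x) (at_right x)"
    and dominated_right_limit_mid: "(mid f\<^sub>m f\<^sub>p \<longlongrightarrow> f\<^sub>p x) (at_right x)"
proof -
  have ev: "eventually (\<lambda>t. t \<in> {x<..<c}) (at_right x)" by (rule eventually_at_right_real[OF x(2)])
  have K: "0 \<le> K" by (rule dominated_const_nonneg[OF f])
  show "(f\<^sub>m \<longlongrightarrow> f\<^sub>p x) (at_right x)"
  proof (rule tendsto_if_dominated[OF _ measure_right_null])
    show "eventually (\<lambda>t. norm (f\<^sub>m t - f\<^sub>p x) \<le> K * measure M {x<..t}) (at_right x)"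
      using ev
    proof eventually_elim
      case (elim t)
      have "K * measure M {x<..<t} \<le> K * measure M {x<..t}"
        by (intro mult_left_mono measure_mono K) auto
      then show ?case using dominated_mp[OF f, of x t] x elim by auto
    qed
  qed
  show "(mid f\<^sub>m f\<^sub>p \<longlongrightarrow> f\<^sub>p x) (at_right x)"
    by (rule tendsto_if_dominated[OF _ measure_right_null, of _ _ K])
       (use ev in eventually_elim, use dominated_mid_right[OF f] x in auto)
qed

lemma dominated_left_limit_mid:
  assumes f: "dominated f\<^sub>m f\<^sub>p K" and x: "0 < x" "x < c"
  shows "(mid f\<^sub>m f\<^sub>p \<longlongrightarrow> f\<^sub>m x) (at_left x)"
proof -
  have ev: "eventually (\<lambda>t. t \<in> {0<..<x}) (at_left x)" by (rule eventually_at_left_real[OF x(1)])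
  show "(mid f\<^sub>m f\<^sub>p \<longlongrightarrow> f\<^sub>m x) (at_left x)"
    by (rule tendsto_if_dominated[OF _ measure_left_null, of _ _ K])
       (use ev in eventually_elim, use dominated_mid_left[OF f] x in auto)
qed

text \<open>
  As \<open>M\<close> is finite up to the endpoint, the increments near \<open>0\<close> are controlled by a bounded monotone
  function, and the jumps tend to \<open>0\<close>.
\<close>

lemma dominated_limit_0:
  assumes f: "dominated f\<^sub>m f\<^sub>p K" and c: "0 < c"
  obtains f\<^sub>0 where "(f\<^sub>m \<longlongrightarrow> f\<^sub>0) (at_right 0)" "(f\<^sub>p \<longlongrightarrow> f\<^sub>0) (at_right 0)" "(mid f\<^sub>m f\<^sub>p \<longlongrightarrow> f\<^sub>0) (at_right 0)"
proof -
  have K: "0 \<le> K" by (rule dominated_const_nonneg[OF f])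
  have ev: "eventually (\<lambda>t. t \<in> {0<..<c}) (at_right 0)" by (rule eventually_at_right_real[OF c])
  obtain f\<^sub>0 where f0: "(mid f\<^sub>m f\<^sub>p \<longlongrightarrow> f\<^sub>0) (at_right 0)"
    using right_limit_of_majorized[OF c, of "mid f\<^sub>m f\<^sub>p" "\<lambda>t. K * (measure M {..<t} + measure M {..t})" 0]
      dominated_mid[OF f] K by auto
  have jump: "((\<lambda>t. f\<^sub>p t - f\<^sub>m t) \<longlongrightarrow> 0) (at_right 0)"
  proof (rule tendsto_if_dominated[OF _ measure_right_null, of _ _ K])
    show "eventually (\<lambda>t. norm (f\<^sub>p t - f\<^sub>m t - 0) \<le> K * measure M {0<..t}) (at_right 0)"
      using ev
    proof eventually_elim
      case (elim t)
      have "K * measure M {t} \<le> K * measure M {0<..t}"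
        by (intro mult_left_mono measure_mono K) (use elim in auto)
      then show ?case using dominated_jump[OF f, of t] elim by auto
    qed
  qed
  have "((\<lambda>t. mid f\<^sub>m f\<^sub>p t - (1/2) *\<^sub>R (f\<^sub>p t - f\<^sub>m t)) \<longlongrightarrow> f\<^sub>0 - (1/2) *\<^sub>R 0) (at_right 0)"
    "((\<lambda>t. mid f\<^sub>m f\<^sub>p t + (1/2) *\<^sub>R (f\<^sub>p t - f\<^sub>m t)) \<longlongrightarrow> f\<^sub>0 + (1/2) *\<^sub>R 0) (at_right 0)"
    by (intro tendsto_intros f0 jump)+
  moreover have "mid f\<^sub>m f\<^sub>p t - (1/2) *\<^sub>R (f\<^sub>p t - f\<^sub>m t) = f\<^sub>m t" "mid f\<^sub>m f\<^sub>p t + (1/2) *\<^sub>R (f\<^sub>p t - f\<^sub>m t) = f\<^sub>p t" for t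
    unfolding mid_def by (simp_all add: algebra_simps flip: scaleR_left_distrib)
  ultimately show ?thesis using that[OF _ _ f0] by simp
qed

lemma dominated_bounded:
  assumes f: "dominated f\<^sub>m f\<^sub>p K" and c: "0 < c"
  obtains U where "0 \<le> U" "\<And>x. 0 < x \<Longrightarrow> x < c \<Longrightarrow> norm (f\<^sub>m x) \<le> U" "\<And>x. 0 < x \<Longrightarrow> x < c \<Longrightarrow> norm (f\<^sub>p x) \<le> U"
     "\<And>x. 0 < x \<Longrightarrow> x < c \<Longrightarrow> norm (mid f\<^sub>m f\<^sub>p x) \<le> U"
proof -
  have K: "0 \<le> K" by (rule dominated_const_nonneg[OF f])
  define y where "y = c / 2"
  have y: "0 < y" "y < c" using c by (auto simp: y_def)
  define U where "U = norm (f\<^sub>m y) + 2 * (K * measure M UNIV)"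
  have le: "K * measure M A \<le> K * measure M UNIV" for A
    by (intro mult_left_mono K) (metis bounded_measure sets_M sets_eq_imp_space_eq space_borel)
  have m: "norm (f\<^sub>m x - f\<^sub>m y) \<le> K * measure M UNIV" if "0 < x" "x < c" for x
  proof -
    consider "x < y" | "x = y" | "y < x" by linarith
    then show ?thesis
    proof cases
      case 1
      then show ?thesis using dominated_mm[OF f, of x y] that y le[of "{x..<y}"] by (simp add: norm_minus_commute)
    next
      case 3
      then show ?thesis using dominated_mm[OF f, of y x] that y le[of "{y..<x}"] by simp
    qed (use K in simp)
  qed
  have m': "norm (f\<^sub>m x) \<le> U" if "0 < x" "x < c" for x
    using m[OF that] norm_triangle_sub[of "f\<^sub>m x" "f\<^sub>m y"] le[of "{}"] unfolding U_def by simp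
  have p': "norm (f\<^sub>p x) \<le> U" if "0 < x" "x < c" for x
    using m[OF that] norm_triangle_sub[of "f\<^sub>m x" "f\<^sub>m y"] norm_triangle_sub[of "f\<^sub>p x" "f\<^sub>m x"]
      dominated_jump[OF f that] le[of "{x}"] unfolding U_def by simp
  have "norm (mid f\<^sub>m f\<^sub>p x) \<le> U" if "0 < x" "x < c" for x
    unfolding mid_def using norm_average_diff_le[of "f\<^sub>m x" 0 U "f\<^sub>p x"] m'[OF that] p'[OF that] by simp
  moreover have "0 \<le> U" unfolding U_def using K by simp
  ultimately show ?thesis using that m' p' by blast
qed

text \<open>
  The error \<open>h s t\<close> over \<open>[s,t)\<close> is additive and bounded by \<open>C M(s,t)\<^sup>2\<close>. Every point has a neighbourhood in
  which the punctured one-sided intervals have measure at most \<open>e\<close>; there \<open>\<bar>h\<bar> \<le> e C M\<close>, and bisection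
  extends this bound to every interval. Now let \<open>e\<close> tend to \<open>0\<close>.
\<close>

lemma interval_identity:
  fixes g\<^sub>m g\<^sub>p :: "real \<Rightarrow> 'a::real_normed_vector"
  assumes D: "measure_on {0<..<c} D" and C: "0 \<le> C"
    and jump: "\<And>s. 0 < s \<Longrightarrow> s < c \<Longrightarrow> g\<^sub>p s - g\<^sub>m s = D {s}"
    and quad: "\<And>s t. 0 < s \<Longrightarrow> s < t \<Longrightarrow> t < c \<Longrightarrow>
       norm (g\<^sub>m t - g\<^sub>p s - D {s<..<t}) \<le> C * (measure M {s<..<t})\<^sup>2"
    and st: "0 < s" "s < t" "t < c"
  shows "g\<^sub>m t - g\<^sub>p s = D {s<..<t}"
proof -
  define h where "h s t = g\<^sub>m t - g\<^sub>m s - D {s..<t}" for s t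
  have h_add: "h x z = h x y + h y z" if "0 < x" "x \<le> y" "y \<le> z" "z < c" for x y z
  proof -
    have "D ({x..<y} \<union> {y..<z}) = D {x..<y} + D {y..<z}"
      by (rule measure_on_Un[OF D]) (use that in auto)
    moreover have "{x..<y} \<union> {y..<z} = {x..<z}" using that by auto
    ultimately show ?thesis by (simp add: h_def)
  qed
  have h_quad: "norm (h x y) \<le> C * (measure M {x<..<y})\<^sup>2" if "0 < x" "x \<le> y" "y < c" for x y
  proof (cases "x = y")
    case True
    then show ?thesis using measure_on_empty[OF D] by (simp add: h_def)
  next
    case False
    then have "D ({x} \<union> {x<..<y}) = D {x} + D {x<..<y}"
      by (intro measure_on_Un[OF D]) (use that in auto)
    moreover have "{x} \<union> {x<..<y} = {x..<y}" using that False by auto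
    ultimately have "h x y = g\<^sub>m y - g\<^sub>p x - D {x<..<y}"
      using jump[of x] that unfolding h_def by (simp add: algebra_simps)
    then show ?thesis using quad[of x y] that False by simp
  qed
  have small: "norm (h s t) \<le> e * (C * measure M UNIV)" if "e > 0" for e
  proof -
    have "s \<le> t" using st by simp
    then have "0 < s \<longrightarrow> t < c \<longrightarrow> norm (h s t) \<le> e * (C * measure M {s..<t})"
    proof (induction rule: Bolzano)
      case (trans x y z)
      have "measure M {x..<z} = measure M {x..<y} + measure M {y..<z}"
        using trans measure_add[of "{x..<y}" "{y..<z}"] by (auto simp: ivl_disj_un_two)
      then show ?case
        using trans h_add[of x y z] norm_triangle_ineq[of "h x y" "h y z"] by (auto simp: algebra_simps)
    next
      case (local x)
      have "eventually (\<lambda>y. measure M {y..<x} < e) (at_left x)" "eventually (\<lambda>y. measure M {x<..y} < e) (at_right x)"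
        using order_tendstoD(2)[OF measure_left_null \<open>e > 0\<close>] order_tendstoD(2)[OF measure_right_null \<open>e > 0\<close>] by auto
      then obtain y\<^sub>1 y\<^sub>2 where y: "y\<^sub>1 < x" "\<And>y. y\<^sub>1 < y \<Longrightarrow> y < x \<Longrightarrow> measure M {y..<x} < e"
        "x < y\<^sub>2" "\<And>y. x < y \<Longrightarrow> y < y\<^sub>2 \<Longrightarrow> measure M {x<..y} < e"
        unfolding eventually_at_left_field eventually_at_right_field by blast
      define d where "d = min (x - y\<^sub>1) (y\<^sub>2 - x)"
      have half: "norm (h p r) \<le> e * (C * measure M {p..<r})"
        if "0 < p" "p \<le> r" "r < c" "measure M {p<..<r} \<le> e" for p r
      proof -
        have "norm (h p r) \<le> C * (measure M {p<..<r})\<^sup>2" by (rule h_quad) (use that in auto)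
        also have "\<dots> \<le> C * (e * measure M {p..<r})"
          unfolding power2_eq_square
          by (intro mult_left_mono mult_mono measure_mono) (use that \<open>e > 0\<close> C in auto)
        finally show ?thesis by (simp add: algebra_simps)
      qed
      have "norm (h a b) \<le> e * (C * measure M {a..<b})" if ab: "a \<le> x" "x \<le> b" "b - a < d" "0 < a" "b < c" for a b
      proof -
        have "measure M {a<..<x} \<le> e"
        proof (cases "a = x")
          case False
          then have "measure M {a..<x} < e" using y(2)[of a] ab by (auto simp: d_def)
          moreover have "measure M {a<..<x} \<le> measure M {a..<x}" by (rule measure_mono) auto
          ultimately show ?thesis by linarith
        qed (use \<open>e > 0\<close> in simp)
        moreover have "measure M {x<..<b} \<le> e"
        proof (cases "b = x")
          case False
          then have "measure M {x<..b} < e" using y(4)[of b] ab by (auto simp: d_def)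
          moreover have "measure M {x<..<b} \<le> measure M {x<..b}" by (rule measure_mono) auto
          ultimately show ?thesis by linarith
        qed (use \<open>e > 0\<close> in simp)
        ultimately have "norm (h a x) + norm (h x b) \<le> e * (C * measure M {a..<x}) + e * (C * measure M {x..<b})"
          using half[of a x] half[of x b] ab by auto
        moreover have "measure M {a..<b} = measure M {a..<x} + measure M {x..<b}"
          using ab measure_add[of "{a..<x}" "{x..<b}"] by (auto simp: ivl_disj_un_two)
        ultimately show ?thesis
          using h_add[of a x b] ab norm_triangle_ineq[of "h a x" "h x b"] by (auto simp: algebra_simps)
      qed
      then show ?case using y by (intro exI[of _ d]) (auto simp: d_def)
    qed
    moreover have "e * (C * measure M {s..<t}) \<le> e * (C * measure M UNIV)"
      using \<open>e > 0\<close> C by (intro mult_left_mono measure_mono) auto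
    ultimately show ?thesis using st by auto
  qed
  have "norm (h s t) \<le> 0"
  proof (rule field_le_epsilon)
    fix e :: real assume "e > 0"
    \<comment> \<open>The summand \<open>1\<close> makes the divisor positive.\<close>
    define B where "B = C * measure M UNIV + 1"
    have "B > 0" unfolding B_def using C by (simp add: add_nonneg_pos)
    have "norm (h s t) \<le> e / B * (C * measure M UNIV)"
      by (rule small) (use \<open>e > 0\<close> \<open>B > 0\<close> in simp)
    also have "\<dots> \<le> e / B * B"
      using \<open>e > 0\<close> \<open>B > 0\<close> by (intro mult_left_mono) (auto simp: B_def)
    finally show "norm (h s t) \<le> 0 + e" using \<open>B > 0\<close> by simp
  qed
  then have "h s t = 0" by simp
  moreover have "D ({s} \<union> {s<..<t}) = D {s} + D {s<..<t}"
    by (rule measure_on_Un[OF D]) (use st in auto)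
  moreover have "{s} \<union> {s<..<t} = {s..<t}" using st by auto
  ultimately show ?thesis using jump[of s] st unfolding h_def by (simp add: algebra_simps)
qed

lemma sum_atoms_le:
  assumes "finite F" "F \<subseteq> E" "E \<in> sets borel"
  shows "(\<Sum>y\<in>F. measure M {y}) \<le> measure M E"
proof -
  have "measure M F = (\<Sum>y\<in>F. measure M {y})"
    by (rule finite_measure_eq_sum_singleton) (use assms in auto)
  then show ?thesis using measure_mono[of F E] assms by simp
qed

lemma sum_atoms_squared_le:
  assumes F: "finite F" "F \<subseteq> E" "E \<in> sets borel"
  shows "(\<Sum>y\<in>F. (measure M {y})\<^sup>2) \<le> (measure M E)\<^sup>2"
proof -
  have "(\<Sum>y\<in>F. (measure M {y})\<^sup>2) \<le> (\<Sum>y\<in>F. measure M E * measure M {y})"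
    unfolding power2_eq_square
    by (intro sum_mono mult_right_mono measure_mono) (use F in auto)
  also have "\<dots> \<le> measure M E * measure M E"
    unfolding sum_distrib_left[symmetric] by (intro mult_left_mono sum_atoms_le[OF F]) auto
  finally show ?thesis by (simp add: power2_eq_square)
qed

lemma finite_large_atoms:
  assumes "0 < e" shows "finite {y. e < measure M {y}}"
proof (rule ccontr)
  assume "infinite {y. e < measure M {y}}"
  then obtain F where F: "finite F" "card F = nat \<lceil>measure M UNIV / e\<rceil> + 1" "F \<subseteq> {y. e < measure M {y}}"
    using infinite_arbitrarily_large by blast
  have "measure M UNIV / e < real (card F)" unfolding F(2) by linarith
  then have "measure M UNIV < e * card F" using assms by (simp add: field_simps)
  also have "\<dots> = (\<Sum>y\<in>F. e)" by simp
  also have "\<dots> \<le> (\<Sum>y\<in>F. measure M {y})" by (rule sum_mono) (use F in auto)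
  also have "\<dots> \<le> measure M UNIV" by (rule sum_atoms_le[OF F(1)]) auto
  finally show False by simp
qed

text \<open>
  Only finitely many atoms exceed a given size, so an estimate for small atoms holds for all of them with a
  larger constant.
\<close>

lemma squared_atom_bound:
  fixes g :: "real \<Rightarrow> 'b::real_normed_vector"
  assumes "0 < \<eta>" and small: "\<And>y. y \<in> X \<Longrightarrow> measure M {y} \<le> \<eta> \<Longrightarrow> norm (g y) \<le> K * (measure M {y})\<^sup>2"
  shows "\<exists>K'\<ge>0. \<forall>y\<in>X. norm (g y) \<le> K' * (measure M {y})\<^sup>2"
proof -
  define F where "F = {y. \<eta> < measure M {y}}"
  have F: "finite F" unfolding F_def by (rule finite_large_atoms[OF assms(1)])
  define S where "S = (\<Sum>y\<in>F. norm (g y) / (measure M {y})\<^sup>2)"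
  have S: "0 \<le> S" unfolding S_def by (rule sum_nonneg) auto
  have "norm (g y) \<le> (\<bar>K\<bar> + S) * (measure M {y})\<^sup>2" if "y \<in> X" for y
  proof (cases "y \<in> F")
    case True
    have "norm (g y) / (measure M {y})\<^sup>2 \<le> S"
      unfolding S_def by (rule member_le_sum) (use True F in auto)
    also have "\<dots> \<le> \<bar>K\<bar> + S" by simp
    finally show ?thesis using True assms(1) by (simp add: F_def field_simps)
  next
    case False
    then have "norm (g y) \<le> K * (measure M {y})\<^sup>2" using small that by (auto simp: F_def)
    also have "\<dots> \<le> (\<bar>K\<bar> + S) * (measure M {y})\<^sup>2" using S by (intro mult_right_mono) auto
    finally show ?thesis .
  qed
  then show ?thesis using S by (intro exI[of _ "\<bar>K\<bar> + S"]) auto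
qed

lemma abs_summable_atoms:
  fixes f :: "real \<Rightarrow> complex"
  assumes "\<And>y. y \<in> E \<Longrightarrow> norm (f y) \<le> K * measure M {y}" "E \<in> sets borel" "0 \<le> K"
  shows "(\<lambda>y. norm (f y)) summable_on E"
proof (rule nonneg_bdd_above_summable_on)
  show "bdd_above (sum (\<lambda>y. norm (f y)) ` {F. F \<subseteq> E \<and> finite F})"
  proof (rule bdd_aboveI2)
    fix F assume F: "F \<in> {F. F \<subseteq> E \<and> finite F}"
    have "(\<Sum>y\<in>F. norm (f y)) \<le> (\<Sum>y\<in>F. K * measure M {y})" by (rule sum_mono) (use F assms in auto)
    also have "\<dots> \<le> K * measure M E"
      unfolding sum_distrib_left[symmetric] by (intro mult_left_mono sum_atoms_le) (use F assms in auto)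
    finally show "(\<Sum>y\<in>F. norm (f y)) \<le> K * measure M E" .
  qed
qed auto

end

section \<open>Vectors and matrices in two dimensions\<close>

lemma J_entries [simp]: "J $ 1 $ 1 = 0" "J $ 1 $ 2 = - 1" "J $ 2 $ 1 = 1" "J $ 2 $ 2 = 0"
  by (simp_all add: J_def)

lemma J_mult: "(J *v z) $ 1 = - z $ 2" "(J *v z) $ 2 = z $ 1"
  by (simp_all add: matrix_vector_mult_def sum_2)

lemma J_J: "J *v (J *v z) = - z"
  by (simp add: vec_eq_iff forall_2 J_mult)

lemma J_uminus: "J *v (- z) = - (J *v z)"
  by (simp add: vec_eq_iff forall_2 J_mult)

lemma norm_J_mult: "norm (J *v z) = norm z"
  by (simp add: norm_vec_def L2_set_def sum_2 J_mult add.commute)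

lemma bounded_linear_J: "bounded_linear ((*v) J)"
  by (intro linear_conv_bounded_linear[THEN iffD1] linearI) (simp_all add: vec_eq_iff forall_2 J_mult)

lemma norm_smult: "norm (a *s z) = norm a * norm (z :: complex^2)"
  by (simp add: norm_vec_def L2_set_right_distrib norm_mult)

lemma norm_vec_cnj: "norm (vec_cnj z) = norm z"
  by (simp add: norm_vec_def vec_cnj_def)

lemma norm_le_components: "norm (z :: complex^2) \<le> norm (z $ 1) + norm (z $ 2)"
  unfolding norm_vec_def using L2_set_le_sum[of UNIV "\<lambda>i. norm (z $ i)"] by (simp add: sum_2)

lemma vec_cnj_diff: "vec_cnj (a - b) = vec_cnj a - vec_cnj b"
  by (simp add: vec_cnj_def vec_eq_iff)

lemma vec_cnj_nth [simp]: "vec_cnj z $ i = cnj (z $ i)"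
  by (simp add: vec_cnj_def)

lemma tendsto_vec_cnj: "(f \<longlongrightarrow> l) F \<Longrightarrow> ((\<lambda>x. vec_cnj (f x)) \<longlongrightarrow> vec_cnj l) F"
  by (rule vec_tendstoI) (auto intro!: tendsto_cnj tendsto_vec_nth)

lemma tendsto_smult:
  fixes f :: "'b \<Rightarrow> complex" and g :: "'b \<Rightarrow> complex^2"
  shows "(f \<longlongrightarrow> k) F \<Longrightarrow> (g \<longlongrightarrow> l) F \<Longrightarrow> ((\<lambda>x. f x *s g x) \<longlongrightarrow> k *s l) F"
  by (rule vec_tendstoI) (auto intro!: tendsto_mult tendsto_vec_nth)

lemma hermitian_entries:
  assumes "hermitian A"
  shows "A $ 2 $ 1 = cnj (A $ 1 $ 2)" "cnj (A $ 1 $ 1) = A $ 1 $ 1" "cnj (A $ 2 $ 2) = A $ 2 $ 2"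
proof -
  have "A $ i $ j = cnj (A $ j $ i)" for i j
  proof -
    have "A $ i $ j = transpose (map_matrix cnj A) $ i $ j" using assms unfolding hermitian_def by (rule arg_cong)
    then show ?thesis by (simp add: transpose_def)
  qed
  then show "A $ 2 $ 1 = cnj (A $ 1 $ 2)" "cnj (A $ 1 $ 1) = A $ 1 $ 1" "cnj (A $ 2 $ 2) = A $ 2 $ 2"
    by metis+
qed

context dominating_measure
begin

lemma dominated_vec_cnj:
  "dominated f\<^sub>m f\<^sub>p K \<Longrightarrow> dominated (\<lambda>x. vec_cnj (f\<^sub>m x)) (\<lambda>x. vec_cnj (f\<^sub>p x)) K"
  unfolding dominated_def by (simp add: norm_vec_cnj flip: vec_cnj_diff)

lemma dominated_smult:
  fixes g\<^sub>m g\<^sub>p :: "real \<Rightarrow> complex^2"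
  assumes f: "dominated f\<^sub>m f\<^sub>p K" and g: "dominated g\<^sub>m g\<^sub>p L" and c: "0 < c"
  shows "\<exists>C. dominated (\<lambda>x. f\<^sub>m x *s g\<^sub>m x) (\<lambda>x. f\<^sub>p x *s g\<^sub>p x) C"
proof -
  obtain U where U: "0 \<le> U" "\<And>x. 0 < x \<Longrightarrow> x < c \<Longrightarrow> norm (f\<^sub>m x) \<le> U" "\<And>x. 0 < x \<Longrightarrow> x < c \<Longrightarrow> norm (f\<^sub>p x) \<le> U"
    using dominated_bounded[OF f c] by metis
  obtain V where V: "0 \<le> V" "\<And>x. 0 < x \<Longrightarrow> x < c \<Longrightarrow> norm (g\<^sub>m x) \<le> V" "\<And>x. 0 < x \<Longrightarrow> x < c \<Longrightarrow> norm (g\<^sub>p x) \<le> V"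
    using dominated_bounded[OF g c] by metis
  have K: "0 \<le> K" and L: "0 \<le> L" using dominated_const_nonneg f g by auto
  have *: "norm (a *s b - a' *s b') \<le> (U * L + K * V) * m"
    if "norm a \<le> U" "norm b' \<le> V" "norm (a - a') \<le> K * m" "norm (b - b') \<le> L * m" "0 \<le> m"
    for a a' :: complex and b b' :: "complex^2" and m
  proof -
    have "a *s b - a' *s b' = a *s (b - b') + (a - a') *s b'" by (simp add: vec_eq_iff algebra_simps)
    also have "norm \<dots> \<le> norm a * norm (b - b') + norm (a - a') * norm b'"
      by (rule norm_triangle_mono) (simp_all only: norm_smult order_refl)
    also have "\<dots> \<le> U * (L * m) + (K * m) * V"
      by (intro add_mono mult_mono that) (use U(1) K that in auto)
    finally show ?thesis by (simp add: algebra_simps)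
  qed
  have "dominated (\<lambda>x. f\<^sub>m x *s g\<^sub>m x) (\<lambda>x. f\<^sub>p x *s g\<^sub>p x) (U * L + K * V)"
    unfolding dominated_def
  proof (intro conjI allI impI)
    fix s t :: real assume st: "0 < s" "s < t" "t < c"
    then show "norm (f\<^sub>m t *s g\<^sub>m t - f\<^sub>p s *s g\<^sub>p s) \<le> (U * L + K * V) * measure M {s<..<t}"
      by (intro * U V dominated_mp[OF f] dominated_mp[OF g]) auto
  next
    fix s :: real assume "0 < s" "s < c"
    then show "norm (f\<^sub>p s *s g\<^sub>p s - f\<^sub>m s *s g\<^sub>m s) \<le> (U * L + K * V) * measure M {s}"
      by (intro * U V dominated_jump[OF f] dominated_jump[OF g]) auto
  qed (use U V K L in simp)
  then show ?thesis ..
qed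

end

section \<open>The coefficient measures and their majorant\<close>

definition pencil where
  "pencil q w l E = q E - map_matrix ((*) l) (w E)"

definition pencil_times where
  "pencil_times q w l u E = times_fun q u E - l *s times_fun w u E"

lemma pencil_entry: "pencil q w l E $ i $ j = q E $ i $ j - l * w E $ i $ j"
  by (simp add: pencil_def map_matrix_def)

lemma B_det:
  fixes q w l y
  defines "D \<equiv> pencil q w l {y}"
  shows "det (B_plus q w y l) = 1 + det D / 4 - (D $ 1 $ 2 - D $ 2 $ 1) / 2"
    and "det (B_minus q w y l) = 1 + det D / 4 + (D $ 1 $ 2 - D $ 2 $ 1) / 2"
proof -
  have eq: "B_plus q w y l $ i $ j = J $ i $ j + D $ i $ j / 2" "B_minus q w y l $ i $ j = J $ i $ j - D $ i $ j / 2" for i j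
    by (simp_all add: B_plus_def B_minus_def D_def pencil_def scaleR_conv_of_real[where 'a=complex])
  show "det (B_plus q w y l) = 1 + det D / 4 - (D $ 1 $ 2 - D $ 2 $ 1) / 2"
    "det (B_minus q w y l) = 1 + det D / 4 + (D $ 1 $ 2 - D $ 2 $ 1) / 2"
    unfolding det_2 eq by (simp_all add: field_simps)
qed

lemma pencil_times_cong:
  assumes E: "E \<in> sets borel" and eq: "\<And>x. x \<in> E \<Longrightarrow> f x = g x"
  shows "pencil_times q w l f E = pencil_times q w l g E"
proof -
  have *: "integral\<^sup>L (positive_part E \<rho>) (\<lambda>x. f x $ j) = integral\<^sup>L (positive_part E \<rho>) (\<lambda>x. g x $ j)" for \<rho> j
    by (rule Bochner_Integration.integral_cong) (auto simp: space_positive_part[OF E] eq)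
  show ?thesis
    unfolding pencil_times_def times_fun_def integral_complex_def integral_real_def * ..
qed

text \<open>
  The coefficients on an interval \<open>(0,c)\<close> on which they are finite measures. Invertibility of \<open>B\<^sub>+\<close> and
  \<open>B\<^sub>-\<close> is assumed at \<open>\<lambda>\<close>; by Hermitian symmetry it carries over to \<open>cnj \<lambda>\<close> (\<open>B_cnj\<close>).
\<close>

locale regular_system =
  fixes q w :: "real set \<Rightarrow> complex^2^2" and c :: real and lam :: complex
  assumes c_pos: "0 < c"
    and q_measure: "measure_on {0<..<c} q" and w_measure: "measure_on {0<..<c} w"
    and herm: "\<And>E s t. E \<in> sets borel \<Longrightarrow> E \<subseteq> {s..t} \<Longrightarrow> 0 < s \<Longrightarrow> t < c \<Longrightarrow> hermitian (q E) \<and> hermitian (w E)"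
    and nonresonant: "\<And>y. 0 < y \<Longrightarrow> y < c \<Longrightarrow> det (B_plus q w y lam) * det (B_minus q w y lam) \<noteq> 0"

begin

lemma entry_measure: "measure_on {0<..<c} (entry q i j)" "measure_on {0<..<c} (entry w i j)"
proof -
  have *: "bounded_linear (\<lambda>A::complex^2^2. A $ i $ j)"
    using bounded_linear_compose[OF bounded_linear_vec_nth bounded_linear_vec_nth] .
  show "measure_on {0<..<c} (entry q i j)" "measure_on {0<..<c} (entry w i j)"
    using measure_on_bounded_linear[OF * q_measure] measure_on_bounded_linear[OF * w_measure]
    unfolding entry_def by simp_all
qed

text \<open>
  The factor \<open>1 + \<bar>\<lambda>\<bar>\<close> lets one set function bound \<open>q - \<lambda> w\<close> and \<open>q - cnj \<lambda> w\<close> at once, with constant \<open>1\<close>.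
\<close>

definition weight :: "real set \<Rightarrow> real" where
  "weight E = (1 + norm lam) * (\<Sum>i\<in>UNIV. \<Sum>j\<in>UNIV. complex_variation (entry q i j) E + complex_variation (entry w i j) E)"

lemma weight_measure: "measure_on {0<..<c} weight"
  unfolding weight_def
  by (intro measure_on_bounded_linear[OF bounded_linear_mult_right] measure_on_sum measure_on_add
      measure_on_complex_variation entry_measure) auto

lemma weight_nonneg: "0 \<le> weight E"
  unfolding weight_def by (intro mult_nonneg_nonneg sum_nonneg add_nonneg_nonneg complex_variation_nonneg) auto

text \<open>
  The non-negative set function \<open>weight\<close>, turned into a measure on the line.
\<close>

definition majorant :: "real measure" where
  "majorant = positive_part UNIV (\<lambda>E. weight (E \<inter> {0<..<c}))"

lemma weight_Int: "measure_on UNIV (\<lambda>E. weight (E \<inter> {0<..<c}))"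
  by (rule measure_on_Int[OF weight_measure]) simp

sublocale dominating_measure majorant c
proof (intro dominating_measure.intro dominating_measure_axioms.intro)
  show "finite_measure majorant"
    unfolding majorant_def by (rule finite_measure_positive_part[OF _ weight_Int]) simp
  show "sets majorant = sets borel" unfolding majorant_def by (subst sets_positive_part) auto
qed

lemma measure_majorant:
  assumes "E \<in> sets borel" "E \<subseteq> {0<..<c}"
  shows "measure majorant E = weight E"
proof -
  have "measure majorant E = upper_var (\<lambda>E. weight (E \<inter> {0<..<c})) E"
    unfolding majorant_def by (rule measure_positive_part[OF _ weight_Int]) (use assms in auto)
  also have "\<dots> = weight (E \<inter> {0<..<c})"
    by (rule upper_var_nonneg_measure[OF assms(1) measure_on_subset[OF weight_Int]]) (auto simp: weight_nonneg)
  finally show ?thesis using assms(2) by (simp add: Int_absorb2)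
qed

lemma entries_le_majorant:
  assumes E: "E \<in> sets borel" "E \<subseteq> {0<..<c}"
  shows "(1 + norm lam) * (norm (entry q i j E) + norm (entry w i j E)) \<le> measure majorant E"
proof -
  have "norm (entry q i j E) + norm (entry w i j E) \<le> complex_variation (entry q i j) E + complex_variation (entry w i j) E"
    by (intro add_mono norm_le_complex_variation measure_on_subset[OF entry_measure(1)] measure_on_subset[OF entry_measure(2)] E)
  also have "\<dots> \<le> (\<Sum>j\<in>UNIV. complex_variation (entry q i j) E + complex_variation (entry w i j) E)"
    by (rule member_le_sum) (auto simp: complex_variation_nonneg add_nonneg_nonneg)
  also have "\<dots> \<le> (\<Sum>i\<in>UNIV. \<Sum>j\<in>UNIV. complex_variation (entry q i j) E + complex_variation (entry w i j) E)"
    by (rule member_le_sum[where f="\<lambda>i. \<Sum>j\<in>UNIV. complex_variation (entry q i j) E + complex_variation (entry w i j) E"])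
       (auto simp: complex_variation_nonneg add_nonneg_nonneg sum_nonneg)
  finally show ?thesis
    unfolding measure_majorant[OF E] weight_def by (intro mult_left_mono) auto
qed

lemma entry_le_majorant:
  assumes E: "E \<in> sets borel" "E \<subseteq> {0<..<c}"
  shows "norm (entry q i j E) \<le> measure majorant E" "norm (entry w i j E) \<le> measure majorant E"
    "norm (entry q i j E) + norm lam * norm (entry w i j E) \<le> measure majorant E"
proof -
  have "norm (entry q i j E) + norm (entry w i j E) + norm lam * norm (entry q i j E) + norm lam * norm (entry w i j E) \<le> measure majorant E"
    using entries_le_majorant[OF E, of i j] by (simp add: algebra_simps)
  moreover have "0 \<le> norm lam * norm (entry q i j E)" "0 \<le> norm lam * norm (entry w i j E)" by simp_all
  ultimately show "norm (entry q i j E) \<le> measure majorant E" "norm (entry w i j E) \<le> measure majorant E"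
    "norm (entry q i j E) + norm lam * norm (entry w i j E) \<le> measure majorant E"
    using norm_ge_zero[of "entry q i j E"] norm_ge_zero[of "entry w i j E"] by linarith+
qed

lemma pencil_le_majorant:
  assumes E: "E \<in> sets borel" "E \<subseteq> {0<..<c}" and l: "norm l = norm lam"
  shows "norm (pencil q w l E $ i $ j) \<le> measure majorant E"
proof -
  have "norm (pencil q w l E $ i $ j) \<le> norm (entry q i j E) + norm lam * norm (entry w i j E)"
    unfolding pencil_entry entry_def by (rule norm_triangle_le_diff) (simp add: norm_mult l)
  then show ?thesis using entry_le_majorant(3)[OF E] by (rule order_trans)
qed

lemma pencil_times_approx:
  assumes E: "E \<in> sets borel" "E \<subseteq> {0<..<c}" and l: "norm l = norm lam"
    and f: "\<And>j. (\<lambda>x. f x $ j) \<in> borel_measurable (restrict_space borel {0<..<c})"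
    and B: "0 \<le> B" "\<And>x. x \<in> E \<Longrightarrow> norm (f x - k) \<le> B"
  shows "norm (pencil_times q w l f E - pencil q w l E *v k) \<le> B * measure majorant E"
proof -
  let ?V = "\<lambda>i j. complex_variation (entry q i j) E + complex_variation (entry w i j) E"
  let ?z = "pencil_times q w l f E - pencil q w l E *v k"
  \<comment> \<open>Each entry of \<open>q\<close> and \<open>w\<close> contributes the error of its own scalar integral.\<close>
  have comp: "norm (?z $ i) \<le> B * (1 + norm lam) * (\<Sum>j\<in>UNIV. ?V i j)" for i
  proof -
    have fE: "(\<lambda>x. f x $ j) \<in> borel_measurable (restrict_space borel E)" for j
      using f[of j] E(2) by (rule measurable_restrict_mono)
    have Bj: "norm (f x $ j - k $ j) \<le> B" if "x \<in> E" for x j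
      using B(2)[OF that] Finite_Cartesian_Product.norm_nth_le[of "f x - k" j] by simp
    let ?I = "\<lambda>m j. integral_complex E (entry m i j) (\<lambda>x. f x $ j) - entry m i j E * k $ j"
    have I: "norm (?I q j) \<le> B * complex_variation (entry q i j) E" "norm (?I w j) \<le> B * complex_variation (entry w i j) E" for j
      using integral_complex_approx[OF E(1) measure_on_subset[OF entry_measure(1) E(2)] fE Bj]
        integral_complex_approx[OF E(1) measure_on_subset[OF entry_measure(2) E(2)] fE Bj] by simp_all
    have "?z $ i = (\<Sum>j\<in>UNIV. ?I q j - l * ?I w j)"
      unfolding pencil_times_def times_fun_def matrix_vector_mult_def
      by (simp add: pencil_entry entry_def sum_2 algebra_simps)
    also have "norm \<dots> \<le> (\<Sum>j\<in>UNIV. B * (1 + norm lam) * ?V i j)"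
    proof (rule sum_norm_le)
      fix j :: 2
      have "norm (?I q j - l * ?I w j) \<le> norm (?I q j) + norm lam * norm (?I w j)"
        by (rule norm_triangle_le_diff) (simp add: norm_mult l)
      also have "\<dots> \<le> B * complex_variation (entry q i j) E + norm lam * (B * complex_variation (entry w i j) E)"
        by (intro add_mono mult_left_mono I) auto
      also have "\<dots> \<le> B * (1 + norm lam) * ?V i j"
        using B(1) by (simp add: algebra_simps complex_variation_nonneg)
      finally show "norm (?I q j - l * ?I w j) \<le> B * (1 + norm lam) * ?V i j" .
    qed
    finally show ?thesis by (simp add: sum_distrib_left)
  qed
  have "norm ?z \<le> norm (?z $ 1) + norm (?z $ 2)" by (rule norm_le_components)
  also have "\<dots> \<le> B * weight E"
    using comp[of 1] comp[of 2] unfolding weight_def sum_2[of "\<lambda>i. sum (?V i) UNIV"] by (simp add: algebra_simps)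
  finally show ?thesis unfolding measure_majorant[OF E] .
qed

lemma pencil_times_measure:
  assumes f: "\<And>j. (\<lambda>x. f x $ j) \<in> borel_measurable (restrict_space borel {0<..<c})"
    and B: "\<And>x. x \<in> {0<..<c} \<Longrightarrow> norm (f x) \<le> B"
  shows "measure_on {0<..<c} (pencil_times q w l f)"
proof -
  have comp: "norm (f x $ j) \<le> B" if "x \<in> {0<..<c}" for x j
    using B[OF that] Finite_Cartesian_Product.norm_nth_le[of "f x" j] by simp
  have axis: "bounded_linear (\<lambda>z::complex. axis i z :: complex^2)" for i :: 2
    by (intro linear_conv_bounded_linear[THEN iffD1] linearI) (auto simp: vec_eq_iff axis_def)
  have part: "measure_on {0<..<c} (times_fun m f)" if m: "\<And>i j. measure_on {0<..<c} (entry m i j)" for m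
  proof -
    have eq: "times_fun m f = (\<lambda>E. \<Sum>i\<in>UNIV. axis i (\<Sum>j\<in>UNIV. integral_complex E (entry m i j) (\<lambda>x. f x $ j)))"
      unfolding times_fun_def by (rule ext) (simp add: vec_eq_iff axis_def forall_2 sum_2)
    show ?thesis unfolding eq
      by (intro measure_on_sum measure_on_bounded_linear[OF axis] measure_on_integral_complex[OF _ m f comp]) auto
  qed
  have lin: "bounded_linear (\<lambda>z::complex^2. l *s z)"
    by (intro linear_conv_bounded_linear[THEN iffD1] linearI) (auto simp: vec_eq_iff algebra_simps)
  show ?thesis unfolding pencil_times_def
    by (intro measure_on_diff measure_on_bounded_linear[OF lin] part entry_measure)
qed

lemma pencil_times_singleton:
  assumes "0 < x" "x < c" and l: "norm l = norm lam"
    and f: "\<And>j. (\<lambda>x. f x $ j) \<in> borel_measurable (restrict_space borel {0<..<c})"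
  shows "pencil_times q w l f {x} = pencil q w l {x} *v f x"
proof -
  \<comment> \<open>On a single point the integrand has oscillation \<open>0\<close>.\<close>
  have "norm (pencil_times q w l f {x} - pencil q w l {x} *v f x) \<le> 0 * measure majorant {x}"
    by (rule pencil_times_approx) (use assms in auto)
  then show ?thesis by simp
qed

lemma measurable_mid:
  fixes f\<^sub>m f\<^sub>p :: "real \<Rightarrow> complex^2"
  assumes "\<And>x. 0 < x \<Longrightarrow> x < c \<Longrightarrow> (g \<longlongrightarrow> f\<^sub>m x) (at_left x)"
    and "\<And>x. 0 < x \<Longrightarrow> x < c \<Longrightarrow> (g \<longlongrightarrow> f\<^sub>p x) (at_right x)"
    and f: "\<And>x. 0 < x \<Longrightarrow> x < c \<Longrightarrow> f x = mid f\<^sub>m f\<^sub>p x"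
  shows "(\<lambda>x. f x $ j) \<in> borel_measurable (restrict_space borel {0<..<c})"
proof -
  have "(\<lambda>x. f\<^sub>m x $ j) \<in> borel_measurable (restrict_space borel {0<..<c})"
    by (rule borel_measurable_left_limit[where f="\<lambda>x. g x $ j"]) (use assms(1) in \<open>auto intro: tendsto_vec_nth\<close>)
  moreover have "(\<lambda>x. f\<^sub>p x $ j) \<in> borel_measurable (restrict_space borel {0<..<c})"
    by (rule borel_measurable_right_limit[where f="\<lambda>x. g x $ j"]) (use assms(2) in \<open>auto intro: tendsto_vec_nth\<close>)
  ultimately have "(\<lambda>x. (1/2) *\<^sub>R (f\<^sub>m x $ j + f\<^sub>p x $ j)) \<in> borel_measurable (restrict_space borel {0<..<c})"
    by simp
  then show ?thesis
    by (rule measurable_cong[THEN iffD1, rotated]) (simp add: space_restrict_space f mid_def)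
qed

text \<open>
  For Hermitian coefficients, \<open>q - cnj \<lambda> w\<close> is the conjugate transpose of \<open>q - \<lambda> w\<close>. Hermitian symmetry
  is available on sets that stay away from \<open>0\<close>.
\<close>

lemma pencil_cnj:
  assumes "E \<in> sets borel" "E \<subseteq> {s..t}" "0 < s" "t < c"
  shows "pencil q w (cnj lam) E $ i $ j = cnj (pencil q w lam E $ j $ i)"
proof -
  have h: "hermitian (q E)" "hermitian (w E)" using herm[OF assms] by auto
  show ?thesis
    using exhaust_2[of i] exhaust_2[of j] hermitian_entries[OF h(1)] hermitian_entries[OF h(2)]
    by (auto simp: pencil_entry)
qed

end

section \<open>The multiplier as the exponential of a set function\<close>

text \<open>
  With \<open>d = 1 + e - \<mu>/2\<close> the quotient is \<open>1 + z\<close> for \<open>z = \<mu>/d\<close>. Here \<open>z - \<mu> = z (1 - d)\<close> and \<open>Ln (1 + z) - z\<close> are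
  both of second order.
\<close>

lemma Ln_ratio_approx:
  fixes \<mu> e :: complex
  assumes \<mu>: "norm \<mu> \<le> 2 * m" and e: "norm e \<le> m\<^sup>2" and m: "m \<le> 1/16"
  shows "norm (Ln ((1 + e + \<mu> / 2) / (1 + e - \<mu> / 2)) - \<mu>) \<le> 17 * m\<^sup>2"
proof -
  have m0: "0 \<le> m" using \<mu> norm_ge_zero[of \<mu>] by linarith
  have mm: "m\<^sup>2 \<le> m" using m0 m by (simp add: power2_eq_square mult_left_le)
  define d where "d = 1 + e - \<mu> / 2"
  have d1: "norm (1 - d) \<le> 2 * m"
  proof -
    have "1 - d = \<mu> / 2 - e" unfolding d_def by simp
    then have "norm (1 - d) \<le> norm (\<mu> / 2) + norm e" by (metis norm_triangle_ineq4)
    then show ?thesis using \<mu> e mm by (simp add: norm_divide)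
  qed
  have d: "7/8 \<le> norm d"
  proof -
    have "norm (1::complex) \<le> norm (1 - d) + norm d"
      using norm_triangle_ineq[of "1 - d" d] by simp
    then show ?thesis using d1 m by simp
  qed
  then have "d \<noteq> 0" by auto
  define z where "z = \<mu> / d"
  have z: "norm z \<le> 3 * m"
  proof -
    have "norm z \<le> 2 * m / (7/8)" unfolding z_def norm_divide using \<mu> d m0 by (intro frac_le) auto
    then show ?thesis using m0 by simp
  qed
  have z\<mu>: "norm (z - \<mu>) \<le> 5 * m\<^sup>2"
  proof -
    have "z - \<mu> = z * (1 - d)" unfolding z_def using \<open>d \<noteq> 0\<close> by (simp add: field_simps)
    then have "norm (z - \<mu>) = norm z * norm (1 - d)" by (simp add: norm_mult)
    also have "\<dots> \<le> (2 * m / (7/8)) * (2 * m)"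
      unfolding z_def norm_divide using \<mu> d d1 m0 by (intro mult_mono frac_le) auto
    also have "\<dots> \<le> 5 * m\<^sup>2" by (simp add: power2_eq_square)
    finally show ?thesis .
  qed
  have Lz: "norm (Ln (1 + z) - z) \<le> 12 * m\<^sup>2"
  proof -
    have "norm (Ln (1 + z) - z) \<le> (norm z)\<^sup>2 / (1 - norm z)"
      by (rule Ln_approx_linear) (use z m in linarith)
    also have "\<dots> \<le> (3 * m)\<^sup>2 / (13/16)"
      using z m m0 by (intro frac_le power_mono) auto
    also have "\<dots> \<le> 12 * m\<^sup>2" by (simp add: power2_eq_square)
    finally show ?thesis .
  qed
  have "1 + e + \<mu> / 2 = d + \<mu>" by (simp add: d_def field_simps)
  then have "(1 + e + \<mu> / 2) / (1 + e - \<mu> / 2) = 1 + z"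
    unfolding z_def using \<open>d \<noteq> 0\<close> by (simp add: d_def[symmetric] add_divide_distrib)
  then have "norm (Ln ((1 + e + \<mu> / 2) / (1 + e - \<mu> / 2)) - \<mu>) \<le> norm (Ln (1 + z) - z) + norm (z - \<mu>)"
    using norm_triangle_ineq[of "Ln (1 + z) - z" "z - \<mu>"] by simp
  then show ?thesis using z\<mu> Lz by simp
qed

context regular_system
begin

text \<open>
  The scalar measure \<open>\<sigma>\<close> that measures how far \<open>q - cnj \<lambda> w\<close> is from being symmetric. At an atom it is
  \<open>det B\<^sub>- - det B\<^sub>+\<close> for the parameter \<open>cnj \<lambda>\<close>.
\<close>

definition skew :: "real set \<Rightarrow> complex" where
  "skew E = 2 * \<i> * (of_real (Im (entry q 1 2 E)) - cnj lam * of_real (Im (entry w 1 2 E)))"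

lemma skew_measure: "measure_on {0<..<c} skew"
proof -
  have *: "measure_on {0<..<c} (\<lambda>E. of_real (Im (entry m 1 2 E)) :: complex)" if "measure_on {0<..<c} (entry m 1 2)" for m
    using measure_on_bounded_linear[OF bounded_linear_compose[OF bounded_linear_of_real bounded_linear_Im] that] .
  show ?thesis unfolding skew_def
    by (intro measure_on_bounded_linear[OF bounded_linear_mult_right] measure_on_diff * entry_measure)
qed

lemma norm_skew_le:
  assumes "E \<in> sets borel" "E \<subseteq> {0<..<c}"
  shows "norm (skew E) \<le> 2 * measure majorant E"
proof -
  have "norm (skew E) = 2 * norm (of_real (Im (entry q 1 2 E)) - cnj lam * of_real (Im (entry w 1 2 E)))"
    by (simp add: skew_def norm_mult)
  also have "norm (of_real (Im (entry q 1 2 E)) - cnj lam * of_real (Im (entry w 1 2 E)))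
    \<le> norm (entry q 1 2 E) + norm lam * norm (entry w 1 2 E)"
    by (rule norm_triangle_le_diff) (auto simp: norm_mult intro!: add_mono mult_left_mono abs_Im_le_cmod)
  also have "\<dots> \<le> measure majorant E" by (rule entry_le_majorant[OF assms])
  finally show ?thesis by simp
qed

lemma skew_pencil:
  assumes "E \<in> sets borel" "E \<subseteq> {s..t}" "0 < s" "t < c"
  shows "skew E = pencil q w (cnj lam) E $ 1 $ 2 - pencil q w (cnj lam) E $ 2 $ 1"
proof -
  have h: "hermitian (q E)" "hermitian (w E)" using herm[OF assms] by auto
  have im: "z - cnj z = 2 * \<i> * of_real (Im z)" for z by (simp add: complex_eq_iff)
  have "pencil q w (cnj lam) E $ 1 $ 2 - pencil q w (cnj lam) E $ 2 $ 1
     = (q E $ 1 $ 2 - cnj (q E $ 1 $ 2)) - cnj lam * (w E $ 1 $ 2 - cnj (w E $ 1 $ 2))"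
    unfolding pencil_entry hermitian_entries(1)[OF h(1)] hermitian_entries(1)[OF h(2)] by (simp add: algebra_simps)
  then show ?thesis unfolding skew_def entry_def im by (simp add: algebra_simps)
qed

text \<open>
  Conjugating the equation produces the transposed pencil, which differs from the pencil by a multiple of
  \<open>J\<close>. This is where the term comes from that the multiplier has to remove.
\<close>

lemma pencil_cnj_mult:
  assumes "E \<in> sets borel" "E \<subseteq> {s..t}" "0 < s" "t < c"
  shows "J *v (pencil q w (cnj lam) E *v vec_cnj a) = vec_cnj (J *v (pencil q w lam E *v a)) + skew E *s vec_cnj a"
  unfolding vec_eq_iff forall_2 skew_pencil[OF assms]
  by (simp add: J_mult matrix_vector_mult_def sum_2 pencil_cnj[OF assms] algebra_simps)

lemma B_cnj:
  assumes "0 < y" "y < c"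
  shows "det (B_plus q w y (cnj lam)) = cnj (det (B_minus q w y lam))"
    and "det (B_minus q w y (cnj lam)) = cnj (det (B_plus q w y lam))"
proof -
  have "pencil q w (cnj lam) {y} $ i $ j = cnj (pencil q w lam {y} $ j $ i)" for i j
    by (rule pencil_cnj[of _ y y]) (use assms in auto)
  then show "det (B_plus q w y (cnj lam)) = cnj (det (B_minus q w y lam))"
    "det (B_minus q w y (cnj lam)) = cnj (det (B_plus q w y lam))"
    unfolding B_det unfolding det_2 by (simp_all add: diff_divide_distrib)
qed

definition ratio :: "real \<Rightarrow> complex" where
  "ratio y = det (B_minus q w y (cnj lam)) / det (B_plus q w y (cnj lam))"

lemma det_B_nonzero:
  assumes "0 < y" "y < c"
  shows "det (B_plus q w y (cnj lam)) \<noteq> 0" "det (B_minus q w y (cnj lam)) \<noteq> 0" "ratio y \<noteq> 0"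
  using nonresonant[OF assms] unfolding ratio_def B_cnj[OF assms] by auto

text \<open>
  What the logarithm of the factor of \<open>\<tau>\<close> at \<open>y\<close> contributes beyond the mass \<open>\<sigma>{y}\<close>. It vanishes at points
  that are not atoms and is of second order at atoms, which makes it summable.
\<close>

definition log_defect :: "real \<Rightarrow> complex" where
  "log_defect y = Ln (ratio y) - skew {y}"

text \<open>
  With \<open>D\<close> the value of the pencil at \<open>{y}\<close>, the two determinants are \<open>1 + det D / 4 \<plusminus> \<sigma>{y} / 2\<close>.
\<close>

lemma log_defect_bound: "\<exists>K\<ge>0. \<forall>y\<in>{0<..<c}. norm (log_defect y) \<le> K * (measure majorant {y})\<^sup>2"
proof (rule squared_atom_bound)
  fix y assume y: "y \<in> {0<..<c}" and small: "measure majorant {y} \<le> 1/16"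
  let ?D = "pencil q w (cnj lam) {y}" and ?m = "measure majorant {y}"
  have D: "norm (?D $ i $ j) \<le> ?m" for i j
    by (rule pencil_le_majorant) (use y in auto)
  have sk: "skew {y} = ?D $ 1 $ 2 - ?D $ 2 $ 1"
    by (rule skew_pencil[of _ y y]) (use y in auto)
  have "norm (det ?D) \<le> norm (?D $ 1 $ 1) * norm (?D $ 2 $ 2) + norm (?D $ 1 $ 2) * norm (?D $ 2 $ 1)"
    unfolding det_2 by (rule norm_triangle_le_diff) (simp add: norm_mult)
  also have "\<dots> \<le> ?m * ?m + ?m * ?m" by (intro add_mono mult_mono D) auto
  finally have "norm (det ?D) \<le> 2 * ?m\<^sup>2" by (simp add: power2_eq_square)
  then have "norm (det ?D) / 4 \<le> ?m\<^sup>2" using zero_le_power2[of ?m] by linarith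
  then have det: "norm (det ?D / 4) \<le> ?m\<^sup>2" by (simp add: norm_divide)
  have "norm (skew {y}) \<le> 2 * ?m" by (rule norm_skew_le) (use y in auto)
  from Ln_ratio_approx[OF this det small]
  show "norm (log_defect y) \<le> 17 * ?m\<^sup>2"
    unfolding log_defect_def ratio_def B_det sk .
qed simp

lemma log_defect_summable:
  assumes "E \<in> sets borel" "E \<subseteq> {0<..<c}"
  shows "(\<lambda>y. norm (log_defect y)) summable_on E"
proof -
  obtain K where K: "0 \<le> K" "\<And>y. y \<in> {0<..<c} \<Longrightarrow> norm (log_defect y) \<le> K * (measure majorant {y})\<^sup>2"
    using log_defect_bound by blast
  show ?thesis
  proof (rule abs_summable_atoms)
    fix y assume "y \<in> E"
    then have "norm (log_defect y) \<le> K * (measure majorant {y})\<^sup>2" using K(2) assms by auto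
    also have "\<dots> \<le> K * (measure majorant UNIV * measure majorant {y})"
      unfolding power2_eq_square by (intro mult_left_mono mult_right_mono measure_mono K) auto
    finally show "norm (log_defect y) \<le> (K * measure majorant UNIV) * measure majorant {y}" by (simp add: mult.assoc)
  qed (use K assms in auto)
qed

text \<open>
  Up to multiples of \<open>2 \<pi> \<i>\<close>, \<open>Phi {0<..<x}\<close> is the logarithm of \<open>\<tau>(x)\<close>: the atoms of \<open>\<sigma>\<close> cancel against the
  subtracted terms \<open>\<sigma>{y}\<close>, which leaves the continuous part of \<open>\<sigma>\<close> and the logarithms of the factors.
\<close>

definition Phi :: "real set \<Rightarrow> complex" where
  "Phi E = skew E + (\<Sum>\<^sub>\<infinity>y\<in>E. log_defect y)"

lemma Phi_Un:
  assumes "A \<in> sets borel" "B \<in> sets borel" "A \<subseteq> {0<..<c}" "B \<subseteq> {0<..<c}" "A \<inter> B = {}"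
  shows "Phi (A \<union> B) = Phi A + Phi B"
proof -
  have "(\<Sum>\<^sub>\<infinity>y\<in>A \<union> B. log_defect y) = (\<Sum>\<^sub>\<infinity>y\<in>A. log_defect y) + (\<Sum>\<^sub>\<infinity>y\<in>B. log_defect y)"
    using abs_summable_summable[OF log_defect_summable] assms by (intro infsum_Un_disjoint) auto
  then show ?thesis unfolding Phi_def using measure_on_Un[OF skew_measure assms] by simp
qed

lemma Phi_singleton: "Phi {y} = Ln (ratio y)"
  unfolding Phi_def by (simp add: log_defect_def)

lemma Phi_approx: "\<exists>K\<ge>0. \<forall>E. E \<in> sets borel \<longrightarrow> E \<subseteq> {0<..<c} \<longrightarrow> norm (Phi E - skew E) \<le> K * (measure majorant E)\<^sup>2"
proof -
  obtain K where K: "0 \<le> K" "\<And>y. y \<in> {0<..<c} \<Longrightarrow> norm (log_defect y) \<le> K * (measure majorant {y})\<^sup>2"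
    using log_defect_bound by blast
  have "norm (Phi E - skew E) \<le> K * (measure majorant E)\<^sup>2" if E: "E \<in> sets borel" "E \<subseteq> {0<..<c}" for E
  proof -
    have "norm (Phi E - skew E) \<le> (\<Sum>\<^sub>\<infinity>y\<in>E. norm (log_defect y))"
      unfolding Phi_def using norm_infsum_bound[OF log_defect_summable[OF E]] by simp
    also have "\<dots> \<le> K * (measure majorant E)\<^sup>2"
    proof (rule infsum_le_finite_sums[OF log_defect_summable[OF E]])
      fix F assume F: "finite F" "F \<subseteq> E"
      have "(\<Sum>y\<in>F. norm (log_defect y)) \<le> (\<Sum>y\<in>F. K * (measure majorant {y})\<^sup>2)"
        by (rule sum_mono, rule K(2)) (use F E in auto)
      also have "\<dots> \<le> K * (measure majorant E)\<^sup>2"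
        unfolding sum_distrib_left[symmetric] by (intro mult_left_mono sum_atoms_squared_le F E K)
      finally show "(\<Sum>y\<in>F. norm (log_defect y)) \<le> K * (measure majorant E)\<^sup>2" .
    qed
    finally show ?thesis .
  qed
  then show ?thesis using K(1) by blast
qed

text \<open>
  \<open>\<Phi>(E) = \<sigma>(E) + O(M(E)\<^sup>2)\<close>, and the exponential adds only further second-order terms. As \<open>M\<close> is finite,
  one constant serves for all sets \<open>E\<close>.
\<close>

lemma exp_Phi_approx:
  "\<exists>K\<ge>0. \<forall>E. E \<in> sets borel \<longrightarrow> E \<subseteq> {0<..<c} \<longrightarrow> norm (exp (Phi E)) \<le> K \<and>
     norm (exp (Phi E) - 1) \<le> K * measure majorant E \<and>
     norm (exp (Phi E) - 1 - skew E) \<le> K * (measure majorant E)\<^sup>2"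
proof -
  obtain K where K: "0 \<le> K" "\<And>E. E \<in> sets borel \<Longrightarrow> E \<subseteq> {0<..<c} \<Longrightarrow> norm (Phi E - skew E) \<le> K * (measure majorant E)\<^sup>2"
    using Phi_approx by blast
  define W where "W = measure majorant UNIV"
  define C where "C = K * W + 2"
  have C: "0 \<le> C" unfolding C_def W_def using K(1) by simp
  define K' where "K' = K + exp (C * W) * (1 + C + C\<^sup>2)"
  have eC: "exp (C * W) \<le> K'" "exp (C * W) * C \<le> K'" "K + exp (C * W) * C\<^sup>2 \<le> K'"
    unfolding K'_def using K(1) C by (auto simp: distrib_left)
  have "norm (exp (Phi E)) \<le> K'" "norm (exp (Phi E) - 1) \<le> K' * measure majorant E"
     "norm (exp (Phi E) - 1 - skew E) \<le> K' * (measure majorant E)\<^sup>2" if E: "E \<in> sets borel" "E \<subseteq> {0<..<c}" for E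
  proof -
    let ?m = "measure majorant E"
    have mW: "?m \<le> W" unfolding W_def by (rule measure_mono) auto
    have "norm (Phi E) \<le> norm (Phi E - skew E) + norm (skew E)" by norm
    also have "\<dots> \<le> K * ?m\<^sup>2 + 2 * ?m" by (intro add_mono K(2) norm_skew_le E)
    also have "\<dots> \<le> C * ?m"
      unfolding C_def power2_eq_square distrib_right using mW K(1)
      by (auto simp: mult.assoc intro!: mult_left_mono mult_right_mono)
    finally have Phi: "norm (Phi E) \<le> C * ?m" .
    also have "\<dots> \<le> C * W" by (intro mult_left_mono mW C)
    finally have eP: "exp (norm (Phi E)) \<le> exp (C * W)" by simp
    have "norm (exp (Phi E)) \<le> exp (norm (Phi E))" by (rule norm_exp)
    then show "norm (exp (Phi E)) \<le> K'" using eP eC by linarith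
    have "norm (exp (Phi E) - 1) \<le> exp (norm (Phi E)) * norm (Phi E)"
      using Taylor_exp_field[of "Phi E" 0] by simp
    also have "\<dots> \<le> exp (C * W) * (C * ?m)" by (intro mult_mono eP Phi) auto
    also have "\<dots> \<le> K' * ?m" unfolding mult.assoc[symmetric] by (intro mult_right_mono eC) auto
    finally show "norm (exp (Phi E) - 1) \<le> K' * ?m" .
    have "norm (exp (Phi E) - 1 - Phi E) \<le> exp (norm (Phi E)) * (norm (Phi E))\<^sup>2"
      using Taylor_exp_field[of "Phi E" 1] by (simp add: power2_eq_square algebra_simps)
    also have "\<dots> \<le> exp (C * W) * (C * ?m)\<^sup>2" by (intro mult_mono eP power_mono Phi) auto
    finally have "norm (exp (Phi E) - 1 - Phi E) + norm (Phi E - skew E) \<le> exp (C * W) * (C * ?m)\<^sup>2 + K * ?m\<^sup>2"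
      by (intro add_mono K(2) E)
    also have "\<dots> = (K + exp (C * W) * C\<^sup>2) * ?m\<^sup>2" by (simp add: algebra_simps power_mult_distrib)
    also have "\<dots> \<le> K' * ?m\<^sup>2" by (intro mult_right_mono eC) auto
    finally have "norm (exp (Phi E) - 1 - Phi E) + norm (Phi E - skew E) \<le> K' * ?m\<^sup>2" .
    moreover have "norm (exp (Phi E) - 1 - skew E) \<le> norm (exp (Phi E) - 1 - Phi E) + norm (Phi E - skew E)" by norm
    ultimately show "norm (exp (Phi E) - 1 - skew E) \<le> K' * ?m\<^sup>2" by linarith
  qed
  moreover have "0 \<le> K'" using eC(1) exp_ge_zero[of "C * W"] by linarith
  ultimately show ?thesis by blast
qed

text \<open>
  The finite subproducts are exponentials of finite sums of logarithms. Since the logarithms are absolutely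
  summable, the product converges irrespective of order. The points of \<open>(0,x)\<close> that are not atoms have the
  factor \<open>1\<close>, so the sum may run over all of \<open>(0,x)\<close>.
\<close>

lemma tau_exp_Phi:
  assumes x: "0 < x" "x \<le> c"
  shows "tau q w x (cnj lam) = exp (Phi {0<..<x})"
proof -
  let ?E = "{0<..<x}"
  have E: "?E \<in> sets borel" "?E \<subseteq> {0<..<c}" using x by auto
  have sq: "(\<lambda>y. entry q 1 2 {y}) summable_on ?E" and sw: "(\<lambda>y. entry w 1 2 {y}) summable_on ?E"
    by (rule abs_summable_summable, rule abs_summable_atoms[where K=1], use x entry_le_majorant in auto)+
  have "((\<lambda>y. 2 * \<i> * (of_real (Im (entry q 1 2 {y})) + (- cnj lam) * of_real (Im (entry w 1 2 {y})))) has_sum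
      2 * \<i> * (of_real (Im (\<Sum>\<^sub>\<infinity>y\<in>?E. entry q 1 2 {y})) + (- cnj lam) * of_real (Im (\<Sum>\<^sub>\<infinity>y\<in>?E. entry w 1 2 {y})))) ?E"
    by (intro has_sum_cmult_right has_sum_add has_sum_of_real has_sum_Im has_sum_infsum sq sw)
  then have skew_sum: "((\<lambda>y. skew {y}) has_sum 2 * \<i> * (of_real (Im (\<Sum>\<^sub>\<infinity>y\<in>?E. entry q 1 2 {y})) - cnj lam * of_real (Im (\<Sum>\<^sub>\<infinity>y\<in>?E. entry w 1 2 {y})))) ?E"
    unfolding skew_def by simp
  have defect_sum: "(log_defect has_sum (\<Sum>\<^sub>\<infinity>y\<in>?E. log_defect y)) ?E"
    by (rule has_sum_infsum[OF abs_summable_summable[OF log_defect_summable[OF E]]])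
  define S where "S = 2 * \<i> * (of_real (Im (\<Sum>\<^sub>\<infinity>y\<in>?E. entry q 1 2 {y})) - cnj lam * of_real (Im (\<Sum>\<^sub>\<infinity>y\<in>?E. entry w 1 2 {y})))"
  have "((\<lambda>y. skew {y} + log_defect y) has_sum (S + (\<Sum>\<^sub>\<infinity>y\<in>?E. log_defect y))) ?E"
    unfolding S_def by (rule has_sum_add[OF skew_sum defect_sum])
  then have Ln_sum_E: "((\<lambda>y. Ln (ratio y)) has_sum (S + (\<Sum>\<^sub>\<infinity>y\<in>?E. log_defect y))) ?E"
    by (simp add: log_defect_def)
  have "Ln (ratio y) = 0" if "y \<in> ?E - atoms q w x" for y
  proof -
    have "q {y} = 0" "w {y} = 0" using that by (auto simp: atoms_def)
    then have "pencil q w (cnj lam) {y} = 0" by (simp add: vec_eq_iff pencil_entry)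
    then show ?thesis unfolding ratio_def B_det by (simp add: det_2)
  qed
  note Ln_0 = this
  have sub: "atoms q w x \<subseteq> ?E" by (auto simp: atoms_def)
  have Ln_sum: "((\<lambda>y. Ln (ratio y)) has_sum (S + (\<Sum>\<^sub>\<infinity>y\<in>?E. log_defect y))) (atoms q w x)"
  proof (rule has_sum_cong_neutral[THEN iffD2, OF _ _ _ Ln_sum_E])
    show "Ln (ratio y) = 0" if "y \<in> ?E - atoms q w x" for y by (rule Ln_0[OF that])
    show "Ln (ratio y) = 0" if "y \<in> atoms q w x - ?E" for y using sub that by blast
  qed (rule refl)
  have "((\<lambda>F. \<Prod>y\<in>F. ratio y) \<longlongrightarrow> exp (S + (\<Sum>\<^sub>\<infinity>y\<in>?E. log_defect y))) (finite_subsets_at_top (atoms q w x))"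
  proof (rule Lim_transform_eventually)
    show "((\<lambda>F. exp (\<Sum>y\<in>F. Ln (ratio y))) \<longlongrightarrow> exp (S + (\<Sum>\<^sub>\<infinity>y\<in>?E. log_defect y))) (finite_subsets_at_top (atoms q w x))"
      using Ln_sum unfolding has_sum_def by (rule tendsto_exp)
    show "eventually (\<lambda>F. exp (\<Sum>y\<in>F. Ln (ratio y)) = (\<Prod>y\<in>F. ratio y)) (finite_subsets_at_top (atoms q w x))"
    proof (rule eventually_finite_subsets_at_top_weakI)
      fix F assume F: "finite F" "F \<subseteq> atoms q w x"
      have "exp (\<Sum>y\<in>F. Ln (ratio y)) = (\<Prod>y\<in>F. exp (Ln (ratio y)))" by (rule exp_sum[OF F(1)])
      also have "\<dots> = (\<Prod>y\<in>F. ratio y)"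
        by (rule prod.cong[OF refl], rule exp_Ln, rule det_B_nonzero) (use F x in \<open>auto simp: atoms_def\<close>)
      finally show "exp (\<Sum>y\<in>F. Ln (ratio y)) = (\<Prod>y\<in>F. ratio y)" .
    qed
  qed
  then have "P q w x (cnj lam) = exp (S + (\<Sum>\<^sub>\<infinity>y\<in>?E. log_defect y))"
    unfolding P_def ratio_def by (rule tendsto_Lim[OF finite_subsets_at_top_neq_bot])
  moreover have "2 * \<i> * (of_real (Im (continuous_part (entry q 1 2) ?E)) - cnj lam * of_real (Im (continuous_part (entry w 1 2) ?E)))
     = skew ?E - S"
    unfolding continuous_part_def skew_def S_def by (simp add: algebra_simps)
  ultimately show ?thesis
    unfolding tau_def Phi_def by (simp only: exp_add[symmetric]) (simp add: add.commute)
qed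

text \<open>
  The left limits of \<open>\<tau>\<close>, which is left continuous, and its right limits, which include the factor at \<open>t\<close>.
\<close>

definition tau_left :: "real \<Rightarrow> complex" where "tau_left t = exp (Phi {0<..<t})"

definition tau_right :: "real \<Rightarrow> complex" where "tau_right t = exp (Phi {0<..t})"

lemma tau_left_split:
  assumes "0 < s" "s < t" "t < c"
  shows "tau_left t = tau_right s * exp (Phi {s<..<t})"
proof -
  have "Phi ({0<..s} \<union> {s<..<t}) = Phi {0<..s} + Phi {s<..<t}" by (rule Phi_Un) (use assms in auto)
  moreover have "{0<..s} \<union> {s<..<t} = {0<..<t}" using assms by auto
  ultimately show ?thesis unfolding tau_left_def tau_right_def by (simp add: exp_add)
qed

lemma tau_right_split:
  assumes "0 < s" "s < c"
  shows "tau_right s = tau_left s * exp (Phi {s})" "exp (Phi {s}) = ratio s"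
proof -
  have "Phi ({0<..<s} \<union> {s}) = Phi {0<..<s} + Phi {s}" by (rule Phi_Un) (use assms in auto)
  moreover have "{0<..<s} \<union> {s} = {0<..s}" using assms by auto
  ultimately show "tau_right s = tau_left s * exp (Phi {s})" unfolding tau_left_def tau_right_def by (simp add: exp_add)
  show "exp (Phi {s}) = ratio s" unfolding Phi_singleton by (rule exp_Ln[OF det_B_nonzero(3)[OF assms]])
qed

lemma dominated_tau: "\<exists>K. dominated tau_left tau_right K"
proof -
  obtain K where K: "0 \<le> K" and K1: "\<And>E. E \<in> sets borel \<Longrightarrow> E \<subseteq> {0<..<c} \<Longrightarrow> norm (exp (Phi E)) \<le> K"
    and K2: "\<And>E. E \<in> sets borel \<Longrightarrow> E \<subseteq> {0<..<c} \<Longrightarrow> norm (exp (Phi E) - 1) \<le> K * measure majorant E"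
    using exp_Phi_approx by blast
  have "dominated tau_left tau_right (K * K)"
    unfolding dominated_def
  proof (intro conjI allI impI)
    fix s t :: real assume st: "0 < s" "s < t" "t < c"
    have "tau_left t - tau_right s = tau_right s * (exp (Phi {s<..<t}) - 1)"
      unfolding tau_left_split[OF st] by (simp add: algebra_simps)
    then have "norm (tau_left t - tau_right s) = norm (tau_right s) * norm (exp (Phi {s<..<t}) - 1)" by (simp add: norm_mult)
    also have "\<dots> \<le> K * (K * measure majorant {s<..<t})"
      unfolding tau_right_def by (intro mult_mono K1 K2 K) (use st in auto)
    finally show "norm (tau_left t - tau_right s) \<le> K * K * measure majorant {s<..<t}" by (simp add: mult.assoc)
  next
    fix s :: real assume s: "0 < s" "s < c"
    have "tau_right s - tau_left s = tau_left s * (exp (Phi {s}) - 1)"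
      unfolding tau_right_split(1)[OF s] by (simp add: algebra_simps)
    then have "norm (tau_right s - tau_left s) = norm (tau_left s) * norm (exp (Phi {s}) - 1)" by (simp add: norm_mult)
    also have "\<dots> \<le> K * (K * measure majorant {s})"
      unfolding tau_left_def by (intro mult_mono K1 K2 K) (use s in auto)
    finally show "norm (tau_right s - tau_left s) \<le> K * K * measure majorant {s}" by (simp add: mult.assoc)
  qed (use K in simp)
  then show ?thesis ..
qed

lemma tau_limit_0:
  "(tau_left \<longlongrightarrow> 1) (at_right 0)" "(tau_right \<longlongrightarrow> 1) (at_right 0)"
proof -
  obtain K where K: "0 \<le> K" 
    and K2: "\<And>E. E \<in> sets borel \<Longrightarrow> E \<subseteq> {0<..<c} \<Longrightarrow> norm (exp (Phi E) - 1) \<le> K * measure majorant E"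
    using exp_Phi_approx by blast
  have ev: "eventually (\<lambda>t. t \<in> {0<..<c}) (at_right 0)" by (rule eventually_at_right_real[OF c_pos])
  show "(tau_right \<longlongrightarrow> 1) (at_right 0)" unfolding tau_right_def
    by (rule tendsto_if_dominated[OF _ measure_right_null, of _ _ K])
       (use ev in eventually_elim, rule K2, auto)
  show "(tau_left \<longlongrightarrow> 1) (at_right 0)" unfolding tau_left_def
  proof (rule tendsto_if_dominated[OF _ measure_right_null, of _ _ K])
    show "eventually (\<lambda>t. norm (exp (Phi {0<..<t}) - 1) \<le> K * measure majorant {0<..t}) (at_right 0)"
      using ev
    proof eventually_elim
      case (elim t)
      have "norm (exp (Phi {0<..<t}) - 1) \<le> K * measure majorant {0<..<t}" by (rule K2) (use elim in auto)
      also have "\<dots> \<le> K * measure majorant {0<..t}" by (intro mult_left_mono measure_mono K) auto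
      finally show ?case .
    qed
  qed
qed

end

section \<open>Solutions up to the regular endpoint\<close>

text \<open>
  \<open>D\<close> is the Lebesgue--Stieltjes measure of \<open>u\<close>. The variation of \<open>u\<close> is assumed finite on intervals up to
  and including \<open>c\<close>, so that only the endpoint \<open>0\<close> needs attention.
\<close>

locale solution_on = regular_system +
  fixes u :: "real \<Rightarrow> complex^2" and D :: "real set \<Rightarrow> complex^2"
  assumes bv: "\<And>s t. 0 < s \<Longrightarrow> t \<le> c \<Longrightarrow> bounded_variation_on s t u"
    and bal: "\<And>x. 0 < x \<Longrightarrow> x < c \<Longrightarrow> u x = (1/2) *\<^sub>R (left_lim u x + right_lim u x)"
    and D_measure: "\<And>s t. 0 < s \<Longrightarrow> t < c \<Longrightarrow> measure_on {s..t} D"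
    and D_right: "\<And>s t. 0 < s \<Longrightarrow> s < t \<Longrightarrow> t < c \<Longrightarrow> D {s<..t} = right_lim u t - right_lim u s"
    and D_eq: "\<And>E s t. 0 < s \<Longrightarrow> t < c \<Longrightarrow> E \<in> sets borel \<Longrightarrow> E \<subseteq> {s..t} \<Longrightarrow> D E = J *v pencil_times q w lam u E"

begin

lemma
  assumes x: "0 < x" "x < c"
  shows u_left: "(u \<longlongrightarrow> left_lim u x) (at_left x)" and u_right: "(u \<longlongrightarrow> right_lim u x) (at_right x)"
proof -
  have "bounded_variation_on (x/2) c u" using bv x by simp
  then obtain G where G: "\<And>y z. x/2 \<le> y \<Longrightarrow> y \<le> z \<Longrightarrow> z \<le> c \<Longrightarrow> norm (u z - u y) \<le> G z - G y"
    using bounded_variation_on_majorant by blast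
  have mono: "G y \<le> G z" if "x/2 \<le> y" "y \<le> z" "z \<le> c" for y z
    using G[OF that] norm_ge_zero[of "u z - u y"] by linarith
  have "\<exists>l. (u \<longlongrightarrow> l) (at_left x)"
    by (rule left_limit_of_majorized[of "x/2" x u G "G x"]) (use x G mono in auto)
  then show "(u \<longlongrightarrow> left_lim u x) (at_left x)" using left_lim_eq by metis
  have "\<exists>l. (u \<longlongrightarrow> l) (at_right x)"
    by (rule right_limit_of_majorized[of x c u G "G x"]) (use x G mono in auto)
  then show "(u \<longlongrightarrow> right_lim u x) (at_right x)" using right_lim_eq by metis
qed

lemma u_mid: "0 < x \<Longrightarrow> x < c \<Longrightarrow> u x = mid (left_lim u) (right_lim u) x"
  using bal unfolding mid_def .

lemma u_measurable: "(\<lambda>x. u x $ j) \<in> borel_measurable (restrict_space borel {0<..<c})"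
  by (rule measurable_mid[OF u_left u_right u_mid])

lemma u_bounded_away_0:
  assumes "0 < s" obtains U where "0 \<le> U" "\<And>x. s \<le> x \<Longrightarrow> x < c \<Longrightarrow> norm (u x) \<le> U"
proof -
  have "bounded_variation_on s c u" using bv assms by simp
  then obtain G where G: "\<And>y z. s \<le> y \<Longrightarrow> y \<le> z \<Longrightarrow> z \<le> c \<Longrightarrow> norm (u z - u y) \<le> G z - G y"
    using bounded_variation_on_majorant by blast
  have "norm (u x) \<le> norm (u s) + \<bar>G c - G s\<bar>" if x: "s \<le> x" "x < c" for x
    using G[of s x] G[of x c] x norm_ge_zero[of "u c - u x"] norm_triangle_sub[of "u x" "u s"] by linarith
  then show ?thesis by (intro that[of "norm (u s) + \<bar>G c - G s\<bar>"]) auto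
qed

lemma norm_D_le:
  assumes "0 < s" "t < c" "E \<in> sets borel" "E \<subseteq> {s..t}" "0 \<le> U" "\<And>x. x \<in> E \<Longrightarrow> norm (u x) \<le> U"
  shows "norm (D E) \<le> U * measure majorant E"
proof -
  have "norm (pencil_times q w lam u E - pencil q w lam E *v 0) \<le> U * measure majorant E"
    by (rule pencil_times_approx) (use assms u_measurable in auto)
  then show ?thesis unfolding D_eq[OF assms(1-4)] norm_J_mult by simp
qed

text \<open>
  \<open>D\<close> is known on half-open intervals. As \<open>s\<close> increases to \<open>t\<close>, the value \<open>D(s,t]\<close> tends to \<open>D{t}\<close>, and the
  right limits at \<open>s\<close> tend to the left limit at \<open>t\<close>.
\<close>

lemma D_singleton:
  assumes t: "0 < t" "t < c" shows "D {t} = right_lim u t - left_lim u t"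
proof -
  obtain U where U: "0 \<le> U" "\<And>x. t/2 \<le> x \<Longrightarrow> x < c \<Longrightarrow> norm (u x) \<le> U"
    using u_bounded_away_0[of "t/2"] t by auto
  have ev: "eventually (\<lambda>s. s \<in> {t/2<..<t}) (at_left t)" by (rule eventually_at_left_real) (use t in simp)
  have "((\<lambda>s. right_lim u t - right_lim u s) \<longlongrightarrow> D {t}) (at_left t)"
  proof (rule tendsto_if_dominated[OF _ measure_left_null, of _ _ U])
    show "eventually (\<lambda>s. norm (right_lim u t - right_lim u s - D {t}) \<le> U * measure majorant {s..<t}) (at_left t)"
      using ev
    proof eventually_elim
      case (elim s)
      have "D ({s<..<t} \<union> {t}) = D {s<..<t} + D {t}"
        by (rule measure_on_Un[OF D_measure[of s t]]) (use elim t in auto)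
      moreover have "{s<..<t} \<union> {t} = {s<..t}" using elim by auto
      ultimately have "right_lim u t - right_lim u s - D {t} = D {s<..<t}"
        using D_right[of s t] elim t by simp
      also have "norm \<dots> \<le> U * measure majorant {s<..<t}"
        by (rule norm_D_le[of s t]) (use elim t U in auto)
      also have "\<dots> \<le> U * measure majorant {s..<t}" by (intro mult_left_mono measure_mono U) auto
      finally show ?case .
    qed
  qed
  moreover have "(right_lim u \<longlongrightarrow> left_lim u t) (at_left t)"
    by (rule right_limits_tendsto_left[OF u_left[OF t] t(1)]) (use u_right t in auto)
  then have "((\<lambda>s. right_lim u t - right_lim u s) \<longlongrightarrow> right_lim u t - left_lim u t) (at_left t)"
    by (intro tendsto_intros)
  ultimately show ?thesis by (rule tendsto_unique[rotated]) simp
qed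

lemma D_open:
  assumes "0 < s" "s < t" "t < c" shows "D {s<..<t} = left_lim u t - right_lim u s"
proof -
  have "D ({s<..<t} \<union> {t}) = D {s<..<t} + D {t}"
    by (rule measure_on_Un[OF D_measure[of s t]]) (use assms in auto)
  moreover have "{s<..<t} \<union> {t} = {s<..t}" using assms by auto
  ultimately have "D {s<..<t} = D {s<..t} - D {t}" by simp
  then show ?thesis using D_right[OF assms] D_singleton[of t] assms by simp
qed

text \<open>
  Choose \<open>e\<close> with \<open>M(0,e] < 1/2\<close> and let \<open>S\<close> be the supremum of \<open>\<bar>u\<bar>\<close> on \<open>[s,e]\<close>. By the equation \<open>u\<close> differs from
  its right limit at \<open>e\<close> by at most \<open>S/2\<close>, so that \<open>S \<le> 2 \<bar>u\<^sup>+(e)\<bar>\<close>, a bound independent of \<open>s\<close>.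
\<close>

lemma u_bounded: obtains U where "0 \<le> U" "\<And>x. 0 < x \<Longrightarrow> x < c \<Longrightarrow> norm (u x) \<le> U"
proof -
  have "eventually (\<lambda>e. measure majorant {0<..e} < 1/2) (at_right 0)"
    by (rule order_tendstoD(2)[OF measure_right_null]) simp
  moreover have "eventually (\<lambda>e. e \<in> {0<..<c}) (at_right 0)" by (rule eventually_at_right_real[OF c_pos])
  ultimately have "eventually (\<lambda>e. measure majorant {0<..e} < 1/2 \<and> e \<in> {0<..<c}) (at_right 0)"
    by (rule eventually_conj)
  then obtain e where e: "measure majorant {0<..e} < 1/2" "0 < e" "e < c"
    using eventually_happens'[of "at_right (0::real)"] by auto
  obtain V where V: "0 \<le> V" "\<And>x. e \<le> x \<Longrightarrow> x < c \<Longrightarrow> norm (u x) \<le> V"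
    using u_bounded_away_0[OF e(2)] by metis
  have near: "norm (u s) \<le> 2 * norm (right_lim u e)" if s: "0 < s" "s \<le> e" for s
  proof -
    obtain W where W: "0 \<le> W" "\<And>x. s \<le> x \<Longrightarrow> x < c \<Longrightarrow> norm (u x) \<le> W"
      using u_bounded_away_0[OF s(1)] by metis
    define S where "S = (SUP x\<in>{s..e}. norm (u x))"
    have bdd: "bdd_above ((\<lambda>x. norm (u x)) ` {s..e})"
      by (rule bdd_aboveI2[of _ _ W]) (use W e in auto)
    have S: "norm (u x) \<le> S" if "x \<in> {s..e}" for x
      unfolding S_def by (rule cSUP_upper[OF that bdd])
    have S0: "0 \<le> S" using S[of s] s norm_ge_zero[of "u s"] by (meson atLeastAtMost_iff order_refl order_trans)
    have D: "norm (D E) \<le> S / 2" if E: "E \<in> sets borel" "E \<subseteq> {s..e}" for E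
    proof -
      have "norm (D E) \<le> S * measure majorant E"
        by (rule norm_D_le[of s e]) (use s e E S S0 in auto)
      also have "\<dots> \<le> S * measure majorant {0<..e}"
        using E s by (intro mult_left_mono measure_mono S0) auto
      also have "\<dots> \<le> S * (1/2)" using e S0 by (intro mult_left_mono) auto
      finally show ?thesis by simp
    qed
    have "norm (u x - right_lim u e) \<le> S / 2" if x: "x \<in> {s..e}" for x
    proof -
      have x': "0 < x" "x < c" using x s e by auto
      have R: "norm (right_lim u x - right_lim u e) \<le> S / 2"
      proof (cases "x = e")
        case False
        then have "right_lim u e - right_lim u x = D {x<..e}" using D_right[of x e] x x' e by auto
        moreover have "norm (D {x<..e}) \<le> S / 2" by (rule D) (use x in auto)
        ultimately show ?thesis by (simp add: norm_minus_commute)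
      qed (use S0 in simp)
      have L: "norm (left_lim u x - right_lim u e) \<le> S / 2"
      proof -
        have "right_lim u e - left_lim u x = D {x..e}"
        proof (cases "x = e")
          case True
          then show ?thesis using D_singleton[of e] e by simp
        next
          case False
          have "D ({x} \<union> {x<..e}) = D {x} + D {x<..e}"
            by (rule measure_on_Un[OF D_measure[of x e]]) (use x x' e in auto)
          moreover have "{x} \<union> {x<..e} = {x..e}" using x by auto
          ultimately show ?thesis using D_singleton[OF x'] D_right[of x e] x x' e False by (simp add: algebra_simps)
        qed
        moreover have "norm (D {x..e}) \<le> S / 2" by (rule D) (use x in auto)
        ultimately show ?thesis by (metis norm_minus_commute)
      qed
      show ?thesis unfolding bal[OF x'] by (rule norm_average_diff_le[OF L R])
    qed
    then have "norm (u x) \<le> norm (right_lim u e) + S / 2" if "x \<in> {s..e}" for x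
      using that norm_triangle_sub[of "u x" "right_lim u e"] by (meson add_left_mono order_trans)
    then have "S \<le> norm (right_lim u e) + S / 2"
      unfolding S_def using s by (intro cSUP_least) auto
    then show ?thesis using S[of s] s by auto
  qed
  show ?thesis
  proof (rule that[of "max V (2 * norm (right_lim u e))"])
    fix x assume "0 < x" "x < c"
    then show "norm (u x) \<le> max V (2 * norm (right_lim u e))"
      using near[of x] V(2)[of x] by (cases "x \<le> e") (auto simp: le_max_iff_disj)
  qed (use V in auto)
qed

lemma u_dominated: "\<exists>K. dominated (left_lim u) (right_lim u) K"
proof -
  obtain U where U: "0 \<le> U" "\<And>x. 0 < x \<Longrightarrow> x < c \<Longrightarrow> norm (u x) \<le> U" using u_bounded by metis
  have "dominated (left_lim u) (right_lim u) U"
    unfolding dominated_def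
  proof (intro conjI allI impI)
    fix s t :: real assume st: "0 < s" "s < t" "t < c"
    show "norm (left_lim u t - right_lim u s) \<le> U * measure majorant {s<..<t}"
      unfolding D_open[OF st, symmetric] by (rule norm_D_le[of s t]) (use st U in auto)
  next
    fix s :: real assume s: "0 < s" "s < c"
    show "norm (right_lim u s - left_lim u s) \<le> U * measure majorant {s}"
      unfolding D_singleton[OF s, symmetric] by (rule norm_D_le[of s s]) (use s U in auto)
  qed (rule U)
  then show ?thesis ..
qed

end

section \<open>The conjugate solution\<close>

text \<open>
  Here \<open>A, B, G, L\<close> are the entries of the conjugated pencil at an atom, \<open>m\<close> and \<open>p\<close> the conjugated one-sided
  limits of \<open>u\<close>. The lemma says that scaling \<open>m\<close> by \<open>d = det B\<^sub>+\<close> and \<open>p\<close> by \<open>n = det B\<^sub>-\<close>, both for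
  \<open>cnj \<lambda>\<close>, turns the jump condition for the conjugated pencil into the one for its transpose. In terms of the
  mean \<open>s = (m + p)/2\<close> both sides become linear in \<open>s\<close>, with equal coefficients.
\<close>

lemma jump_algebra:
  fixes A B G L m\<^sub>1 m\<^sub>2 p\<^sub>1 p\<^sub>2 :: complex
  assumes e1: "p\<^sub>1 - m\<^sub>1 = - (G * ((m\<^sub>1 + p\<^sub>1) / 2) + L * ((m\<^sub>2 + p\<^sub>2) / 2))"
    and e2: "p\<^sub>2 - m\<^sub>2 = A * ((m\<^sub>1 + p\<^sub>1) / 2) + B * ((m\<^sub>2 + p\<^sub>2) / 2)"
  defines "d \<equiv> 1 + (A * L - G * B) / 4 - (G - B) / 2" and "n \<equiv> 1 + (A * L - G * B) / 4 + (G - B) / 2"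
  shows "n * p\<^sub>1 - d * m\<^sub>1 = - (B * ((d * m\<^sub>1 + n * p\<^sub>1) / 2) + L * ((d * m\<^sub>2 + n * p\<^sub>2) / 2))"
    and "n * p\<^sub>2 - d * m\<^sub>2 = A * ((d * m\<^sub>1 + n * p\<^sub>1) / 2) + G * ((d * m\<^sub>2 + n * p\<^sub>2) / 2)"
proof -
  obtain s\<^sub>1 s\<^sub>2 where s: "s\<^sub>1 = (m\<^sub>1 + p\<^sub>1) / 2" "s\<^sub>2 = (m\<^sub>2 + p\<^sub>2) / 2" by blast
  have T: "p\<^sub>1 - m\<^sub>1 = - (G * s\<^sub>1 + L * s\<^sub>2)" "p\<^sub>2 - m\<^sub>2 = A * s\<^sub>1 + B * s\<^sub>2"
    using e1 e2 by (simp_all only: s)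
  have "p\<^sub>1 = s\<^sub>1 + (p\<^sub>1 - m\<^sub>1) / 2" "p\<^sub>2 = s\<^sub>2 + (p\<^sub>2 - m\<^sub>2) / 2"
    "m\<^sub>1 = s\<^sub>1 - (p\<^sub>1 - m\<^sub>1) / 2" "m\<^sub>2 = s\<^sub>2 - (p\<^sub>2 - m\<^sub>2) / 2"
    by (simp_all add: s field_simps)
  note pm = this[unfolded T]
  show "n * p\<^sub>1 - d * m\<^sub>1 = - (B * ((d * m\<^sub>1 + n * p\<^sub>1) / 2) + L * ((d * m\<^sub>2 + n * p\<^sub>2) / 2))"
    "n * p\<^sub>2 - d * m\<^sub>2 = A * ((d * m\<^sub>1 + n * p\<^sub>1) / 2) + G * ((d * m\<^sub>2 + n * p\<^sub>2) / 2)"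
    unfolding n_def d_def by (simp_all only: pm) (simp_all add: field_simps)
qed

context solution_on
begin

abbreviation v_left :: "real \<Rightarrow> complex^2" where
  "v_left x \<equiv> tau_left x *s vec_cnj (left_lim u x)"

abbreviation v_right :: "real \<Rightarrow> complex^2" where
  "v_right x \<equiv> tau_right x *s vec_cnj (right_lim u x)"

lemma v_dominated: "\<exists>K. dominated v_left v_right K"
proof -
  obtain K where "dominated (left_lim u) (right_lim u) K" using u_dominated ..
  moreover obtain L where "dominated tau_left tau_right L" using dominated_tau ..
  ultimately show ?thesis using dominated_smult dominated_vec_cnj c_pos by blast
qed

abbreviation v_mid :: "real \<Rightarrow> complex^2" where "v_mid \<equiv> mid v_left v_right"

lemma v_mid_measurable: "(\<lambda>x. v_mid x $ j) \<in> borel_measurable (restrict_space borel {0<..<c})"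
proof -
  obtain K where v: "dominated v_left v_right K" using v_dominated ..
  show ?thesis
    by (rule measurable_mid[OF dominated_left_limit_mid[OF v] dominated_right_limit_mid[OF v] refl])
qed

text \<open>
  With \<open>k = \<tau>(s) / det B\<^sub>+\<close>, the one-sided limits of \<open>v\<close> at \<open>s\<close> are \<open>k\<close> times the scaled limits \<open>d m\<close> and \<open>n p\<close>
  of \<open>jump_algebra\<close>.
\<close>

lemma v_jump:
  assumes s: "0 < s" "s < c"
  shows "v_right s - v_left s = J *v pencil_times q w (cnj lam) v_mid {s}"
proof -
  let ?p = "\<lambda>i j. cnj (pencil q w lam {s} $ i $ j)"
  let ?m = "\<lambda>i. cnj (left_lim u s $ i)" and ?r = "\<lambda>i. cnj (right_lim u s $ i)"
  have "right_lim u s - left_lim u s = J *v (pencil q w lam {s} *v u s)"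
    using D_singleton[OF s] D_eq[of s s "{s}"] pencil_times_singleton[OF s refl u_measurable] s by auto
  then have "vec_cnj (right_lim u s - left_lim u s) = vec_cnj (J *v (pencil q w lam {s} *v mid (left_lim u) (right_lim u) s))"
    using u_mid[OF s] by simp
  then have e: "?r 1 - ?m 1 = - (?p 2 1 * ((?m 1 + ?r 1) / 2) + ?p 2 2 * ((?m 2 + ?r 2) / 2))"
    "?r 2 - ?m 2 = ?p 1 1 * ((?m 1 + ?r 1) / 2) + ?p 1 2 * ((?m 2 + ?r 2) / 2)"
    by (simp_all add: vec_eq_iff forall_2 J_mult matrix_vector_mult_def sum_2 mid_def scaleR_conv_of_real[where 'a=complex])
  have pc: "pencil q w (cnj lam) {s} $ i $ j = ?p j i" for i j
    by (rule pencil_cnj[of _ s s]) (use s in auto)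
  define d where "d = det (B_plus q w s (cnj lam))"
  define n where "n = det (B_minus q w s (cnj lam))"
  \<comment> \<open>The determinants in the form in which \<open>jump_algebra\<close> expects them.\<close>
  have dn: "d = 1 + (?p 1 1 * ?p 2 2 - ?p 2 1 * ?p 1 2) / 4 - (?p 2 1 - ?p 1 2) / 2"
    "n = 1 + (?p 1 1 * ?p 2 2 - ?p 2 1 * ?p 1 2) / 4 + (?p 2 1 - ?p 1 2) / 2"
    unfolding d_def n_def B_det by (simp_all add: det_2 pc mult.commute)
  note alg = jump_algebra[OF e, folded dn]
  have "d \<noteq> 0" unfolding d_def by (rule det_B_nonzero[OF s])
  define k where "k = tau_left s / d"
  have tau: "tau_left s = k * d" "tau_right s = k * n"
    using tau_right_split[OF s] \<open>d \<noteq> 0\<close> by (simp_all add: k_def ratio_def flip: d_def n_def)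
  have pt: "pencil_times q w (cnj lam) v_mid {s} = pencil q w (cnj lam) {s} *v v_mid s"
    by (rule pencil_times_singleton[OF s _ v_mid_measurable]) simp
  have "(v_right s - v_left s) $ 1 = k * (n * ?r 1 - d * ?m 1)" "(v_right s - v_left s) $ 2 = k * (n * ?r 2 - d * ?m 2)"
    unfolding tau by (simp_all add: algebra_simps)
  moreover have "(J *v (pencil q w (cnj lam) {s} *v v_mid s)) $ 1
      = k * - (?p 1 2 * ((d * ?m 1 + n * ?r 1) / 2) + ?p 2 2 * ((d * ?m 2 + n * ?r 2) / 2))"
    "(J *v (pencil q w (cnj lam) {s} *v v_mid s)) $ 2
      = k * (?p 1 1 * ((d * ?m 1 + n * ?r 1) / 2) + ?p 2 1 * ((d * ?m 2 + n * ?r 2) / 2))"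
    unfolding mid_def tau
    by (simp_all add: J_mult matrix_vector_mult_def sum_2 pc scaleR_conv_of_real[where 'a=complex] algebra_simps add_divide_distrib diff_divide_distrib)
  ultimately show ?thesis unfolding pt vec_eq_iff forall_2 alg by simp
qed

lemma v_measure: "measure_on {0<..<c} (\<lambda>E. J *v pencil_times q w (cnj lam) v_mid E)"
proof -
  obtain K where v: "dominated v_left v_right K" using v_dominated ..
  obtain V where V: "\<And>x. 0 < x \<Longrightarrow> x < c \<Longrightarrow> norm (v_mid x) \<le> V"
    by (rule dominated_bounded[OF v c_pos]) blast
  have "measure_on {0<..<c} (pencil_times q w (cnj lam) v_mid)"
    by (rule pencil_times_measure[OF v_mid_measurable, where B=V]) (use V in auto)
  then show ?thesis by (rule measure_on_bounded_linear[OF bounded_linear_J])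
qed

text \<open>
  Let \<open>a = u\<^sup>+(s)\<close> and \<open>y = u\<^sup>-(t)\<close>, both conjugated, and let \<open>\<rho>\<close> be the growth factor of \<open>\<tau>\<close> over \<open>I = (s,t)\<close>.
  Up to the factor \<open>\<tau>\<^sup>+(s)\<close> the increment of \<open>v\<close> over \<open>I\<close> is
  \<open>\<rho> y - a = (\<rho> - 1)(y - a) + (\<rho> - 1) a + (y - a)\<close>. The first term is of second order; in the others
  \<open>\<rho> - 1\<close> may be replaced by \<open>\<sigma>(I)\<close>, and the integrand of the equation for \<open>u\<close> by its right limit at \<open>s\<close>. What
  remains is, by \<open>pencil_cnj_mult\<close>, the increment that the equation for \<open>v\<close> demands with its integrand
  frozen at its right limit as well.
\<close>

lemma v_quadratic:
  "\<exists>C\<ge>0. \<forall>s t. 0 < s \<longrightarrow> s < t \<longrightarrow> t < c \<longrightarrow>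
     norm (v_left t - v_right s - J *v pencil_times q w (cnj lam) v_mid {s<..<t}) \<le> C * (measure majorant {s<..<t})\<^sup>2"
proof -
  obtain Ku where u: "dominated (left_lim u) (right_lim u) Ku" using u_dominated ..
  obtain Kv where v: "dominated v_left v_right Kv" using v_dominated ..
  have K: "0 \<le> Ku" "0 \<le> Kv" using dominated_const_nonneg u v by auto
  obtain U where U: "0 \<le> U" "\<And>x. 0 < x \<Longrightarrow> x < c \<Longrightarrow> norm (right_lim u x) \<le> U"
    using dominated_bounded[OF u c_pos] by metis
  obtain L where L: "0 \<le> L" "\<And>E. E \<in> sets borel \<Longrightarrow> E \<subseteq> {0<..<c} \<Longrightarrow> norm (exp (Phi E)) \<le> L"
    "\<And>E. E \<in> sets borel \<Longrightarrow> E \<subseteq> {0<..<c} \<Longrightarrow> norm (exp (Phi E) - 1) \<le> L * measure majorant E"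
    "\<And>E. E \<in> sets borel \<Longrightarrow> E \<subseteq> {0<..<c} \<Longrightarrow> norm (exp (Phi E) - 1 - skew E) \<le> L * (measure majorant E)\<^sup>2"
    using exp_Phi_approx by metis
  define C where "C = L * (L * Ku + L * U + Ku) + Kv"
  have "norm (v_left t - v_right s - J *v pencil_times q w (cnj lam) v_mid {s<..<t}) \<le> C * (measure majorant {s<..<t})\<^sup>2"
    if st: "0 < s" "s < t" "t < c" for s t
  proof -
    let ?E = "{s<..<t}" and ?m = "measure majorant {s<..<t}"
    have E: "?E \<in> sets borel" "?E \<subseteq> {0<..<c}" "?E \<subseteq> {s..t}" using st by auto
    have sub: "measure majorant {s<..x} \<le> ?m" if "x < t" for x by (rule measure_mono) (use that in auto)
    define a y where "a = right_lim u s" and "y = left_lim u t"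
    define \<rho> where "\<rho> = exp (Phi ?E)"
    define X where "X = vec_cnj (J *v (pencil q w lam ?E *v a))"
    define D' where "D' = J *v pencil_times q w (cnj lam) v_mid ?E"
    have ya: "y - a = J *v pencil_times q w lam u ?E"
      unfolding y_def a_def D_open[OF st, symmetric] by (rule D_eq[of s t]) (use st E in auto)
    have "norm (pencil_times q w lam u ?E - pencil q w lam ?E *v a) \<le> (Ku * ?m) * ?m"
    proof (rule pencil_times_approx[OF E(1,2) refl u_measurable])
      fix x assume x: "x \<in> ?E"
      have "norm (u x - a) \<le> Ku * measure majorant {s<..x}"
        unfolding a_def using u_mid[of x] dominated_mid_right[OF u, of s x] x st by simp
      also have "\<dots> \<le> Ku * ?m" using x by (intro mult_left_mono sub K) auto
      finally show "norm (u x - a) \<le> Ku * ?m" .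
    qed (use K in simp)
    moreover have "vec_cnj y - vec_cnj a - X = vec_cnj (J *v (pencil_times q w lam u ?E - pencil q w lam ?E *v a))"
      unfolding X_def vec_cnj_diff[symmetric] ya by (simp add: matrix_vector_mult_diff_distrib)
    ultimately have first: "norm (vec_cnj y - vec_cnj a - X) \<le> Ku * ?m\<^sup>2"
      by (simp add: norm_vec_cnj norm_J_mult power2_eq_square mult.assoc)
    have jp: "J *v (pencil q w (cnj lam) ?E *v (k *s vec_cnj a)) = k *s (X + skew ?E *s vec_cnj a)" for k
      unfolding X_def pencil_cnj_mult[OF E(1,3) st(1,3), symmetric]
      by (simp add: vec_eq_iff forall_2 J_mult matrix_vector_mult_def sum_2 algebra_simps)
    have "norm (pencil_times q w (cnj lam) v_mid ?E - pencil q w (cnj lam) ?E *v v_right s) \<le> (Kv * ?m) * ?m"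
    proof (rule pencil_times_approx[OF E(1,2) _ v_mid_measurable])
      fix x assume x: "x \<in> ?E"
      have "norm (v_mid x - v_right s) \<le> Kv * measure majorant {s<..x}"
        using dominated_mid_right[OF v, of s x] x st by simp
      also have "\<dots> \<le> Kv * ?m" using x by (intro mult_left_mono sub K) auto
      finally show "norm (v_mid x - v_right s) \<le> Kv * ?m" .
    qed (use K in simp_all)
    moreover have "D' - tau_right s *s (X + skew ?E *s vec_cnj a)
       = J *v (pencil_times q w (cnj lam) v_mid ?E - pencil q w (cnj lam) ?E *v v_right s)"
      unfolding D'_def using jp[of "tau_right s"] by (simp only: a_def matrix_vector_mult_diff_distrib)
    ultimately have second: "norm (D' - tau_right s *s (X + skew ?E *s vec_cnj a)) \<le> Kv * ?m\<^sup>2"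
      by (simp add: norm_J_mult power2_eq_square mult.assoc)
    have split: "v_left t - v_right s - D'
      = tau_right s *s ((\<rho> - 1) *s (vec_cnj y - vec_cnj a) + (\<rho> - 1 - skew ?E) *s vec_cnj a + (vec_cnj y - vec_cnj a - X))
        - (D' - tau_right s *s (X + skew ?E *s vec_cnj a))"
      unfolding tau_left_split[OF st] \<rho>_def[symmetric] y_def[symmetric] a_def[symmetric]
      by (simp add: vec_eq_iff algebra_simps)
    have "norm (vec_cnj y - vec_cnj a) \<le> Ku * ?m"
      using dominated_mp[OF u st] by (simp add: y_def a_def norm_vec_cnj flip: vec_cnj_diff)
    then have t1: "norm ((\<rho> - 1) *s (vec_cnj y - vec_cnj a)) \<le> (L * ?m) * (Ku * ?m)"
      unfolding norm_smult \<rho>_def by (intro mult_mono L(3) E) (use L in auto)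
    have t2: "norm ((\<rho> - 1 - skew ?E) *s vec_cnj a) \<le> (L * ?m\<^sup>2) * U"
      unfolding norm_smult \<rho>_def norm_vec_cnj a_def by (intro mult_mono L(4) E U) (use st L in auto)
    have "norm ((\<rho> - 1) *s (vec_cnj y - vec_cnj a) + (\<rho> - 1 - skew ?E) *s vec_cnj a + (vec_cnj y - vec_cnj a - X))
       \<le> (L * ?m) * (Ku * ?m) + (L * ?m\<^sup>2) * U + Ku * ?m\<^sup>2"
      by (intro norm_triangle_mono t1 t2 first)
    also have "\<dots> = (L * Ku + L * U + Ku) * ?m\<^sup>2" by (simp add: power2_eq_square algebra_simps)
    finally have "norm (tau_right s *s ((\<rho> - 1) *s (vec_cnj y - vec_cnj a) + (\<rho> - 1 - skew ?E) *s vec_cnj a + (vec_cnj y - vec_cnj a - X)))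
       \<le> L * ((L * Ku + L * U + Ku) * ?m\<^sup>2)"
      unfolding norm_smult tau_right_def by (intro mult_mono L(2)) (use st L(1) in auto)
    then have "norm (v_left t - v_right s - D') \<le> L * ((L * Ku + L * U + Ku) * ?m\<^sup>2) + Kv * ?m\<^sup>2"
      unfolding split using second by (rule norm_triangle_le_diff[OF add_mono])
    then show ?thesis unfolding D'_def C_def by (simp add: algebra_simps)
  qed
  moreover have "0 \<le> C" unfolding C_def using L(1) U(1) K by simp
  ultimately show ?thesis by blast
qed

lemma v_equation:
  assumes st: "0 < s" "s < t" "t < c"
  shows "v_right t - v_right s = J *v pencil_times q w (cnj lam) v_mid {s<..t}"
proof -
  let ?D = "\<lambda>E. J *v pencil_times q w (cnj lam) v_mid E"
  obtain C where C: "0 \<le> C" "\<And>s t. 0 < s \<Longrightarrow> s < t \<Longrightarrow> t < c \<Longrightarrow>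
     norm (v_left t - v_right s - ?D {s<..<t}) \<le> C * (measure majorant {s<..<t})\<^sup>2"
    using v_quadratic by blast
  have "v_left t - v_right s = ?D {s<..<t}"
    by (rule interval_identity[where g\<^sub>m=v_left and g\<^sub>p=v_right and D="?D", OF v_measure C(1) _ C(2) st])
       (rule v_jump)
  moreover have "v_right t - v_left t = ?D {t}" by (rule v_jump) (use st in auto)
  moreover have "?D ({s<..<t} \<union> {t}) = ?D {s<..<t} + ?D {t}"
    by (rule measure_on_Un[OF v_measure]) (use st in auto)
  moreover have "{s<..<t} \<union> {t} = {s<..t}" using st by auto
  moreover have "v_right t - v_right s = (v_left t - v_right s) + (v_right t - v_left t)" by simp
  ultimately show ?thesis by (simp only:)
qed

context
  fixes v_minus v :: "real \<Rightarrow> complex^2"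
  assumes v_minus: "\<And>x. 0 < x \<Longrightarrow> x < c \<Longrightarrow> v_minus x = tau q w x (cnj lam) *s vec_cnj (left_lim u x)"
    and v: "\<And>x. 0 < x \<Longrightarrow> x < c \<Longrightarrow> v x = (1/2) *\<^sub>R (v_minus x + right_lim v_minus x)"
begin

lemma v_minus_eq: "0 < x \<Longrightarrow> x < c \<Longrightarrow> v_minus x = v_left x"
  using v_minus tau_exp_Phi[of x] by (simp add: tau_left_def)

text \<open>
  By \<open>tau_exp_Phi\<close> the given function \<open>v_minus\<close> is \<open>v_left\<close>, whose right limits are \<open>v_right\<close>.
\<close>

lemma v_eq_mid: assumes x: "0 < x" "x < c" shows "v x = v_mid x"
proof -
  obtain K where d: "dominated v_left v_right K" using v_dominated ..
  have "(v_minus \<longlongrightarrow> v_right x) (at_right x)"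
  proof (rule Lim_transform_eventually[OF dominated_right_limit_m[OF d x]])
    have "eventually (\<lambda>t. t \<in> {x<..<c}) (at_right x)" by (rule eventually_at_right_real[OF x(2)])
    then show "eventually (\<lambda>t. v_left t = v_minus t) (at_right x)"
      by eventually_elim (use x v_minus_eq in auto)
  qed
  then show ?thesis using v[OF x] v_minus_eq[OF x] right_lim_eq unfolding mid_def by metis
qed

lemma v_lims:
  assumes x: "0 < x" "x < c"
  shows "left_lim v x = v_left x" "right_lim v x = v_right x"
proof -
  obtain K where d: "dominated v_left v_right K" using v_dominated ..
  have ev1: "eventually (\<lambda>t. v_mid t = v t) (at_right x)"
    using eventually_at_right_real[OF x(2)] by eventually_elim (use x v_eq_mid in auto)
  have ev2: "eventually (\<lambda>t. v_mid t = v t) (at_left x)"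
    using eventually_at_left_real[OF x(1)] by eventually_elim (use x v_eq_mid in auto)
  show "left_lim v x = v_left x" "right_lim v x = v_right x"
    by (rule left_lim_eq[OF Lim_transform_eventually[OF dominated_left_limit_mid[OF d x] ev2]]
        right_lim_eq[OF Lim_transform_eventually[OF dominated_right_limit_mid[OF d x] ev1]])+
qed

lemma v_bounded_variation:
  assumes "0 < s" "t < c" shows "bounded_variation_on s t v"
proof -
  obtain K where d: "dominated v_left v_right K" using v_dominated ..
  show ?thesis
    by (rule bounded_variation_onI[where G="\<lambda>x. K * (measure majorant {..<x} + measure majorant {..x})"])
       (use dominated_mid[OF d] v_eq_mid assms in auto)
qed

lemma v_pencil_times:
  assumes "E \<in> sets borel" "E \<subseteq> {0<..<c}"
  shows "pencil_times q w (cnj lam) v_mid E = pencil_times q w (cnj lam) v E"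
  by (rule pencil_times_cong[OF assms(1)]) (use v_eq_mid assms(2) in auto)

lemma v_solution_measure: "measure_on {0<..<c} (\<lambda>E. J *v pencil_times q w (cnj lam) v E)"
  by (rule measure_on_cong[OF _ v_measure]) (simp add: v_pencil_times)

lemma v_solution_increment:
  assumes st: "0 < s" "s < t" "t < c"
  shows "J *v pencil_times q w (cnj lam) v {s<..t} = right_lim v t - right_lim v s"
proof -
  have "pencil_times q w (cnj lam) v_mid {s<..t} = pencil_times q w (cnj lam) v {s<..t}"
    by (rule v_pencil_times) (use st in auto)
  then show ?thesis using v_equation[OF st] v_lims st by simp
qed

lemma v_balanced: "0 < x \<Longrightarrow> x < c \<Longrightarrow> v x = (1/2) *\<^sub>R (left_lim v x + right_lim v x)"
  using v_eq_mid v_lims by (simp add: mid_def)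

lemma v_initial_value: "\<exists>u0. (u \<longlongrightarrow> u0) (at_right 0) \<and> (v \<longlongrightarrow> vec_cnj u0) (at_right 0)"
proof -
  obtain K where d: "dominated (left_lim u) (right_lim u) K" using u_dominated ..
  obtain u0 where u0: "(left_lim u \<longlongrightarrow> u0) (at_right 0)" "(right_lim u \<longlongrightarrow> u0) (at_right 0)"
    "(mid (left_lim u) (right_lim u) \<longlongrightarrow> u0) (at_right 0)"
    by (rule dominated_limit_0[OF d c_pos])
  have ev: "eventually (\<lambda>x. x \<in> {0<..<c}) (at_right 0)" by (rule eventually_at_right_real[OF c_pos])
  have "(u \<longlongrightarrow> u0) (at_right 0)"
    by (rule Lim_transform_eventually[OF u0(3)]) (use ev in eventually_elim, use u_mid in auto)
  moreover have "(v_mid \<longlongrightarrow> (1/2) *\<^sub>R (1 *s vec_cnj u0 + 1 *s vec_cnj u0)) (at_right 0)"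
    unfolding mid_def
    by (intro tendsto_scaleR tendsto_const tendsto_add tendsto_smult tendsto_vec_cnj u0 tau_limit_0)
  then have "(v_mid \<longlongrightarrow> vec_cnj u0) (at_right 0)" by (simp flip: scaleR_2)
  then have "(v \<longlongrightarrow> vec_cnj u0) (at_right 0)"
    by (rule Lim_transform_eventually) (use ev in eventually_elim, use v_eq_mid in auto)
  ultimately show ?thesis by blast
qed

end

end

lemma exists_above_in_ival:
  assumes "s \<in> ival b" "t \<in> ival b"
  obtains c where "c \<in> ival b" "s < c" "t < c"
proof -
  have "ereal (max s t) < b" using assms by (auto simp: ival_def max_def)
  then obtain c where c: "ereal (max s t) < ereal c" "ereal c < b" using ereal_dense2 by blast
  then have "c \<in> ival b" "s < c" "t < c" using assms by (auto simp: ival_def)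
  then show ?thesis by (rule that)
qed

theorem lemma2p2:
  fixes b :: ereal
    and q w :: "real set \<Rightarrow> complex^2^2"
    and lam :: complex
    and u v_minus v :: "real \<Rightarrow> complex^2"
  assumes b_pos: "0 < b"
    and q_local: "local_measure b q"
    and w_local: "local_measure b w"
    and q_regular: "finite_near_0 b q"
    and w_regular: "finite_near_0 b w"
    and q_hermitian: "\<forall>E\<in>local_sets b. hermitian (q E)"
    and w_nonneg: "\<forall>E\<in>local_sets b. nonneg_hermitian (w E)"
    and w_nonzero: "\<exists>E\<in>local_sets b. w E \<noteq> 0"
    and Lambda_proper: "Lambda b q w \<noteq> UNIV"
    and lambda: "lam \<notin> Lambda b q w"
    and u_solution: "solution b q w lam u"
    and v_minus: "\<forall>x\<in>ival b. v_minus x = tau q w x (cnj lam) *s vec_cnj (left_lim u x)"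
    and v: "\<forall>x\<in>ival b. v x = (1/2) *\<^sub>R (v_minus x + right_lim v_minus x)"
  shows "solution b q w (cnj lam) v \<and>
    (\<exists>u0. (u \<longlongrightarrow> u0) (at_right 0) \<and> (v \<longlongrightarrow> vec_cnj u0) (at_right 0))"
proof -
  obtain du where du: "local_measure b du"
    "\<And>s t. s \<in> ival b \<Longrightarrow> t \<in> ival b \<Longrightarrow> s < t \<Longrightarrow> du {s<..t} = right_lim u t - right_lim u s"
    "\<And>E. E \<in> local_sets b \<Longrightarrow> J *v du E + times_fun q u E = lam *s times_fun w u E"
    using u_solution unfolding solution_def stieltjes_measure_def by blast
  have u_bv: "locally_bv b u" and u_bal: "balanced b u" using u_solution unfolding solution_def by auto
  have below: "x \<in> ival b" if "0 < x" "x \<le> c" "c \<in> ival b" for x c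
    using that by (auto simp: ival_def intro: le_less_trans[of "ereal x" "ereal c"])
  have local: "E \<in> local_sets b" if "E \<in> sets borel" "E \<subseteq> {s..t}" "0 < s" "t < c" "c \<in> ival b" for E s t c
  proof (cases "s \<le> t")
    case True
    then have "s \<in> ival b" "t \<in> ival b" using that by (auto intro: below[of _ c])
    then show ?thesis unfolding local_sets_def using that by blast
  next
    case False
    then have "E = {}" using that by auto
    then show ?thesis unfolding local_sets_def using that(5) by auto
  qed
  have sol: "solution_on q w c lam u du" if c: "c \<in> ival b" for c
  proof (intro solution_on.intro regular_system.intro solution_on_axioms.intro)
    show "0 < c" using c by (simp add: ival_def)
    show "measure_on {0<..<c} q" "measure_on {0<..<c} w"
      using q_regular w_regular c unfolding finite_near_0_def by auto
    show "hermitian (q E) \<and> hermitian (w E)" if "E \<in> sets borel" "E \<subseteq> {s..t}" "0 < s" "t < c" for E s t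
      using local[OF that c] q_hermitian w_nonneg unfolding nonneg_hermitian_def by auto
    show "det (B_plus q w y lam) * det (B_minus q w y lam) \<noteq> 0" if "0 < y" "y < c" for y
      using lambda below[of y c] that c unfolding Lambda_def by auto
    show "bounded_variation_on s t u" if "0 < s" "t \<le> c" for s t
    proof (cases "s \<le> t")
      case True
      then have "s \<in> ival b" "t \<in> ival b" using that c by (auto intro: below[of _ c])
      then show ?thesis using u_bv unfolding locally_bv_def by blast
    next
      case False
      then show ?thesis by (intro bounded_variation_onI[where G="\<lambda>_. 0"]) auto
    qed
    show "u x = (1/2) *\<^sub>R (left_lim u x + right_lim u x)" if "0 < x" "x < c" for x
      using u_bal below[of x c] that c unfolding balanced_def by auto
    show "measure_on {s..t} du" if "0 < s" "t < c" for s t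
    proof (cases "s \<le> t")
      case True
      then have "s \<in> ival b" "t \<in> ival b" using that c by (auto intro: below[of _ c])
      then show ?thesis using du(1) unfolding local_measure_def by blast
    next
      case False
      have "measure_on {c..c} du" using du(1) c unfolding local_measure_def by blast
      then show ?thesis by (rule measure_on_subset) (use False in auto)
    qed
    show "du {s<..t} = right_lim u t - right_lim u s" if "0 < s" "s < t" "t < c" for s t
      using that c by (intro du(2)) (auto intro: below[of _ c])
    show "du E = J *v pencil_times q w lam u E" if "0 < s" "t < c" "E \<in> sets borel" "E \<subseteq> {s..t}" for E s t
    proof -
      have "J *v du E + times_fun q u E = lam *s times_fun w u E"
        by (rule du(3)[OF local[OF that(3,4,1,2) c]])
      then have "pencil_times q w lam u E = - (J *v du E)"
        unfolding pencil_times_def by (simp add: algebra_simps eq_neg_iff_add_eq_0)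
      then show ?thesis by (simp add: J_uminus J_J)
    qed
  qed
  have vc: "v_minus x = tau q w x (cnj lam) *s vec_cnj (left_lim u x)"
    "v x = (1/2) *\<^sub>R (v_minus x + right_lim v_minus x)" if "0 < x" "x < c" "c \<in> ival b" for x c
    using v_minus v below[of x c] that by auto
  \<comment> \<open>The equation dictates the derivative of \<open>v\<close>, as \<open>J\<close> is invertible with inverse \<open>- J\<close>. It remains to
    see that this measure generates \<open>v\<close>, which is checked on bounded intervals \<open>(0,c)\<close>.\<close>
  define dv where "dv E = J *v pencil_times q w (cnj lam) v E" for E
  have "locally_bv b v"
    unfolding locally_bv_def
  proof (intro ballI)
    fix s t assume st: "s \<in> ival b" "t \<in> ival b"
    then obtain c where c: "c \<in> ival b" "s < c" "t < c" by (rule exists_above_in_ival)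
    interpret solution_on q w c lam u du by (rule sol[OF c(1)])
    show "bounded_variation_on s t v"
      by (rule v_bounded_variation[OF vc[OF _ _ c(1)]]) (use st c in \<open>auto simp: ival_def\<close>)
  qed
  moreover have "balanced b v"
    unfolding balanced_def
  proof
    fix x assume x: "x \<in> ival b"
    from x x obtain c where c: "c \<in> ival b" "x < c" by (rule exists_above_in_ival)
    interpret solution_on q w c lam u du by (rule sol[OF c(1)])
    show "v x = (1/2) *\<^sub>R (left_lim v x + right_lim v x)"
      by (rule v_balanced[OF vc[OF _ _ c(1)]]) (use x c in \<open>auto simp: ival_def\<close>)
  qed
  moreover have "stieltjes_measure b v dv"
    unfolding stieltjes_measure_def local_measure_def
  proof (intro conjI ballI impI)
    fix s t assume st: "s \<in> ival b" "t \<in> ival b"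
    then obtain c where c: "c \<in> ival b" "s < c" "t < c" by (rule exists_above_in_ival)
    interpret solution_on q w c lam u du by (rule sol[OF c(1)])
    have "measure_on {0<..<c} dv"
      unfolding dv_def by (rule v_solution_measure[OF vc[OF _ _ c(1)]])
    then show "measure_on {s..t} dv"
      by (rule measure_on_subset) (use st c in \<open>auto simp: ival_def\<close>)
    show "dv {s<..t} = right_lim v t - right_lim v s" if "s < t"
      unfolding dv_def
      by (rule v_solution_increment[OF vc[OF _ _ c(1)]]) (use st c that in \<open>auto simp: ival_def\<close>)
  qed
  moreover have "J *v dv E + times_fun q v E = cnj lam *s times_fun w v E" for E
    unfolding dv_def J_J pencil_times_def by simp
  ultimately have "solution b q w (cnj lam) v"
    unfolding solution_def by blast
  moreover obtain c where c: "c \<in> ival b"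
  proof -
    obtain c where "0 < ereal c" "ereal c < b" using ereal_dense2[OF b_pos] by blast
    then show ?thesis by (intro that[of c]) (simp add: ival_def)
  qed
  interpret solution_on q w c lam u du by (rule sol[OF c])
  have "\<exists>u0. (u \<longlongrightarrow> u0) (at_right 0) \<and> (v \<longlongrightarrow> vec_cnj u0) (at_right 0)"
    by (rule v_initial_value[OF vc[OF _ _ c]])
  ultimately show ?thesis by blast
qed

end
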